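(* Let $\Delta^{\mathcal H}$ be a sublaplacian of a sub-Riemannian manifold $(M,\Sigma,g_c)$. If $\Sigma$ satisfies the Hörmander condition and $M$ is a closed, connected manifold, then any horizontal-harmonic function $u$ on $M$, i.e. any smooth function $u$ satisfying $\Delta^{\mathcal H}u=0$, is constant.
   Context: A sub-Riemannian manifold $(M,\Sigma,g_c)$ is a smooth manifold $M$ of dimension $m$ with a smooth distribution (subbundle) $\Sigma\subset TM$ of rank $k<m$, assumed not integrable, and a smooth inner product $g_c$ on $\Sigma$. $\Gamma(\Sigma)$ denotes the smooth (horizontal) vector fields tangent to $\Sigma$. Given a complement $\Sigma'$ of $\Sigma$, $TM=\Sigma\oplus\Sigma'$, let $\mathcal P$, also written $(\cdot)^{\mathcal H}$, be the projection onto $\Sigma$ along $\Sigma'$. An orthogonal extension of $g_c$ is a Riemannian metric $g$ on $M$ with $g|_\Sigma=g_c$ and $\Sigma\perp\Sigma'$; $\nabla$ denotes its Levi-Civita connection. The horizontal connection $D$ is the unique connection on $\Sigma$ with, for all $X,Y,Z\in\Gamma(\Sigma)$, $Xg_c(Y,Z)=g_c(D_XY,Z)+g_c(Y,D_XZ)$ and $D_XY-D_YX=[X,Y]^{\mathcal H}$ (equivalently $D_XY=\mathcal P(\nabla_XY)$ for any orthogonal extension $g$). The horizontal gradient $\nabla^{\mathcal H}f\in\Gamma(\Sigma)$ is defined by $g_c(\nabla^{\mathcal H}f,X)=Xf$ for all $X\in\Gamma(\Sigma)$. The horizontal divergence is $\mathrm{div}^{\mathcal H}X=\sum_{i=1}^kg_c(D_{X_i}X,X_i)$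 for $X\in\Gamma(\Sigma)$ and any (local) orthonormal basis $\{X_i\}$ of $\Sigma$. Put $\Delta^{\mathcal H}=\mathrm{div}^{\mathcal H}\circ\nabla^{\mathcal H}$ (it depends on $(\Sigma,g_c)$ and the splitting). Sublaplacian: fix a complement $\Sigma'$ for which there are an orthogonal extension $g$ of $g_c$ and a $g$-orthonormal basis (local frame) $\{T'_1,\dots,T'_{m-k}\}$ of $\Sigma'$ with $\mathcal P(\nabla_{T'_\beta}T'_\beta)=0$ for $\beta=1,\dots,m-k$. The operator $\Delta^{\mathcal H}$ with respect to such a splitting $TM=\Sigma\oplus\Sigma'$ is called a sublaplacian of $(M,\Sigma,g_c)$ (the sublaplacian if such a complement is unique). Hörmander condition: let $\Sigma_i$ be the set of vector fields spanned by all commutators of order $\le i$ of vector fields in $\Sigma$ and $\Sigma_i(p)\subset T_pM$ the subspace of their values at $p$; $\Sigma$ satisfies the Hörmander (Chow) condition if for every $p\in M$ there is an integer $r(p)$ with $\Sigma_{r(p)}(p)=T_pM$. Closed means compact without boundary. *)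

theory Defs
  imports "HOL-Analysis.Analysis" "HOL-Library.Function_Algebras"
begin

section \<open>Real-valued functions as a real vector space\<close>

text \<open>Tangent vectors are operators on functions and vector fields are functions into tangent
  vectors, so the pointwise structure makes \<open>subspace\<close>, \<open>span\<close> and \<open>dim\<close> available for both.\<close>

instantiation "fun" :: (type, real_vector) real_vector
begin

definition scaleR_fun :: "real \<Rightarrow> ('a \<Rightarrow> 'b) \<Rightarrow> 'a \<Rightarrow> 'b"
  where "scaleR_fun c f = (\<lambda>x. c *\<^sub>R f x)"

instance
  by standard
    (simp_all add: scaleR_fun_def fun_eq_iff scaleR_add_right scaleR_add_left)

end

section \<open>Smooth manifolds\<close>

text \<open>Used for open \<open>S\<close> only, where \<open>frechet_derivative\<close> at interior points is unambiguous.\<close>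

primrec higher_differentiable_on ::
    "nat \<Rightarrow> 'e::euclidean_space set \<Rightarrow> ('e \<Rightarrow> 'b::real_normed_vector) \<Rightarrow> bool" where
  "higher_differentiable_on 0 S f \<longleftrightarrow> continuous_on S f"
| "higher_differentiable_on (Suc n) S f \<longleftrightarrow>
     (\<forall>x\<in>S. f differentiable (at x)) \<and>
     (\<forall>v. higher_differentiable_on n S (\<lambda>x. frechet_derivative f (at x) v))"

definition smooth_on :: "'e::euclidean_space set \<Rightarrow> ('e \<Rightarrow> 'b::real_normed_vector) \<Rightarrow> bool"
  where "smooth_on S f \<longleftrightarrow> (\<forall>n. higher_differentiable_on n S f)"

text \<open>The manifold is the whole type \<open>'a\<close>, its dimension is \<open>DIM('e)\<close>. A chart is a pair of its
  domain and its coordinate map; the values of the coordinate map off the domain are irrelevant.\<close>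

type_synonym ('a, 'e) chart = "'a set \<times> ('a \<Rightarrow> 'e)"

definition is_chart :: "('a::topological_space, 'e::euclidean_space) chart \<Rightarrow> bool"
  where "is_chart = (\<lambda>(U, \<phi>). open U \<and> open (\<phi> ` U) \<and> homeomorphism U (\<phi> ` U) \<phi> (inv_into U \<phi>))"

definition smooth_transition ::
    "('a, 'e::euclidean_space) chart \<Rightarrow> ('a, 'e) chart \<Rightarrow> bool"
  where "smooth_transition = (\<lambda>(U, \<phi>) (V, \<psi>). smooth_on (\<phi> ` (U \<inter> V)) (\<psi> \<circ> inv_into U \<phi>))"

definition smooth_atlas ::
    "('a::{t2_space, second_countable_topology}, 'e::euclidean_space) chart set \<Rightarrow> bool"
  where "smooth_atlas A \<longleftrightarrow>
    (\<forall>c\<in>A. is_chart c) \<and> (\<Union>c\<in>A. fst c) = UNIV \<and> (\<forall>c\<in>A. \<forall>d\<in>A. smooth_transition c d)"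

text \<open>Membership in the maximal atlas determined by \<open>A\<close>.\<close>

definition compatible_chart ::
    "('a::topological_space, 'e::euclidean_space) chart set \<Rightarrow> ('a, 'e) chart \<Rightarrow> bool"
  where "compatible_chart A c \<longleftrightarrow>
    is_chart c \<and> (\<forall>d\<in>A. smooth_transition c d \<and> smooth_transition d c)"

definition smooth_fun ::
    "('a, 'e::euclidean_space) chart set \<Rightarrow> 'a set \<Rightarrow> ('a \<Rightarrow> real) \<Rightarrow> bool"
  where "smooth_fun A U f \<longleftrightarrow> (\<forall>(V, \<phi>)\<in>A. smooth_on (\<phi> ` (U \<inter> V)) (f \<circ> inv_into V \<phi>))"

definition smooth_near ::
    "('a::topological_space, 'e::euclidean_space) chart set \<Rightarrow> 'a \<Rightarrow> ('a \<Rightarrow> real) \<Rightarrow> bool"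
  where "smooth_near A p f \<longleftrightarrow> (\<exists>U. open U \<and> p \<in> U \<and> smooth_fun A U f)"

section \<open>Tangent vectors and vector fields\<close>

text \<open>A tangent vector at \<open>p\<close> is the operator of directional derivative, in some chart, on the
  functions that are smooth near \<open>p\<close>. It is set to zero on all other functions, so that equality
  of operators is equality of tangent vectors.\<close>

type_synonym 'a tvec = "('a \<Rightarrow> real) \<Rightarrow> real"
type_synonym 'a vfield = "'a \<Rightarrow> 'a tvec"

definition coord_vector ::
    "('a::topological_space, 'e::euclidean_space) chart set \<Rightarrow> ('a, 'e) chart \<Rightarrow> 'a \<Rightarrow> 'e \<Rightarrow> 'a tvec"
  where "coord_vector A = (\<lambda>(V, \<phi>) p w f.
    if smooth_near A p f then frechet_derivative (f \<circ> inv_into V \<phi>) (at (\<phi> p)) w else 0)"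

definition tangent_space ::
    "('a::topological_space, 'e::euclidean_space) chart set \<Rightarrow> 'a \<Rightarrow> 'a tvec set"
  where "tangent_space A p = {coord_vector A c p w | c w. c \<in> A \<and> p \<in> fst c}"

text \<open>Smooth sections over the open set \<open>U\<close> of a family \<open>E\<close> of subspaces of the tangent spaces;
  only the values on \<open>U\<close> matter.\<close>

definition sections ::
    "('a::topological_space, 'e::euclidean_space) chart set \<Rightarrow> ('a \<Rightarrow> 'a tvec set) \<Rightarrow> 'a set \<Rightarrow>
     'a vfield set"
  where "sections A E U = {X. (\<forall>p\<in>U. X p \<in> E p) \<and>
    (\<forall>V f. open V \<and> V \<subseteq> U \<and> smooth_fun A V f \<longrightarrow> smooth_fun A V (\<lambda>p. X p f))}"

definition lie_bracket ::
    "('a::topological_space, 'e::euclidean_space) chart set \<Rightarrow> 'a vfield \<Rightarrow> 'a vfield \<Rightarrow> 'a vfield"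
  where "lie_bracket A X Y = (\<lambda>p f.
    if smooth_near A p f then X p (\<lambda>q. Y q f) - Y p (\<lambda>q. X q f) else 0)"

definition smooth_distribution ::
    "('a::topological_space, 'e::euclidean_space) chart set \<Rightarrow> nat \<Rightarrow> ('a \<Rightarrow> 'a tvec set) \<Rightarrow> bool"
  where "smooth_distribution A r E \<longleftrightarrow>
    (\<forall>p. subspace (E p) \<and> E p \<subseteq> tangent_space A p \<and> dim (E p) = r) \<and>
    (\<forall>p. \<exists>U X. open U \<and> p \<in> U \<and> (\<forall>i<r. X i \<in> sections A E U) \<and>
       (\<forall>q\<in>U. E q = span ((\<lambda>i. X i q) ` {..<r})))"

text \<open>Integrability: around every point there is a foliated chart, i.e. the distribution is
  spanned by coordinate directions from a fixed subspace of the model space.\<close>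

definition integrable_distribution ::
    "('a::topological_space, 'e::euclidean_space) chart set \<Rightarrow> ('a \<Rightarrow> 'a tvec set) \<Rightarrow> bool"
  where "integrable_distribution A E \<longleftrightarrow>
    (\<forall>p. \<exists>c W. compatible_chart A c \<and> p \<in> fst c \<and> subspace W \<and>
       (\<forall>q\<in>fst c. E q = coord_vector A c q ` W))"

section \<open>Metrics and connections\<close>

definition inner_product_on :: "'v::real_vector set \<Rightarrow> ('v \<Rightarrow> 'v \<Rightarrow> real) \<Rightarrow> bool"
  where "inner_product_on V b \<longleftrightarrow>
    (\<forall>x\<in>V. \<forall>y\<in>V. b x y = b y x) \<and>
    (\<forall>x\<in>V. \<forall>y\<in>V. \<forall>z\<in>V. b (x + y) z = b x z + b y z) \<and>
    (\<forall>c. \<forall>x\<in>V. \<forall>y\<in>V. b (c *\<^sub>R x) y = c * b x y) \<and>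
    (\<forall>x\<in>V. x \<noteq> 0 \<longrightarrow> b x x > 0)"

definition orthonormal_basis :: "'v::real_vector set \<Rightarrow> ('v \<Rightarrow> 'v \<Rightarrow> real) \<Rightarrow> 'v set \<Rightarrow> bool"
  where "orthonormal_basis V b B \<longleftrightarrow>
    finite B \<and> span B = V \<and> (\<forall>x\<in>B. \<forall>y\<in>B. b x y = (if x = y then 1 else 0))"

type_synonym 'a metric_tensor = "'a \<Rightarrow> 'a tvec \<Rightarrow> 'a tvec \<Rightarrow> real"

definition smooth_metric ::
    "('a::topological_space, 'e::euclidean_space) chart set \<Rightarrow> ('a \<Rightarrow> 'a tvec set) \<Rightarrow>
     'a metric_tensor \<Rightarrow> bool"
  where "smooth_metric A E g \<longleftrightarrow>
    (\<forall>p. inner_product_on (E p) (g p)) \<and>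
    (\<forall>U. open U \<longrightarrow> (\<forall>X\<in>sections A E U. \<forall>Y\<in>sections A E U.
       smooth_fun A U (\<lambda>p. g p (X p) (Y p))))"

text \<open>\<open>D p v Y\<close> is the covariant derivative at \<open>p\<close> of the (locally defined) section \<open>Y\<close> of \<open>E\<close>
  in the direction \<open>v \<in> E p\<close>. The axioms are imposed over every open set, so that \<open>D\<close> may be
  applied to local frames. For \<open>E = tangent_space A\<close> this is an affine connection.\<close>

type_synonym 'a connection = "'a \<Rightarrow> 'a tvec \<Rightarrow> 'a vfield \<Rightarrow> 'a tvec"

definition is_connection ::
    "('a::topological_space, 'e::euclidean_space) chart set \<Rightarrow> ('a \<Rightarrow> 'a tvec set) \<Rightarrow>
     'a connection \<Rightarrow> bool"
  where "is_connection A E D \<longleftrightarrow> (\<forall>U. open U \<longrightarrow>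
    (\<forall>X\<in>sections A E U. \<forall>Y\<in>sections A E U. (\<lambda>p. D p (X p) Y) \<in> sections A E U) \<and>
    (\<forall>Y\<in>sections A E U. \<forall>p\<in>U. \<forall>v\<in>E p. \<forall>w\<in>E p. D p (v + w) Y = D p v Y + D p w Y) \<and>
    (\<forall>Y\<in>sections A E U. \<forall>p\<in>U. \<forall>v\<in>E p. \<forall>c. D p (c *\<^sub>R v) Y = c *\<^sub>R D p v Y) \<and>
    (\<forall>Y\<in>sections A E U. \<forall>Z\<in>sections A E U. \<forall>p\<in>U. \<forall>v\<in>E p.
       D p v (Y + Z) = D p v Y + D p v Z) \<and>
    (\<forall>Y\<in>sections A E U. \<forall>f. smooth_fun A U f \<longrightarrow> (\<forall>p\<in>U. \<forall>v\<in>E p.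
       D p v (\<lambda>q. f q *\<^sub>R Y q) = v f *\<^sub>R Y p + f p *\<^sub>R D p v Y)))"

definition metric_compatible ::
    "('a::topological_space, 'e::euclidean_space) chart set \<Rightarrow> ('a \<Rightarrow> 'a tvec set) \<Rightarrow>
     'a metric_tensor \<Rightarrow> 'a connection \<Rightarrow> bool"
  where "metric_compatible A E g D \<longleftrightarrow> (\<forall>U. open U \<longrightarrow>
    (\<forall>X\<in>sections A E U. \<forall>Y\<in>sections A E U. \<forall>Z\<in>sections A E U. \<forall>p\<in>U.
       X p (\<lambda>q. g q (Y q) (Z q)) = g p (D p (X p) Y) (Z p) + g p (Y p) (D p (X p) Z)))"

definition levi_civita ::
    "('a::topological_space, 'e::euclidean_space) chart set \<Rightarrow> 'a metric_tensor \<Rightarrow>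
     'a connection \<Rightarrow> bool"
  where "levi_civita A g N \<longleftrightarrow>
    is_connection A (tangent_space A) N \<and> metric_compatible A (tangent_space A) g N \<and>
    (\<forall>U. open U \<longrightarrow>
      (\<forall>X\<in>sections A (tangent_space A) U. \<forall>Y\<in>sections A (tangent_space A) U. \<forall>p\<in>U.
         N p (X p) Y - N p (Y p) X = lie_bracket A X Y p))"

section \<open>Sub-Riemannian manifolds\<close>

definition sub_riemannian ::
    "('a::{t2_space, second_countable_topology}, 'e::euclidean_space) chart set \<Rightarrow> nat \<Rightarrow>
     ('a \<Rightarrow> 'a tvec set) \<Rightarrow> 'a metric_tensor \<Rightarrow> bool"
  where "sub_riemannian A k S gc \<longleftrightarrow>
    smooth_atlas A \<and> k < DIM('e) \<and> smooth_distribution A k S \<and>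
    \<not> integrable_distribution A S \<and> smooth_metric A S gc"

definition complement ::
    "('a::topological_space, 'e::euclidean_space) chart set \<Rightarrow> nat \<Rightarrow> ('a \<Rightarrow> 'a tvec set) \<Rightarrow>
     ('a \<Rightarrow> 'a tvec set) \<Rightarrow> bool"
  where "complement A k S S' \<longleftrightarrow> smooth_distribution A (DIM('e) - k) S' \<and>
    (\<forall>p. S p \<inter> S' p = {0} \<and> {v + w | v w. v \<in> S p \<and> w \<in> S' p} = tangent_space A p)"

definition hproj :: "('a \<Rightarrow> 'a tvec set) \<Rightarrow> ('a \<Rightarrow> 'a tvec set) \<Rightarrow> 'a \<Rightarrow> 'a tvec \<Rightarrow> 'a tvec"
  where "hproj S S' p v = (THE h. h \<in> S p \<and> v - h \<in> S' p)"

definition orthogonal_extension ::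
    "('a::topological_space, 'e::euclidean_space) chart set \<Rightarrow> ('a \<Rightarrow> 'a tvec set) \<Rightarrow>
     ('a \<Rightarrow> 'a tvec set) \<Rightarrow> 'a metric_tensor \<Rightarrow> 'a metric_tensor \<Rightarrow> bool"
  where "orthogonal_extension A S S' gc g \<longleftrightarrow>
    smooth_metric A (tangent_space A) g \<and>
    (\<forall>p. \<forall>v\<in>S p. \<forall>w\<in>S p. g p v w = gc p v w) \<and>
    (\<forall>p. \<forall>v\<in>S p. \<forall>w\<in>S' p. g p v w = 0)"

definition horizontal_connection ::
    "('a::topological_space, 'e::euclidean_space) chart set \<Rightarrow> ('a \<Rightarrow> 'a tvec set) \<Rightarrow>
     ('a \<Rightarrow> 'a tvec set) \<Rightarrow> 'a metric_tensor \<Rightarrow> 'a connection \<Rightarrow> bool"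
  where "horizontal_connection A S S' gc D \<longleftrightarrow>
    is_connection A S D \<and> metric_compatible A S gc D \<and>
    (\<forall>U. open U \<longrightarrow> (\<forall>X\<in>sections A S U. \<forall>Y\<in>sections A S U. \<forall>p\<in>U.
       D p (X p) Y - D p (Y p) X = hproj S S' p (lie_bracket A X Y p)))"

definition hgrad ::
    "('a::topological_space, 'e::euclidean_space) chart set \<Rightarrow> ('a \<Rightarrow> 'a tvec set) \<Rightarrow>
     'a metric_tensor \<Rightarrow> ('a \<Rightarrow> real) \<Rightarrow> 'a vfield"
  where "hgrad A S gc f = (THE W. W \<in> sections A S UNIV \<and>
    (\<forall>X\<in>sections A S UNIV. \<forall>p. gc p (W p) (X p) = X p f))"

text \<open>The trace does not depend on the orthonormal basis that is chosen.\<close>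

definition hdiv ::
    "('a \<Rightarrow> 'a tvec set) \<Rightarrow> 'a metric_tensor \<Rightarrow> 'a connection \<Rightarrow> 'a vfield \<Rightarrow> 'a \<Rightarrow> real"
  where "hdiv S gc D X p =
    (\<Sum>e\<in>(SOME B. orthonormal_basis (S p) (gc p) B). gc p (D p e X) e)"

definition hlaplacian ::
    "('a::topological_space, 'e::euclidean_space) chart set \<Rightarrow> ('a \<Rightarrow> 'a tvec set) \<Rightarrow>
     'a metric_tensor \<Rightarrow> 'a connection \<Rightarrow> ('a \<Rightarrow> real) \<Rightarrow> 'a \<Rightarrow> real"
  where "hlaplacian A S gc D f = hdiv S gc D (hgrad A S gc f)"

text \<open>The condition on the complement: orthonormal frames of \<open>S'\<close> with
  \<open>P (\<nabla>\<^bsub>T i\<^esub> (T i)) = 0\<close> exist locally, for one global orthogonal extension.\<close>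

definition sublaplacian_complement ::
    "('a::topological_space, 'e::euclidean_space) chart set \<Rightarrow> nat \<Rightarrow> ('a \<Rightarrow> 'a tvec set) \<Rightarrow>
     'a metric_tensor \<Rightarrow> ('a \<Rightarrow> 'a tvec set) \<Rightarrow> bool"
  where "sublaplacian_complement A k S gc S' \<longleftrightarrow> complement A k S S' \<and>
    (\<exists>g N. orthogonal_extension A S S' gc g \<and> levi_civita A g N \<and>
      (\<forall>p. \<exists>U T. open U \<and> p \<in> U \<and>
        (\<forall>i<DIM('e) - k. T i \<in> sections A S' U) \<and>
        (\<forall>q\<in>U. \<forall>i<DIM('e) - k. \<forall>j<DIM('e) - k.
           g q (T i q) (T j q) = (if i = j then 1 else 0)) \<and>
        (\<forall>q\<in>U. \<forall>i<DIM('e) - k. hproj S S' q (N q (T i q) (T i)) = 0)))"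

definition sublaplacian ::
    "('a::topological_space, 'e::euclidean_space) chart set \<Rightarrow> nat \<Rightarrow> ('a \<Rightarrow> 'a tvec set) \<Rightarrow>
     'a metric_tensor \<Rightarrow> (('a \<Rightarrow> real) \<Rightarrow> 'a \<Rightarrow> real) \<Rightarrow> bool"
  where "sublaplacian A k S gc L \<longleftrightarrow>
    (\<exists>S' D. sublaplacian_complement A k S gc S' \<and> horizontal_connection A S S' gc D \<and>
       L = hlaplacian A S gc D)"

section \<open>The bracket-generating condition\<close>

text \<open>\<open>commutator A S n X\<close>: \<open>X\<close> is an iterated Lie bracket of \<open>n\<close> horizontal fields.\<close>

inductive commutator ::
    "('a::topological_space, 'e::euclidean_space) chart set \<Rightarrow> ('a \<Rightarrow> 'a tvec set) \<Rightarrow> nat \<Rightarrow>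
     'a vfield \<Rightarrow> bool"
  for A S where
  horizontal: "X \<in> sections A S UNIV \<Longrightarrow> commutator A S 1 X"
| bracket: "commutator A S i X \<Longrightarrow> commutator A S j Y \<Longrightarrow>
    commutator A S (i + j) (lie_bracket A X Y)"

definition bracket_span ::
    "('a::topological_space, 'e::euclidean_space) chart set \<Rightarrow> ('a \<Rightarrow> 'a tvec set) \<Rightarrow> nat \<Rightarrow>
     'a vfield set"
  where "bracket_span A S i = span {X. \<exists>j\<le>i. commutator A S j X}"

definition hoermander ::
    "('a::topological_space, 'e::euclidean_space) chart set \<Rightarrow> ('a \<Rightarrow> 'a tvec set) \<Rightarrow> bool"
  where "hoermander A S \<longleftrightarrow>
    (\<forall>p. \<exists>r. (\<lambda>X. X p) ` bracket_span A S r = tangent_space A p)"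

end

theory Submission
  imports Defs
begin

text \<open>The proof is Bony's strong maximum principle for sums of squares of vector fields; it is
  local and uses no integration.

  Let \<open>m\<close> be the maximum of \<open>u\<close>, attained because \<open>M\<close> is compact, and let \<open>F\<close> be the closed set
  where \<open>u = m\<close>. As \<open>M\<close> is connected it is enough that \<open>F\<close> is open. Otherwise, in a suitable chart,
  there is a point outside \<open>F\<close> whose nearest point \<open>y\<close> of \<open>F\<close> is not on the edge of the region
  considered, and the segment from \<open>y\<close> to that point is a nonzero \<^emph>\<open>proximal normal\<close> \<open>n\<close>: some ball
  with \<open>n\<close> as inner direction touches \<open>F\<close> only at \<open>y\<close> (lemma \<open>proximal_normal_exists\<close>). Two facts
  contradict this.

  \<^item> Horizontal vectors are orthogonal to proximal normals (\<open>hopf_lemma\<close>,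
    \<open>horizontal_tangent_to_maximum_set\<close>). If not, let \<open>s\<close> be a defining function of the touching
    ball, \<open>s(y) = 0\<close>, negative on the rest of \<open>F\<close> near \<open>y\<close>. The horizontal Laplacian of \<open>s + K s\<^sup>2\<close> at \<open>y\<close> is
    \<open>\<Delta> s + 2 K \<bar>\<nabla> s\<bar>\<^sup>2\<close>, which is positive for large \<open>K\<close> precisely because a horizontal derivative
    of \<open>s\<close> does not vanish. Then \<open>u + \<epsilon> (s + K s\<^sup>2)\<close> has an interior maximum at which its
    Laplacian is positive, which is impossible.

  \<^item> If two vector fields are orthogonal to all proximal normals of a closed set, so is their bracket
    (\<open>bracket_tangent\<close>). A curve that almost follows such a field cannot leave the set quickly, since
    the derivative of the squared distance only sees the component of the velocity along a proximal
    normal (\<open>infdist_sq_growth\<close>). Following \<open>X\<close>, \<open>Y\<close>, \<open>-X\<close>, \<open>-Y\<close> for time \<open>T\<close> leads to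
    \<open>y + T\<^sup>2 [X,Y](y) + o(T\<^sup>2)\<close>, so that this point is within \<open>o(T\<^sup>2)\<close> of the set, which is only
    possible if \<open>[X,Y](y)\<close> has no positive component along a normal at \<open>y\<close>.

  So all iterated brackets of horizontal fields are orthogonal to \<open>n\<close>, while the Hoermander
  condition makes them span the tangent space at \<open>y\<close>: hence \<open>n = 0\<close>.

  To apply the maximum principle to \<open>\<Delta>\<^sup>H = div \<nabla>\<close> one needs that the horizontal gradient is a
  smooth field and that the divergence, a trace over an arbitrarily chosen orthonormal basis at each
  point, depends smoothly on the point. Both follow by computing in a smooth orthogonal frame, which
  the Gram-Schmidt process provides locally.\<close>

section \<open>Calculus of smooth functions on open subsets of Euclidean space\<close>

lemma frechet_derivative_cong_open:
  assumes "open S" "x \<in> S" "\<And>y. y \<in> S \<Longrightarrow> f y = g y"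
  shows "frechet_derivative f (at x) = frechet_derivative g (at x)"
proof -
  have "(f has_derivative D) (at x) \<longleftrightarrow> (g has_derivative D) (at x)" for D
    using has_derivative_transform_within_open[OF _ assms(1,2), of f D UNIV g]
      has_derivative_transform_within_open[OF _ assms(1,2), of g D UNIV f] assms(3) by auto
  then show ?thesis by (simp add: frechet_derivative_def)
qed

lemma differentiable_cong_open:
  assumes "open S" "x \<in> S" "\<And>y. y \<in> S \<Longrightarrow> f y = g y" "f differentiable (at x)"
  shows "g differentiable (at x)"
  using assms has_derivative_transform_within_open[OF _ assms(1,2), of f _ UNIV g]
  unfolding differentiable_def by blast

lemma frechet_derivative_eqI: "(f has_derivative D) (at x) \<Longrightarrow> frechet_derivative f (at x) = D"
  using frechet_derivative_at by metis

lemma higher_differentiable_on_Suc_imp: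
  "higher_differentiable_on (Suc n) S f \<Longrightarrow> higher_differentiable_on n S f"
proof (induction n arbitrary: f)
  case 0
  then show ?case
    by (auto intro!: continuous_at_imp_continuous_on differentiable_imp_continuous_within)
next
  case (Suc n)
  have "higher_differentiable_on n S (\<lambda>x. frechet_derivative f (at x) v)" for v
    by (rule Suc.IH) (use Suc.prems in \<open>simp only: higher_differentiable_on.simps, blast\<close>)
  with Suc.prems show ?case by simp
qed

text \<open>The derivatives of \<open>f\<close> and \<open>g\<close> at a point of \<open>S\<close> agree only because \<open>S\<close> is open; this is why
  openness is assumed in the closure properties under sums, products and inverses.\<close>

lemma higher_differentiable_on_cong:
  assumes "open S" "\<And>x. x \<in> S \<Longrightarrow> f x = g x" "higher_differentiable_on n S f"
  shows "higher_differentiable_on n S g"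
  using assms(2,3)
proof (induction n arbitrary: f g)
  case 0
  then show ?case by (auto cong: continuous_on_cong)
next
  case (Suc n)
  have "higher_differentiable_on n S (\<lambda>x. frechet_derivative g (at x) v)" for v
  proof (rule Suc.IH)
    show "higher_differentiable_on n S (\<lambda>x. frechet_derivative f (at x) v)"
      using Suc.prems by simp
    show "frechet_derivative f (at x) v = frechet_derivative g (at x) v" if "x \<in> S" for x
      using frechet_derivative_cong_open[OF assms(1) that, of f g] Suc.prems by simp
  qed
  then show ?case
    using Suc.prems differentiable_cong_open[OF assms(1), of _ f g] by auto
qed

lemma higher_differentiable_on_subset:
  "higher_differentiable_on n S f \<Longrightarrow> T \<subseteq> S \<Longrightarrow> higher_differentiable_on n T f"
  by (induction n arbitrary: f) (auto intro: continuous_on_subset)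

lemma higher_differentiable_on_local:
  assumes "\<And>x. x \<in> S \<Longrightarrow> \<exists>T. open T \<and> x \<in> T \<and> higher_differentiable_on n T f"
  shows "higher_differentiable_on n S f"
  using assms
proof (induction n arbitrary: f)
  case 0
  then show ?case
    by (simp add: continuous_at_imp_continuous_on) (metis continuous_at_imp_continuous_on continuous_on_eq_continuous_at)
next
  case (Suc n)
  have "higher_differentiable_on n S (\<lambda>x. frechet_derivative f (at x) v)" for v
  proof (rule Suc.IH)
    fix x assume "x \<in> S"
    then obtain T where "open T" "x \<in> T" "higher_differentiable_on (Suc n) T f"
      using Suc.prems by blast
    then show "\<exists>T. open T \<and> x \<in> T
        \<and> higher_differentiable_on n T (\<lambda>x. frechet_derivative f (at x) v)" by auto
  qed
  moreover have "\<forall>x\<in>S. f differentiable (at x)" using Suc.prems by auto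
  ultimately show ?case by simp
qed

lemma higher_differentiable_on_const [simp]: "higher_differentiable_on n S (\<lambda>x. c)"
proof (induction n arbitrary: c)
  case (Suc n)
  then show ?case by (simp add: frechet_derivative_const)
qed simp

lemma higher_differentiable_on_add:
  assumes "open S" "higher_differentiable_on n S f" "higher_differentiable_on n S g"
  shows "higher_differentiable_on n S (\<lambda>x. f x + g x)"
  using assms(2,3)
proof (induction n arbitrary: f g)
  case 0
  then show ?case by (simp add: continuous_on_add)
next
  case (Suc n)
  have "higher_differentiable_on n S (\<lambda>x. frechet_derivative (\<lambda>x. f x + g x) (at x) v)" for v
  proof (rule higher_differentiable_on_cong[OF assms(1)])
    show "higher_differentiable_on n S
        (\<lambda>x. frechet_derivative f (at x) v + frechet_derivative g (at x) v)"
      using Suc by simp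
    show "frechet_derivative f (at x) v + frechet_derivative g (at x) v
        = frechet_derivative (\<lambda>x. f x + g x) (at x) v" if "x \<in> S" for x
      using Suc.prems that
      by (subst frechet_derivative_eqI[OF has_derivative_add[of f _ _ g]])
        (auto simp: frechet_derivative_works[symmetric])
  qed
  then show ?case using Suc.prems by simp
qed

lemma higher_differentiable_on_mult:
  fixes f g :: "'e::euclidean_space \<Rightarrow> real"
  assumes "open S" "higher_differentiable_on n S f" "higher_differentiable_on n S g"
  shows "higher_differentiable_on n S (\<lambda>x. f x * g x)"
  using assms(2,3)
proof (induction n arbitrary: f g)
  case 0
  then show ?case by (simp add: continuous_on_mult)
next
  case (Suc n)
  have fg: "higher_differentiable_on n S f" "higher_differentiable_on n S g"
    using Suc.prems higher_differentiable_on_Suc_imp by blast+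
  have "higher_differentiable_on n S (\<lambda>x. frechet_derivative (\<lambda>x. f x * g x) (at x) v)" for v
  proof (rule higher_differentiable_on_cong[OF assms(1)])
    show "higher_differentiable_on n S
        (\<lambda>x. f x * frechet_derivative g (at x) v + frechet_derivative f (at x) v * g x)"
      using Suc fg by (auto intro!: higher_differentiable_on_add[OF assms(1)])
    show "f x * frechet_derivative g (at x) v + frechet_derivative f (at x) v * g x
        = frechet_derivative (\<lambda>x. f x * g x) (at x) v" if "x \<in> S" for x
      using Suc.prems that
      by (subst frechet_derivative_eqI[OF has_derivative_mult[of f _ _ _ g]])
        (auto simp: frechet_derivative_works[symmetric])
  qed
  then show ?case using Suc.prems by (simp add: differentiable_mult)
qed

lemma higher_differentiable_on_inverse:
  fixes f :: "'e::euclidean_space \<Rightarrow> real"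
  assumes "open S" "higher_differentiable_on n S f" "\<And>x. x \<in> S \<Longrightarrow> f x \<noteq> 0"
  shows "higher_differentiable_on n S (\<lambda>x. inverse (f x))"
  using assms(2)
proof (induction n)
  case 0
  then show ?case using assms(3) by (simp add: continuous_on_inverse)
next
  case (Suc n)
  have IH: "higher_differentiable_on n S (\<lambda>x. inverse (f x))"
    using Suc higher_differentiable_on_Suc_imp by blast
  have "higher_differentiable_on n S (\<lambda>x. frechet_derivative (\<lambda>x. inverse (f x)) (at x) v)" for v
  proof (rule higher_differentiable_on_cong[OF assms(1)])
    show "higher_differentiable_on n S
        (\<lambda>x. (-1) * (inverse (f x) * frechet_derivative f (at x) v * inverse (f x)))"
      using Suc.prems IH
      by (intro higher_differentiable_on_mult[OF assms(1)]) auto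
    show "(-1) * (inverse (f x) * frechet_derivative f (at x) v * inverse (f x))
        = frechet_derivative (\<lambda>x. inverse (f x)) (at x) v" if "x \<in> S" for x
      using Suc.prems that assms(3)
      by (subst frechet_derivative_eqI[OF Deriv.has_derivative_inverse])
        (auto simp: frechet_derivative_works[symmetric])
  qed
  then show ?case using Suc.prems assms(3) by (simp add: differentiable_inverse)
qed

lemma higher_differentiable_on_inner_const:
  fixes f :: "'e::euclidean_space \<Rightarrow> 'b::real_inner"
  assumes "open S" "higher_differentiable_on n S f"
  shows "higher_differentiable_on n S (\<lambda>x. f x \<bullet> b)"
  using assms(2)
proof (induction n arbitrary: f)
  case 0
  then show ?case by (simp add: continuous_on_inner)
next
  case (Suc n)
  have "higher_differentiable_on n S (\<lambda>x. frechet_derivative (\<lambda>x. f x \<bullet> b) (at x) v)" for v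
  proof (rule higher_differentiable_on_cong[OF assms(1)])
    show "higher_differentiable_on n S (\<lambda>x. frechet_derivative f (at x) v \<bullet> b)"
      using Suc by simp
    show "frechet_derivative f (at x) v \<bullet> b
        = frechet_derivative (\<lambda>x. f x \<bullet> b) (at x) v" if "x \<in> S" for x
      using Suc.prems that
      by (subst frechet_derivative_eqI[OF has_derivative_inner_left[of f]])
        (auto simp: frechet_derivative_works[symmetric])
  qed
  moreover have "(\<lambda>x. f x \<bullet> b) differentiable at x" if "x \<in> S" for x
  proof -
    have "(f has_derivative frechet_derivative f (at x)) (at x)"
      using Suc.prems that frechet_derivative_works by auto
    from has_derivative_inner_left[OF this, of b] show ?thesis by (rule differentiableI)
  qed
  ultimately show ?case by simp
qed

lemma smooth_on_subset: "smooth_on S f \<Longrightarrow> T \<subseteq> S \<Longrightarrow> smooth_on T f"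
  by (auto simp: smooth_on_def intro: higher_differentiable_on_subset)

lemma smooth_on_cong:
  "open S \<Longrightarrow> smooth_on S f \<Longrightarrow> (\<And>x. x \<in> S \<Longrightarrow> f x = g x) \<Longrightarrow> smooth_on S g"
  unfolding smooth_on_def using higher_differentiable_on_cong by blast

lemma smooth_on_local:
  assumes "\<And>x. x \<in> S \<Longrightarrow> \<exists>T. open T \<and> x \<in> T \<and> smooth_on T f"
  shows "smooth_on S f"
  using assms unfolding smooth_on_def by (intro allI higher_differentiable_on_local) blast

lemma smooth_on_differentiable: "smooth_on S f \<Longrightarrow> x \<in> S \<Longrightarrow> f differentiable (at x)"
  unfolding smooth_on_def using higher_differentiable_on.simps(2) by blast

lemma smooth_on_has_derivative:
  "smooth_on S f \<Longrightarrow> x \<in> S \<Longrightarrow> (f has_derivative frechet_derivative f (at x)) (at x)"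
  using smooth_on_differentiable frechet_derivative_works by blast

lemma smooth_on_continuous_on: "smooth_on S f \<Longrightarrow> continuous_on S f"
  unfolding smooth_on_def using higher_differentiable_on.simps(1) by blast

lemma smooth_on_frechet_derivative:
  "smooth_on S f \<Longrightarrow> smooth_on S (\<lambda>x. frechet_derivative f (at x) v)"
  unfolding smooth_on_def using higher_differentiable_on.simps(2) by blast

lemma smooth_on_derivative_along_line:
  fixes F :: "'e::euclidean_space \<Rightarrow> real"
  assumes "smooth_on S F" "y + s *\<^sub>R v \<in> S"
  shows "((\<lambda>s. F (y + s *\<^sub>R v)) has_real_derivative
    frechet_derivative F (at (y + s *\<^sub>R v)) v) (at s)"
proof -
  have D: "((\<lambda>s. F (y + s *\<^sub>R v)) has_derivative
      (\<lambda>h. frechet_derivative F (at (y + s *\<^sub>R v)) (h *\<^sub>R v))) (at s)"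
    by (rule has_derivative_compose[of "\<lambda>s. y + s *\<^sub>R v" "\<lambda>h. h *\<^sub>R v" s UNIV F,
          OF _ smooth_on_has_derivative[OF assms]])
      (auto intro!: derivative_eq_intros)
  have "frechet_derivative F (at (y + s *\<^sub>R v)) (h *\<^sub>R v)
      = h * frechet_derivative F (at (y + s *\<^sub>R v)) v" for h
    using linear_frechet_derivative[OF smooth_on_differentiable[OF assms]]
    by (simp add: linear_scale)
  with D show ?thesis by (simp add: has_field_derivative_def mult.commute[of _ "_::real"] mult_commute_abs)
qed

text \<open>The mean value theorem, applied first in direction \<open>a\<close> and then in direction \<open>b\<close>, turns the
  second difference quotient into a mixed second derivative at a nearby point.\<close>

lemma second_difference_tendsto:
  fixes f :: "'e::euclidean_space \<Rightarrow> real"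
  assumes S: "open S" "x \<in> S" and f: "smooth_on S f"
  shows "((\<lambda>t. (f (x + t *\<^sub>R a + t *\<^sub>R b) - f (x + t *\<^sub>R a) - f (x + t *\<^sub>R b) + f x) / t\<^sup>2)
     \<longlongrightarrow> frechet_derivative (\<lambda>z. frechet_derivative f (at z) a) (at x) b) (at_right 0)"
proof -
  define g where "g = (\<lambda>z. frechet_derivative f (at z) a)"
  define H where "H = (\<lambda>z. frechet_derivative g (at z) b)"
  have g: "smooth_on S g" unfolding g_def by (rule smooth_on_frechet_derivative[OF f])
  have H: "continuous_on S H"
    unfolding H_def by (intro smooth_on_continuous_on smooth_on_frechet_derivative g)
  note line = smooth_on_derivative_along_line
  obtain r where r: "r > 0" "ball x r \<subseteq> S" using S open_contains_ball by blast
  define \<delta> where "\<delta> = r / (norm a + norm b + 1)"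
  have \<delta>: "\<delta> > 0" unfolding \<delta>_def using r(1)
    by (intro divide_pos_pos) (auto intro: add_nonneg_pos)
  have in_S: "x + s *\<^sub>R a + s' *\<^sub>R b \<in> S" if "0 \<le> s" "s \<le> t" "0 \<le> s'" "s' \<le> t" "t < \<delta>" for s s' t
  proof -
    have "norm (s *\<^sub>R a + s' *\<^sub>R b) \<le> s * norm a + s' * norm b"
      using norm_triangle_ineq[of "s *\<^sub>R a" "s' *\<^sub>R b"] that by simp
    also have "\<dots> \<le> t * norm a + t * norm b"
      using that by (intro add_mono mult_right_mono) auto
    also have "\<dots> \<le> t * (norm a + norm b + 1)" using that by (simp add: algebra_simps)
    also have "\<dots> < r" using \<open>t < \<delta>\<close> unfolding \<delta>_def
      by (simp add: pos_less_divide_eq add_nonneg_pos)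
    finally have "dist x (x + (s *\<^sub>R a + s' *\<^sub>R b)) < r"
      unfolding dist_norm by (metis add_diff_cancel_left' norm_minus_commute)
    then have "x + (s *\<^sub>R a + s' *\<^sub>R b) \<in> ball x r" by simp
    then show ?thesis using r(2) by (metis add.assoc subsetD)
  qed
  let ?Q = "\<lambda>t. (f (x + t *\<^sub>R a + t *\<^sub>R b) - f (x + t *\<^sub>R a) - f (x + t *\<^sub>R b) + f x) / t\<^sup>2"
  have mv: "\<exists>s s'. 0 \<le> s \<and> s \<le> t \<and> 0 \<le> s' \<and> s' \<le> t \<and> ?Q t = H (x + s *\<^sub>R a + s' *\<^sub>R b)"
    if t: "0 < t" "t < \<delta>" for t
  proof -
    let ?k = "\<lambda>s. f (x + t *\<^sub>R b + s *\<^sub>R a) - f (x + s *\<^sub>R a)"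
    have D1: "(?k has_real_derivative g (x + t *\<^sub>R b + s *\<^sub>R a) - g (x + s *\<^sub>R a)) (at s)"
      if "0 \<le> s" "s \<le> t" for s
      unfolding g_def
      using in_S[of s t t] in_S[of s t 0] that t
      by (intro DERIV_diff line[OF f]) (auto simp: algebra_simps)
    obtain s where s: "0 < s" "s < t"
      "?k t - ?k 0 = (t - 0) * (g (x + t *\<^sub>R b + s *\<^sub>R a) - g (x + s *\<^sub>R a))"
      using MVT2[OF t(1) D1] by blast
    have D2: "((\<lambda>s'. g (x + s *\<^sub>R a + s' *\<^sub>R b)) has_real_derivative H (x + s *\<^sub>R a + s' *\<^sub>R b)) (at s')"
      if "0 \<le> s'" "s' \<le> t" for s'
      unfolding H_def using in_S[of s t s'] that t s by (intro line[OF g]) auto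
    obtain s' where s': "0 < s'" "s' < t"
      "g (x + s *\<^sub>R a + t *\<^sub>R b) - g (x + s *\<^sub>R a + 0 *\<^sub>R b) = (t - 0) * H (x + s *\<^sub>R a + s' *\<^sub>R b)"
      using MVT2[OF t(1) D2] by blast
    have "?k t - ?k 0 = t\<^sup>2 * H (x + s *\<^sub>R a + s' *\<^sub>R b)"
      using s(3) s'(3) by (simp add: power2_eq_square algebra_simps)
    then have "?Q t = H (x + s *\<^sub>R a + s' *\<^sub>R b)"
      using t by (simp add: algebra_simps)
    then show ?thesis using s s' by (intro exI[of _ s] exI[of _ s']) auto
  qed
  have "(?Q \<longlongrightarrow> H x) (at_right 0)"
  proof (rule tendstoI)
    fix e :: real assume "e > 0"
    have "continuous (at x) H" using H S continuous_on_eq_continuous_at by blast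
    then obtain d where d: "d > 0" "\<And>y. dist y x < d \<Longrightarrow> dist (H y) (H x) < e"
      using \<open>e > 0\<close> unfolding continuous_at_eps_delta by blast
    define \<tau> where "\<tau> = min \<delta> (d / (norm a + norm b + 1))"
    have "\<tau> > 0" unfolding \<tau>_def using \<delta> d(1)
      by (auto intro!: divide_pos_pos add_nonneg_pos)
    have "dist (?Q t) (H x) < e" if t: "0 < t" "t < \<tau>" for t
    proof -
      obtain s s' where s: "0 \<le> s" "s \<le> t" "0 \<le> s'" "s' \<le> t" "?Q t = H (x + s *\<^sub>R a + s' *\<^sub>R b)"
        using mv t unfolding \<tau>_def by force
      have "norm (s *\<^sub>R a + s' *\<^sub>R b) \<le> s * norm a + s' * norm b"
        using norm_triangle_ineq[of "s *\<^sub>R a" "s' *\<^sub>R b"] s by simp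
      also have "\<dots> \<le> t * norm a + t * norm b"
        using s by (intro add_mono mult_right_mono) auto
      also have "\<dots> \<le> t * (norm a + norm b + 1)" using t by (simp add: algebra_simps)
      also have "\<dots> < d" using t unfolding \<tau>_def
        by (simp add: pos_less_divide_eq add_nonneg_pos)
      finally have "dist (x + s *\<^sub>R a + s' *\<^sub>R b) x < d" by (simp add: dist_norm add.assoc)
      then show ?thesis using d(2) s(5) by simp
    qed
    then show "\<forall>\<^sub>F t in at_right 0. dist (?Q t) (H x) < e"
      using \<open>\<tau> > 0\<close> unfolding eventually_at_right_field by auto
  qed
  then show ?thesis by (simp only: H_def g_def)
qed

text \<open>Schwarz's theorem, because the second difference is symmetric in the two directions. It is
  what makes the Lie bracket of two vector fields a first-order operator.\<close>

lemma frechet_derivative_commute: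
  fixes f :: "'e::euclidean_space \<Rightarrow> real"
  assumes "open S" "x \<in> S" "smooth_on S f"
  shows "frechet_derivative (\<lambda>z. frechet_derivative f (at z) a) (at x) b
       = frechet_derivative (\<lambda>z. frechet_derivative f (at z) b) (at x) a"
proof (rule tendsto_unique[OF trivial_limit_at_right_real])
  let ?Q = "\<lambda>t. (f (x + t *\<^sub>R a + t *\<^sub>R b) - f (x + t *\<^sub>R a) - f (x + t *\<^sub>R b) + f x) / t\<^sup>2"
  show "(?Q \<longlongrightarrow> frechet_derivative (\<lambda>z. frechet_derivative f (at z) a) (at x) b) (at_right 0)"
    by (rule second_difference_tendsto[OF assms])
  have Q: "?Q = (\<lambda>t. (f (x + t *\<^sub>R b + t *\<^sub>R a) - f (x + t *\<^sub>R b) - f (x + t *\<^sub>R a) + f x) / t\<^sup>2)"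
    by (simp add: algebra_simps)
  show "(?Q \<longlongrightarrow> frechet_derivative (\<lambda>z. frechet_derivative f (at z) b) (at x) a) (at_right 0)"
    unfolding Q by (rule second_difference_tendsto[OF assms])
qed

text \<open>The product rule for the pairing of the differential of \<open>f\<close> with a vector field. The
  differential is expanded in the standard basis because smoothness is only available for each
  directional derivative separately.\<close>

lemma frechet_derivative_along_field:
  fixes f :: "'e::euclidean_space \<Rightarrow> real"
  assumes S: "open S" "x \<in> S" and f: "smooth_on S f" and a: "(a has_derivative a') (at x)"
  shows "((\<lambda>z. frechet_derivative f (at z) (a z)) has_derivative
    (\<lambda>v. frechet_derivative (\<lambda>z. frechet_derivative f (at z) (a x)) (at x) v
       + frechet_derivative f (at x) (a' v))) (at x)"
proof -
  have expand: "frechet_derivative f (at z) w = (\<Sum>b\<in>Basis. frechet_derivative f (at z) b * (w \<bullet> b))"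
    if "z \<in> S" for z w
  proof -
    interpret L: linear "frechet_derivative f (at z)"
      using linear_frechet_derivative[OF smooth_on_differentiable[OF f that]] .
    have "frechet_derivative f (at z) w = frechet_derivative f (at z) (\<Sum>b\<in>Basis. (w \<bullet> b) *\<^sub>R b)"
      by (simp add: euclidean_representation)
    then show ?thesis by (simp add: L.sum L.scaleR mult.commute del: euclidean_representation)
  qed
  let ?H = "\<lambda>b. frechet_derivative (\<lambda>z. frechet_derivative f (at z) b) (at x)"
  have Db: "((\<lambda>z. frechet_derivative f (at z) b) has_derivative ?H b) (at x)" for b
    by (rule smooth_on_has_derivative[OF smooth_on_frechet_derivative[OF f] S(2)])
  have const: "frechet_derivative (\<lambda>z. frechet_derivative f (at z) w) (at x) v
      = (\<Sum>b\<in>Basis. ?H b v * (w \<bullet> b))" for w v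
  proof -
    have D: "((\<lambda>z. \<Sum>b\<in>Basis. frechet_derivative f (at z) b * (w \<bullet> b)) has_derivative
        (\<lambda>v. \<Sum>b\<in>Basis. ?H b v * (w \<bullet> b))) (at x)"
      by (intro has_derivative_sum has_derivative_mult_left Db)
    have "((\<lambda>z. frechet_derivative f (at z) w) has_derivative
        (\<lambda>v. \<Sum>b\<in>Basis. ?H b v * (w \<bullet> b))) (at x)"
      using has_derivative_transform_within_open[OF D S] expand by simp
    then show ?thesis by (simp add: frechet_derivative_eqI)
  qed
  have D: "((\<lambda>z. \<Sum>b\<in>Basis. frechet_derivative f (at z) b * (a z \<bullet> b)) has_derivative
      (\<lambda>v. \<Sum>b\<in>Basis. frechet_derivative f (at x) b * (a' v \<bullet> b) + ?H b v * (a x \<bullet> b))) (at x)"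
    by (intro has_derivative_sum has_derivative_mult Db has_derivative_inner_left a)
  have "((\<lambda>z. frechet_derivative f (at z) (a z)) has_derivative
      (\<lambda>v. \<Sum>b\<in>Basis. frechet_derivative f (at x) b * (a' v \<bullet> b) + ?H b v * (a x \<bullet> b))) (at x)"
    using has_derivative_transform_within_open[OF D S] expand by simp
  moreover have "(\<Sum>b\<in>Basis. frechet_derivative f (at x) b * (a' v \<bullet> b) + ?H b v * (a x \<bullet> b))
      = frechet_derivative (\<lambda>z. frechet_derivative f (at z) (a x)) (at x) v
        + frechet_derivative f (at x) (a' v)" for v
    unfolding const[of "a x" v] expand[OF S(2), of "a' v"] sum.distrib by (rule add.commute)
  ultimately show ?thesis by simp
qed

text \<open>If the second derivative in direction \<open>a\<close> were positive, the first derivative, which vanishes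
  at \<open>x\<close>, would be positive a little further along \<open>a\<close>, and \<open>f\<close> would exceed its maximum there.\<close>

lemma second_derivative_nonpos_at_max:
  fixes f :: "'e::euclidean_space \<Rightarrow> real"
  assumes S: "open S" "x \<in> S" and f: "smooth_on S f" and max: "\<And>y. y \<in> S \<Longrightarrow> f y \<le> f x"
  shows "frechet_derivative (\<lambda>z. frechet_derivative f (at z) a) (at x) a \<le> 0"
proof (rule ccontr)
  define g where "g = (\<lambda>z. frechet_derivative f (at z) a)"
  define G where "G = frechet_derivative g (at x) a"
  assume "\<not> ?thesis"
  then have "G > 0" by (simp add: G_def g_def)
  have g: "smooth_on S g" unfolding g_def by (rule smooth_on_frechet_derivative[OF f])
  note line = smooth_on_derivative_along_line
  have "frechet_derivative f (at x) = (\<lambda>v. 0)"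
    using differential_zero_maxmin[OF S(2,1) smooth_on_has_derivative[OF f S(2)]] max by blast
  then have g0: "g x = 0" by (simp add: g_def)
  obtain e where e: "e > 0" "ball x e \<subseteq> S" using S open_contains_ball by blast
  define r where "r = e / (norm a + 1)"
  have r: "r > 0" "x + s *\<^sub>R a \<in> S" if "\<bar>s\<bar> < r" for s
  proof -
    show "r > 0" using that by linarith
    have "\<bar>s\<bar> * (norm a + 1) < e"
      using that by (simp add: r_def pos_less_divide_eq add_nonneg_pos)
    then have "\<bar>s\<bar> * norm a < e" by (simp add: algebra_simps)
    then show "x + s *\<^sub>R a \<in> S" using e(2) by (auto simp: dist_norm)
  qed
  have r0: "r > 0" using e by (simp add: r_def add_nonneg_pos)
  have "((\<lambda>s. g (x + s *\<^sub>R a)) has_real_derivative G) (at 0)"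
    using line[OF g, of x 0 a] S(2) by (simp add: G_def)
  then obtain d where d: "d > 0" "\<And>h. 0 < h \<Longrightarrow> h < d \<Longrightarrow> g (x + 0 *\<^sub>R a) < g (x + (0 + h) *\<^sub>R a)"
    using DERIV_pos_inc_right[OF _ \<open>G > 0\<close>] by blast
  define t where "t = min r d / 2"
  have t: "0 < t" "t < r" "t < d" using r0 d(1) by (auto simp: t_def)
  have "((\<lambda>s. f (x + s *\<^sub>R a)) has_real_derivative g (x + s *\<^sub>R a)) (at s)"
    if "0 \<le> s" "s \<le> t" for s
    unfolding g_def using that t r(2) by (intro line[OF f]) auto
  then obtain s where s: "0 < s" "s < t" "f (x + t *\<^sub>R a) - f (x + 0 *\<^sub>R a) = (t - 0) * g (x + s *\<^sub>R a)"
    using MVT2[OF t(1)] by meson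
  have "g (x + s *\<^sub>R a) > 0" using d(2)[of s] s t g0 by simp
  then have "f (x + t *\<^sub>R a) > f x" using s(3) t(1)
    by (smt (verit) add.right_neutral diff_zero mult_pos_pos scale_zero_left)
  then show False using max[OF r(2)[of t]] t by auto
qed

text \<open>On a compact convex set the partial derivatives are bounded, and these bounds add up to a
  Lipschitz constant.\<close>

lemma smooth_on_lipschitz_cball:
  fixes f :: "'e::euclidean_space \<Rightarrow> real"
  assumes f: "smooth_on S f" and S: "cball y R \<subseteq> S"
  shows "\<exists>L\<ge>0. \<forall>x\<in>cball y R. \<forall>z\<in>cball y R. norm (f x - f z) \<le> L * norm (x - z)"
proof -
  have "\<exists>B. \<forall>x\<in>cball y R. \<bar>frechet_derivative f (at x) b\<bar> \<le> B" for b
  proof -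
    have "continuous_on (cball y R) (\<lambda>x. frechet_derivative f (at x) b)"
      by (rule continuous_on_subset[OF smooth_on_continuous_on[OF smooth_on_frechet_derivative[OF f]] S])
    then have "bounded ((\<lambda>x. frechet_derivative f (at x) b) ` cball y R)"
      by (intro compact_imp_bounded compact_continuous_image) auto
    then show ?thesis unfolding bounded_iff by auto
  qed
  then obtain B where B: "\<And>b x. x \<in> cball y R \<Longrightarrow> \<bar>frechet_derivative f (at x) b\<bar> \<le> B b" by metis
  define L where "L = (\<Sum>b\<in>Basis. \<bar>B b\<bar>)"
  have on: "onorm (frechet_derivative f (at x)) \<le> L" if x: "x \<in> cball y R" for x
  proof (rule onorm_le)
    fix h
    have lin: "linear (frechet_derivative f (at x))"
      by (rule linear_frechet_derivative[OF smooth_on_differentiable[OF f]]) (use x S in auto)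
    have "frechet_derivative f (at x) h = frechet_derivative f (at x) (\<Sum>b\<in>Basis. (h \<bullet> b) *\<^sub>R b)"
      by (simp add: euclidean_representation)
    also have "\<dots> = (\<Sum>b\<in>Basis. (h \<bullet> b) * frechet_derivative f (at x) b)"
      by (simp add: linear_sum[OF lin] linear_scale[OF lin] del: euclidean_representation)
    also have "norm \<dots> \<le> (\<Sum>b\<in>Basis. norm h * \<bar>B b\<bar>)"
    proof (rule sum_norm_le)
      fix b :: 'e assume b: "b \<in> Basis"
      have "\<bar>h \<bullet> b\<bar> * \<bar>frechet_derivative f (at x) b\<bar> \<le> norm h * \<bar>B b\<bar>"
        using B[OF x, of b] Basis_le_norm[OF b, of h] by (intro mult_mono) auto
      then show "norm ((h \<bullet> b) * frechet_derivative f (at x) b) \<le> norm h * \<bar>B b\<bar>"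
        by (simp add: abs_mult)
    qed
    finally show "norm (frechet_derivative f (at x) h) \<le> L * norm h"
      by (simp add: L_def sum_distrib_left[symmetric] mult.commute)
  qed
  have "norm (f x - f z) \<le> L * norm (x - z)" if "x \<in> cball y R" "z \<in> cball y R" for x z
    by (rule differentiable_bound[OF convex_cball
          has_derivative_at_withinI[OF smooth_on_has_derivative[OF f subsetD[OF S]]] on that])
  moreover have "L \<ge> 0" by (simp add: L_def sum_nonneg)
  ultimately show ?thesis by blast
qed

lemma smooth_components_lipschitz_cball:
  fixes a :: "'e::euclidean_space \<Rightarrow> 'e"
  assumes a: "\<And>b. b \<in> Basis \<Longrightarrow> smooth_on S (\<lambda>x. a x \<bullet> b)" and S: "cball y R \<subseteq> S"
  shows "\<exists>L\<ge>0. \<forall>x\<in>cball y R. \<forall>z\<in>cball y R. norm (a x - a z) \<le> L * norm (x - z)"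
proof -
  have "\<forall>b\<in>Basis. \<exists>L\<ge>0. \<forall>x\<in>cball y R. \<forall>z\<in>cball y R. norm (a x \<bullet> b - a z \<bullet> b) \<le> L * norm (x - z)"
    using smooth_on_lipschitz_cball[OF a S] by blast
  then obtain L where L: "\<And>b. b \<in> Basis \<Longrightarrow> L b \<ge> 0"
    "\<And>b x z. b \<in> Basis \<Longrightarrow> x \<in> cball y R \<Longrightarrow> z \<in> cball y R \<Longrightarrow>
      norm (a x \<bullet> b - a z \<bullet> b) \<le> L b * norm (x - z)"
    by metis
  have "norm (a x - a z) \<le> (\<Sum>b\<in>Basis. L b) * norm (x - z)"
    if "x \<in> cball y R" "z \<in> cball y R" for x z
  proof -
    have "norm (a x - a z) \<le> (\<Sum>b\<in>Basis. \<bar>(a x - a z) \<bullet> b\<bar>)" by (rule norm_le_l1)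
    also have "\<dots> \<le> (\<Sum>b\<in>Basis. L b * norm (x - z))"
      using L(2) that by (intro sum_mono) (simp add: inner_diff_left)
    finally show ?thesis by (simp add: sum_distrib_right)
  qed
  moreover have "(\<Sum>b\<in>Basis. L b) \<ge> 0" using L(1) by (simp add: sum_nonneg)
  ultimately show ?thesis by blast
qed

section \<open>Proximal normals and brackets of tangent fields\<close>

text \<open>The inequality says that near \<open>y\<close> no point of \<open>F\<close> lies in the open ball with centre \<open>y + n\<close>
  through \<open>y\<close>. In this form the notion is local and scales down with \<open>n\<close>.\<close>

definition proximal_normal :: "'e::real_inner set \<Rightarrow> 'e \<Rightarrow> 'e \<Rightarrow> bool"
  where "proximal_normal F y n \<longleftrightarrow>
    y \<in> F \<and> (\<exists>e>0. \<forall>z\<in>F. dist z y < e \<longrightarrow> 2 * (n \<bullet> (z - y)) \<le> (norm (z - y))\<^sup>2)"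

lemma nearest_point_proximal_normal:
  assumes "y \<in> F" "e > 0" "\<And>z. z \<in> F \<Longrightarrow> dist z y < e \<Longrightarrow> dist c y \<le> dist c z"
  shows "proximal_normal F y (c - y)"
  unfolding proximal_normal_def
proof (intro conjI exI[of _ e] ballI impI)
  fix z assume "z \<in> F" "dist z y < e"
  then have "(norm (c - y))\<^sup>2 \<le> (norm (c - z))\<^sup>2"
    using assms(3) by (simp add: dist_norm power_mono)
  then show "2 * ((c - y) \<bullet> (z - y)) \<le> (norm (z - y))\<^sup>2"
    by (simp add: power2_norm_eq_inner inner_diff_left inner_diff_right inner_commute)
qed (use assms in auto)

text \<open>If \<open>z\<close> is a point of \<open>F\<close> nearest to \<open>\<gamma> t\<close>, then \<open>\<bar>\<gamma> - z\<bar>\<^sup>2\<close> bounds the squared distance to \<open>F\<close>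
  from above and agrees with it at time \<open>t\<close>, so the squared distance grows at most at the rate
  \<open>2 (\<gamma> t - z) \<bullet> \<gamma>' t\<close>. The hypotheses bound this by a multiple of the squared distance up to the
  error \<open>\<eta>\<close>, and a Gronwall argument gives the estimate. It is essential for what follows that the
  error contributes only \<open>O(T \<eta>)\<close> to the distance itself.\<close>

lemma infdist_sq_growth:
  fixes \<gamma> \<gamma>' :: "real \<Rightarrow> 'e::euclidean_space"
  assumes T: "T > 0" and L: "\<Lambda> \<ge> 0" and h: "\<eta> \<ge> 0"
    and der: "\<And>t. 0 \<le> t \<Longrightarrow> t \<le> T \<Longrightarrow> (\<gamma> has_vector_derivative \<gamma>' t) (at t)"
    and err: "\<And>t. 0 \<le> t \<Longrightarrow> t \<le> T \<Longrightarrow> norm (\<gamma>' t - v t) \<le> \<eta>"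
    and near: "\<And>t. 0 \<le> t \<Longrightarrow> t \<le> T \<Longrightarrow>
      \<exists>z\<in>F. infdist (\<gamma> t) F = dist (\<gamma> t) z \<and> (\<gamma> t - z) \<bullet> v t \<le> \<Lambda> * (dist (\<gamma> t) z)\<^sup>2"
  shows "(infdist (\<gamma> T) F)\<^sup>2 \<le> exp (2 * \<Lambda> * T + 1) * ((infdist (\<gamma> 0) F)\<^sup>2 + T\<^sup>2 * \<eta>\<^sup>2)"
proof -
  define m where "m = (\<lambda>t. (infdist (\<gamma> t) F)\<^sup>2)"
  \<comment> \<open>The summand \<open>1 / T\<close> pays for \<open>2 d \<eta> \<le> d\<^sup>2 / T + T \<eta>\<^sup>2\<close> and costs only a factor \<open>exp 1\<close>.\<close>
  define K where "K = 2 * \<Lambda> + 1 / T"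
  have "K > 0" using T L by (simp add: K_def add_nonneg_pos)
  have cont\<gamma>: "continuous_on {0..T} \<gamma>"
    using der by (auto intro!: continuous_at_imp_continuous_on has_vector_derivative_continuous)
  have contm: "continuous_on {0..T} m" unfolding m_def by (intro continuous_intros cont\<gamma>)
  have main: "m T \<le> exp (K * T) * (m 0 + (T * \<eta>\<^sup>2 + \<delta>) * T)" if "\<delta> > 0" for \<delta>
  proof (rule ccontr)
    define B where "B = (\<lambda>t. exp (K * t) * (m 0 + (T * \<eta>\<^sup>2 + \<delta>) * t))"
    have contB: "continuous_on {0..T} B" unfolding B_def by (intro continuous_intros)
    \<comment> \<open>\<open>B\<close> strictly outgrows \<open>m\<close> wherever \<open>m \<le> B\<close>, so there is no first time of failure.\<close>
    define Z where "Z = {t\<in>{0..T}. m t > B t}"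
    assume "\<not> m T \<le> exp (K * T) * (m 0 + (T * \<eta>\<^sup>2 + \<delta>) * T)"
    then have TZ: "T \<in> Z" using T by (simp add: Z_def B_def)
    define s where "s = Inf Z"
    have bdd: "bdd_below Z" unfolding Z_def by (intro bdd_belowI[of _ 0]) auto
    have s0: "0 \<le> s" unfolding s_def using TZ by (intro cInf_greatest) (auto simp: Z_def)
    have sT: "s \<le> T" unfolding s_def by (rule cInf_lower[OF TZ bdd])
    have below: "m t \<le> B t" if "0 \<le> t" "t < s" for t
    proof (rule ccontr)
      assume "\<not> m t \<le> B t"
      then have "t \<in> Z" using that sT by (auto simp: Z_def)
      from cInf_lower[OF this bdd] that show False by (simp add: s_def)
    qed
    have ms: "m s \<le> B s"
    proof (cases "s = 0")
      case True then show ?thesis by (simp add: B_def)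
    next
      case False
      have "closedin (top_of_set {0..T}) {t\<in>{0..T}. m t \<le> B t}"
        by (intro continuous_on_closed_Collect_le[THEN closed_subset[rotated]] contm contB) auto
      then have cl: "closed {t\<in>{0..T}. m t \<le> B t}" using closedin_closed_trans by blast
      have "{0..<s} \<subseteq> {t\<in>{0..T}. m t \<le> B t}" using below sT by auto
      then have "closure {0..<s} \<subseteq> {t\<in>{0..T}. m t \<le> B t}" by (rule closure_minimal[OF _ cl])
      then show ?thesis using False s0 by auto
    qed
    have "s < T" using ms TZ sT by (cases "s = T") (auto simp: Z_def)
    obtain z where z: "z \<in> F" "infdist (\<gamma> s) F = dist (\<gamma> s) z"
      "(\<gamma> s - z) \<bullet> v s \<le> \<Lambda> * (dist (\<gamma> s) z)\<^sup>2" using near[OF s0 sT] by blast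
    define d where "d = dist (\<gamma> s) z"
    have md: "m s = d\<^sup>2" by (simp add: m_def d_def z)
    define f where "f = (\<lambda>t. (\<gamma> t - z) \<bullet> (\<gamma> t - z))"
    have fm: "m t \<le> f t" for t
    proof -
      have "infdist (\<gamma> t) F \<le> dist (\<gamma> t) z" by (rule infdist_le[OF z(1)])
      then have "m t \<le> (dist (\<gamma> t) z)\<^sup>2" unfolding m_def by (intro power_mono infdist_nonneg)
      then show ?thesis by (simp add: f_def dist_norm power2_norm_eq_inner)
    qed
    have fs: "f s = m s" by (simp add: f_def md d_def dist_norm power2_norm_eq_inner)
    have \<gamma>z: "((\<lambda>t. \<gamma> t - z) has_vector_derivative \<gamma>' s) (at s)"
      using has_vector_derivative_diff[OF der[OF s0 sT] has_vector_derivative_const[of z]] by simp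
    have df: "(f has_real_derivative 2 * ((\<gamma> s - z) \<bullet> \<gamma>' s)) (at s)"
      unfolding f_def has_real_derivative_iff_has_vector_derivative
      using bounded_bilinear.has_vector_derivative[OF bounded_bilinear_inner \<gamma>z \<gamma>z]
      by (simp add: inner_commute)
    have dB: "(B has_real_derivative K * B s + exp (K * s) * (T * \<eta>\<^sup>2 + \<delta>)) (at s)"
      unfolding B_def by (auto intro!: derivative_eq_intros simp: algebra_simps)
    have "(\<gamma> s - z) \<bullet> \<gamma>' s = (\<gamma> s - z) \<bullet> v s + (\<gamma> s - z) \<bullet> (\<gamma>' s - v s)"
      by (simp add: inner_diff_right)
    also have "\<dots> \<le> \<Lambda> * d\<^sup>2 + d * \<eta>"
    proof (rule add_mono)
      have "(\<gamma> s - z) \<bullet> (\<gamma>' s - v s) \<le> norm (\<gamma> s - z) * norm (\<gamma>' s - v s)"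
        by (rule norm_cauchy_schwarz)
      also have "\<dots> \<le> d * \<eta>" using err[OF s0 sT] by (simp add: d_def dist_norm mult_left_mono)
      finally show "(\<gamma> s - z) \<bullet> (\<gamma>' s - v s) \<le> d * \<eta>" .
    qed (use z d_def in simp)
    finally have "2 * ((\<gamma> s - z) \<bullet> \<gamma>' s) \<le> 2 * \<Lambda> * d\<^sup>2 + 2 * d * \<eta>" by simp
    also have "2 * d * \<eta> \<le> d\<^sup>2 / T + T * \<eta>\<^sup>2"
    proof -
      have "0 \<le> (d - T * \<eta>)\<^sup>2" by simp
      then have "2 * d * \<eta> * T \<le> (d\<^sup>2 / T + T * \<eta>\<^sup>2) * T"
        using T by (simp add: power2_eq_square algebra_simps)
      then show ?thesis using T by (simp only: mult_le_cancel_right_pos)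
    qed
    finally have "2 * ((\<gamma> s - z) \<bullet> \<gamma>' s) \<le> K * m s + T * \<eta>\<^sup>2"
      by (simp add: K_def md algebra_simps)
    also have "\<dots> < K * B s + exp (K * s) * (T * \<eta>\<^sup>2 + \<delta>)"
    proof (rule add_le_less_mono)
      show "K * m s \<le> K * B s" using ms \<open>K > 0\<close> by simp
      have "1 \<le> exp (K * s)" using \<open>K > 0\<close> s0 by simp
      then have "1 * (T * \<eta>\<^sup>2 + \<delta>) \<le> exp (K * s) * (T * \<eta>\<^sup>2 + \<delta>)"
        using T that by (intro mult_right_mono) auto
      then show "T * \<eta>\<^sup>2 < exp (K * s) * (T * \<eta>\<^sup>2 + \<delta>)" using that by simp
    qed
    finally have neg: "2 * ((\<gamma> s - z) \<bullet> \<gamma>' s) - (K * B s + exp (K * s) * (T * \<eta>\<^sup>2 + \<delta>)) < 0"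
      by simp
    obtain r where r: "r > 0" "\<And>h. 0 < h \<Longrightarrow> h < r \<Longrightarrow> f s - B s > f (s + h) - B (s + h)"
      using DERIV_neg_dec_right[OF DERIV_diff[OF df dB] neg] by blast
    have le: "m t \<le> B t" if "0 \<le> t" "t < s + r" for t
    proof (cases "t \<le> s")
      case True then show ?thesis using below ms that by (cases "t = s") auto
    next
      case False
      then show ?thesis using r(2)[of "t - s"] that fm[of t] fs ms by auto
    qed
    have "s + r \<le> Inf Z"
      using TZ by (intro cInf_greatest) (use le in \<open>force simp: Z_def\<close>)+
    then show False using r(1) by (simp add: s_def)
  qed
  have KT: "K * T = 2 * \<Lambda> * T + 1" using T by (simp add: K_def algebra_simps)
  have "m T \<le> exp (K * T) * (m 0 + T\<^sup>2 * \<eta>\<^sup>2)"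
  proof (rule field_le_epsilon)
    fix e :: real assume "e > 0"
    define \<delta> where "\<delta> = e / (exp (K * T) * T)"
    have "\<delta> > 0" using \<open>e > 0\<close> T by (simp add: \<delta>_def)
    from main[OF this] have "m T \<le> exp (K * T) * (m 0 + (T * \<eta>\<^sup>2 + \<delta>) * T)" .
    also have "\<dots> = exp (K * T) * (m 0 + T\<^sup>2 * \<eta>\<^sup>2) + exp (K * T) * T * \<delta>"
      by (simp add: algebra_simps power2_eq_square)
    also have "exp (K * T) * T * \<delta> = e" using T by (simp add: \<delta>_def)
    finally show "m T \<le> exp (K * T) * (m 0 + T\<^sup>2 * \<eta>\<^sup>2) + e" .
  qed
  then show ?thesis by (simp add: m_def KT)
qed

text \<open>A second-order tangency condition: a curve from \<open>y\<close> with first-order coefficient \<open>\<sigma>\<close> and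
  second-order coefficient \<open>\<rho>\<close> remains within \<open>o(T\<^sup>2)\<close> of \<open>F\<close>.\<close>

definition reachable :: "'e::real_inner set \<Rightarrow> 'e \<Rightarrow> 'e \<Rightarrow> 'e \<Rightarrow> bool"
  where "reachable F y \<sigma> \<rho> \<longleftrightarrow>
    (\<forall>e>0. \<exists>\<tau>>0. \<forall>T. 0 < T \<and> T < \<tau> \<longrightarrow> infdist (y + T *\<^sub>R \<sigma> + T\<^sup>2 *\<^sub>R \<rho>) F \<le> e * T\<^sup>2)"

text \<open>Starting at \<open>y + T \<sigma> + T\<^sup>2 \<rho>\<close> and following \<open>g\<close> for time \<open>T\<close> leads, to second order, to
  \<open>y + T (\<sigma> + g y) + T\<^sup>2 (\<rho> + G \<sigma> + G (g y) / 2)\<close>. The explicit curve \<open>\<gamma>\<close> below satisfies the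
  equation \<open>\<gamma>' = g \<circ> \<gamma>\<close> up to an error \<open>\<mu> T\<close> with \<open>\<mu>\<close> as small as desired, so the distance to \<open>F\<close>
  grows by at most \<open>o(T\<^sup>2)\<close>; no solution of a differential equation is required. Tangency enters
  at the nearest point \<open>z\<close>, where \<open>\<gamma> t - z\<close> is a proximal normal and \<open>g z\<close> is orthogonal to it;
  the difference between \<open>g z\<close> and \<open>g (\<gamma> t)\<close> is controlled by the Lipschitz constant.\<close>

lemma reachable_step:
  fixes g :: "'e::euclidean_space \<Rightarrow> 'e"
  assumes R: "R > 0" and F: "compact (F \<inter> cball y R)" "y \<in> F"
    and L: "\<Lambda> \<ge> 0"
    and lip: "\<And>x z. x \<in> cball y R \<Longrightarrow> z \<in> cball y R \<Longrightarrow> norm (g x - g z) \<le> \<Lambda> * norm (x - z)"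
    and G: "(g has_derivative G) (at y)"
    and tan: "\<And>z n. z \<in> F \<Longrightarrow> z \<in> ball y R \<Longrightarrow> proximal_normal F z n \<Longrightarrow> g z \<bullet> n = 0"
    and reach: "reachable (F \<inter> cball y R) y \<sigma> \<rho>"
  shows "reachable (F \<inter> cball y R) y (\<sigma> + g y) (\<rho> + G \<sigma> + (1/2) *\<^sub>R G (g y))"
  unfolding reachable_def
proof (intro allI impI)
  let ?F = "F \<inter> cball y R"
  fix e :: real assume e: "e > 0"
  have yF: "y \<in> ?F" using F R by simp
  have lin: "bounded_linear G" using G by (rule has_derivative_bounded_linear)
  interpret G: bounded_linear G by (rule lin)
  obtain NG where NG: "NG > 0" "\<And>x. norm (G x) \<le> norm x * NG" using G.pos_bounded by blast
  define E where "E = exp (2 * \<Lambda> + 1)"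
  have E: "E \<ge> 1" using L by (simp add: E_def)
  \<comment> \<open>chosen so that \<open>E (\<mu>\<^sup>2 + \<mu>\<^sup>2) \<le> e\<^sup>2\<close>\<close>
  define \<mu> where "\<mu> = e / (2 * E)"
  have \<mu>: "\<mu> > 0" using e E by (simp add: \<mu>_def)
  define C1 where "C1 = norm \<rho> + norm (G \<sigma>) + norm (G (g y))"
  define C2 where "C2 = norm \<sigma> + norm (g y) + C1"
  have C: "C1 \<ge> 0" "C2 \<ge> 0" by (auto simp: C1_def C2_def)
  define \<kappa> where "\<kappa> = \<mu> / (2 * (C2 + 1))"
  have \<kappa>: "\<kappa> > 0" using \<mu> C by (simp add: \<kappa>_def)
  obtain \<delta> where \<delta>: "\<delta> > 0"
    "\<And>x. norm (x - y) < \<delta> \<Longrightarrow> norm (g x - g y - G (x - y)) \<le> \<kappa> * norm (x - y)"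
    using G \<kappa> unfolding has_derivative_at_alt by blast
  obtain \<tau>0 where \<tau>0: "\<tau>0 > 0"
    "\<And>T. 0 < T \<Longrightarrow> T < \<tau>0 \<Longrightarrow> infdist (y + T *\<^sub>R \<sigma> + T\<^sup>2 *\<^sub>R \<rho>) ?F \<le> \<mu> * T\<^sup>2"
    using reach[unfolded reachable_def, rule_format, OF \<mu>] by meson
  \<comment> \<open>The third bound makes the second-order remainder of \<open>\<gamma>\<close> negligible; the fourth keeps \<open>\<gamma>\<close> where
    \<open>g\<close> is close to its linearization, and so close to \<open>y\<close> that its nearest points in \<open>F\<close> are interior to the ball of radius \<open>R\<close>.\<close>
  define \<tau> where "\<tau> = Min {1, \<tau>0, \<mu> / (2 * (NG * C1 + 1)), min \<delta> (R/2) / (C2 + 1)}"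
  have "NG * C1 \<ge> 0" using NG C by simp
  then have "\<tau> > 0" using \<tau>0 \<mu> \<delta> R C by (auto simp: \<tau>_def)
  moreover have "infdist (y + T *\<^sub>R (\<sigma> + g y) + T\<^sup>2 *\<^sub>R (\<rho> + G \<sigma> + (1/2) *\<^sub>R G (g y))) ?F \<le> e * T\<^sup>2"
    if T: "0 < T" "T < \<tau>" for T
  proof -
    have T1: "T < 1" "T < \<tau>0" "T < \<mu> / (2 * (NG * C1 + 1))" "T < min \<delta> (R/2) / (C2 + 1)"
      using T by (auto simp: \<tau>_def)
    have T2: "T * (C2 + 1) < min \<delta> (R/2)"
      using T1(4) C by (simp add: pos_less_divide_eq)
    have T3: "NG * C1 * T \<le> \<mu> / 2"
    proof -
      have "T * (2 * (NG * C1 + 1)) < \<mu>" using T1(3) \<open>NG * C1 \<ge> 0\<close>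
        by (subst (asm) pos_less_divide_eq) auto
      then show ?thesis using T by (simp add: algebra_simps)
    qed
    have \<kappa>C: "\<kappa> * C2 \<le> \<mu> / 2"
    proof -
      have "\<kappa> * C2 \<le> \<kappa> * (C2 + 1)" using \<kappa> by simp
      also have "\<dots> = \<mu> / 2" using C by (simp add: \<kappa>_def field_simps)
      finally show ?thesis .
    qed
    define \<gamma> where "\<gamma> = (\<lambda>t. y + T *\<^sub>R \<sigma> + T\<^sup>2 *\<^sub>R \<rho> + t *\<^sub>R g y + (t * T) *\<^sub>R G \<sigma> + (t\<^sup>2 / 2) *\<^sub>R G (g y))"
    define \<gamma>' where "\<gamma>' = (\<lambda>t. g y + T *\<^sub>R G \<sigma> + t *\<^sub>R G (g y))"
    define r where "r = (\<lambda>t. T\<^sup>2 *\<^sub>R \<rho> + (t * T) *\<^sub>R G \<sigma> + (t\<^sup>2 / 2) *\<^sub>R G (g y))"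
    have \<gamma>r: "\<gamma> t - y = T *\<^sub>R \<sigma> + t *\<^sub>R g y + r t" for t
      by (simp add: \<gamma>_def r_def algebra_simps)
    have rb: "norm (r t) \<le> T\<^sup>2 * C1" if t: "0 \<le> t" "t \<le> T" for t
    proof -
      have "t\<^sup>2 \<le> T\<^sup>2" using t by (rule power_mono[rotated])
      moreover have "t * T \<le> T\<^sup>2" "0 \<le> t * T"
        using t T by (auto simp: power2_eq_square mult_right_mono)
      ultimately have q: "t * T \<le> T\<^sup>2" "t\<^sup>2 / 2 \<le> T\<^sup>2" "0 \<le> t * T"
        using zero_le_power2[of T] by linarith+
      have "norm (r t) \<le> norm (T\<^sup>2 *\<^sub>R \<rho>) + norm ((t * T) *\<^sub>R G \<sigma>) + norm ((t\<^sup>2 / 2) *\<^sub>R G (g y))"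
        unfolding r_def by (meson norm_triangle_ineq norm_triangle_le add_right_mono order_trans)
      also have "\<dots> = T\<^sup>2 * norm \<rho> + (t * T) * norm (G \<sigma>) + (t\<^sup>2 / 2) * norm (G (g y))"
        using q t T by simp
      also have "\<dots> \<le> T\<^sup>2 * norm \<rho> + T\<^sup>2 * norm (G \<sigma>) + T\<^sup>2 * norm (G (g y))"
        using q by (intro add_mono mult_right_mono order_refl) auto
      finally show ?thesis by (simp add: C1_def algebra_simps)
    qed
    have \<gamma>b: "norm (\<gamma> t - y) \<le> T * C2" if t: "0 \<le> t" "t \<le> T" for t
    proof -
      have "norm (\<gamma> t - y) \<le> norm (T *\<^sub>R \<sigma>) + norm (t *\<^sub>R g y) + norm (r t)"
        unfolding \<gamma>r by (meson norm_triangle_ineq norm_triangle_le add_right_mono order_trans)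
      also have "\<dots> \<le> T * norm \<sigma> + T * norm (g y) + T\<^sup>2 * C1"
        using rb[OF t] t T by (intro add_mono) (auto simp: mult_right_mono)
      also have "T\<^sup>2 * C1 \<le> T * C1"
        using T T1 C by (intro mult_right_mono) (auto simp: power2_eq_square)
      finally show ?thesis by (simp add: C2_def algebra_simps)
    qed
    have TC: "T * C2 < \<delta>" "T * C2 < R / 2" using T2 T by (auto simp: algebra_simps)
    have err: "norm (\<gamma>' t - g (\<gamma> t)) \<le> \<mu> * T" if t: "0 \<le> t" "t \<le> T" for t
    proof -
      have "\<gamma>' t = g y + G (T *\<^sub>R \<sigma> + t *\<^sub>R g y)" by (simp add: \<gamma>'_def G.add G.scaleR)
      also have "\<dots> = g y + G (\<gamma> t - y) - G (r t)" by (simp add: \<gamma>r G.add)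
      finally have "\<gamma>' t - g (\<gamma> t) = - (g (\<gamma> t) - g y - G (\<gamma> t - y)) - G (r t)" by simp
      then have "norm (\<gamma>' t - g (\<gamma> t)) \<le> norm (g (\<gamma> t) - g y - G (\<gamma> t - y)) + norm (G (r t))"
        by (metis norm_minus_cancel norm_triangle_ineq4)
      also have "\<dots> \<le> \<kappa> * (T * C2) + (T\<^sup>2 * C1) * NG"
      proof (rule add_mono)
        have "norm (g (\<gamma> t) - g y - G (\<gamma> t - y)) \<le> \<kappa> * norm (\<gamma> t - y)"
          using \<gamma>b[OF t] TC by (intro \<delta>(2)) auto
        also have "\<dots> \<le> \<kappa> * (T * C2)" using \<gamma>b[OF t] \<kappa> by (intro mult_left_mono) auto
        finally show "norm (g (\<gamma> t) - g y - G (\<gamma> t - y)) \<le> \<kappa> * (T * C2)" .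
        show "norm (G (r t)) \<le> (T\<^sup>2 * C1) * NG"
          using NG(2)[of "r t"] mult_right_mono[OF rb[OF t], of NG] NG(1) by linarith
      qed
      also have "\<dots> = (\<kappa> * C2 + NG * C1 * T) * T" by (simp add: power2_eq_square algebra_simps)
      also have "\<dots> \<le> \<mu> * T" using \<kappa>C T3 T by (intro mult_right_mono) auto
      finally show ?thesis .
    qed
    have "(infdist (\<gamma> T) ?F)\<^sup>2 \<le> exp (2 * \<Lambda> * T + 1) * ((infdist (\<gamma> 0) ?F)\<^sup>2 + T\<^sup>2 * (\<mu> * T)\<^sup>2)"
    proof (rule infdist_sq_growth[OF T(1) L, where \<gamma>' = \<gamma>' and v = "\<lambda>t. g (\<gamma> t)"])
      show "0 \<le> \<mu> * T" using \<mu> T by simp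
      show "(\<gamma> has_vector_derivative \<gamma>' t) (at t)" for t
        unfolding \<gamma>_def \<gamma>'_def
        by (auto intro!: derivative_eq_intros simp: algebra_simps)
      fix t assume t: "0 \<le> t" "t \<le> T"
      show "norm (\<gamma>' t - g (\<gamma> t)) \<le> \<mu> * T" by (rule err[OF t])
      obtain z where z: "z \<in> ?F" "infdist (\<gamma> t) ?F = dist (\<gamma> t) z"
        using infdist_attains_inf[of ?F "\<gamma> t"] compact_imp_closed[OF F(1)] yF by blast
      have \<gamma>R: "dist (\<gamma> t) y < R / 2" using \<gamma>b[OF t] TC by (simp add: dist_norm)
      have "dist (\<gamma> t) z \<le> dist (\<gamma> t) y" using infdist_le[OF yF, of "\<gamma> t"] z by simp
      then have "dist y z < R"
        using dist_triangle[of y z "\<gamma> t"] \<gamma>R by (simp add: dist_commute)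
      then have zb: "z \<in> ball y R" by simp
      then obtain \<epsilon> where \<epsilon>: "\<epsilon> > 0" "ball z \<epsilon> \<subseteq> ball y R"
        by (meson open_ball openE)
      have "proximal_normal F z (\<gamma> t - z)"
      proof (rule nearest_point_proximal_normal[OF _ \<epsilon>(1)])
        fix w assume "w \<in> F" "dist w z < \<epsilon>"
        then have "w \<in> ball z \<epsilon>" by (simp add: dist_commute)
        then have "w \<in> ball y R" using \<epsilon>(2) by blast
        then have "w \<in> ?F" using \<open>w \<in> F\<close> by auto
        from infdist_le[OF this, of "\<gamma> t"] show "dist (\<gamma> t) z \<le> dist (\<gamma> t) w" using z by simp
      qed (use z in simp)
      then have "g z \<bullet> (\<gamma> t - z) = 0" using tan z zb by blast
      then have "(\<gamma> t - z) \<bullet> g (\<gamma> t) = (\<gamma> t - z) \<bullet> (g (\<gamma> t) - g z)"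
        by (simp add: inner_diff_right inner_commute)
      also have "\<dots> \<le> norm (\<gamma> t - z) * norm (g (\<gamma> t) - g z)" by (rule norm_cauchy_schwarz)
      also have "\<dots> \<le> norm (\<gamma> t - z) * (\<Lambda> * norm (\<gamma> t - z))"
        using \<gamma>R R zb by (intro mult_left_mono lip) (auto simp: dist_commute)
      finally have "(\<gamma> t - z) \<bullet> g (\<gamma> t) \<le> \<Lambda> * (dist (\<gamma> t) z)\<^sup>2"
        by (simp add: dist_norm power2_eq_square algebra_simps)
      with z show "\<exists>z\<in>?F. infdist (\<gamma> t) ?F = dist (\<gamma> t) z
          \<and> (\<gamma> t - z) \<bullet> g (\<gamma> t) \<le> \<Lambda> * (dist (\<gamma> t) z)\<^sup>2" by blast
    qed
    also have "\<dots> \<le> E * ((\<mu> * T\<^sup>2)\<^sup>2 + T\<^sup>2 * (\<mu> * T)\<^sup>2)"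
    proof (rule mult_mono)
      have "\<Lambda> * T \<le> \<Lambda>" using mult_left_mono[of T 1 \<Lambda>] L T1 by simp
      then show "exp (2 * \<Lambda> * T + 1) \<le> E" by (simp add: E_def)
      have "infdist (\<gamma> 0) ?F \<le> \<mu> * T\<^sup>2" using \<tau>0(2)[of T] T T1 by (simp add: \<gamma>_def)
      then show "(infdist (\<gamma> 0) ?F)\<^sup>2 + T\<^sup>2 * (\<mu> * T)\<^sup>2 \<le> (\<mu> * T\<^sup>2)\<^sup>2 + T\<^sup>2 * (\<mu> * T)\<^sup>2"
        by (intro add_right_mono power_mono infdist_nonneg)
    qed (use E in auto)
    also have "\<dots> = (2 * E * \<mu>\<^sup>2) * (T\<^sup>2)\<^sup>2" by (simp add: power2_eq_square algebra_simps)
    also have "\<dots> \<le> e\<^sup>2 * (T\<^sup>2)\<^sup>2"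
    proof (rule mult_right_mono)
      have "2 * E * \<mu>\<^sup>2 = e\<^sup>2 / (2 * E)" using E by (simp add: \<mu>_def power2_eq_square field_simps)
      also have "\<dots> \<le> e\<^sup>2 / 1" using E e by (intro divide_left_mono) auto
      finally show "2 * E * \<mu>\<^sup>2 \<le> e\<^sup>2" by simp
    qed simp
    finally have "(infdist (\<gamma> T) ?F)\<^sup>2 \<le> (e * T\<^sup>2)\<^sup>2" by (simp add: power_mult_distrib)
    then have "infdist (\<gamma> T) ?F \<le> e * T\<^sup>2" by (rule power2_le_imp_le) (use e in simp)
    moreover have "\<gamma> T = y + T *\<^sub>R (\<sigma> + g y) + T\<^sup>2 *\<^sub>R (\<rho> + G \<sigma> + (1/2) *\<^sub>R G (g y))"
      by (simp add: \<gamma>_def algebra_simps power2_eq_square)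
    ultimately show ?thesis by simp
  qed
  ultimately show "\<exists>\<tau>>0. \<forall>T. 0 < T \<and> T < \<tau> \<longrightarrow>
    infdist (y + T *\<^sub>R (\<sigma> + g y) + T\<^sup>2 *\<^sub>R (\<rho> + G \<sigma> + (1/2) *\<^sub>R G (g y))) ?F \<le> e * T\<^sup>2"
    by blast
qed

text \<open>A point of \<open>F\<close> within \<open>o(T\<^sup>2)\<close> of \<open>y + T\<^sup>2 \<rho>\<close> has distance \<open>O(T\<^sup>2)\<close> from \<open>y\<close>, so the normal
  inequality at \<open>y\<close> reads \<open>2 T\<^sup>2 (\<rho> \<bullet> n) \<le> o(T\<^sup>2)\<close>.\<close>

lemma reachable_second_order_normal:
  fixes F :: "'e::euclidean_space set"
  assumes "closed F" "reachable F y 0 \<rho>" "proximal_normal F y n"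
  shows "\<rho> \<bullet> n \<le> 0"
proof (rule ccontr)
  assume "\<not> ?thesis"
  then have pos: "\<rho> \<bullet> n > 0" by simp
  then have n0: "norm n > 0" by auto
  obtain d where yF: "y \<in> F" and d: "d > 0"
    "\<And>z. z \<in> F \<Longrightarrow> dist z y < d \<Longrightarrow> 2 * (n \<bullet> (z - y)) \<le> (norm (z - y))\<^sup>2"
    using assms(3) unfolding proximal_normal_def by blast
  define e where "e = (\<rho> \<bullet> n) / (4 * norm n)"
  have e: "e > 0" using pos n0 by (simp add: e_def)
  obtain \<tau> where \<tau>: "\<tau> > 0" "\<And>T. 0 < T \<Longrightarrow> T < \<tau> \<Longrightarrow> infdist (y + T\<^sup>2 *\<^sub>R \<rho>) F \<le> e * T\<^sup>2"
    using assms(2) e unfolding reachable_def by force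
  define C where "C = norm \<rho> + e"
  have C: "C > 0" using e by (simp add: C_def add_nonneg_pos)
  \<comment> \<open>The last bound makes \<open>\<bar>z - y\<bar>\<^sup>2 \<le> C\<^sup>2 T\<^sup>4\<close> smaller than \<open>(\<rho> \<bullet> n) T\<^sup>2\<close>.\<close>
  define M where "M = Min {1, \<tau>, d / C, (\<rho> \<bullet> n) / C\<^sup>2}"
  define T where "T = M / 2"
  have "M > 0" using \<tau> d C pos by (auto simp: M_def)
  moreover have "M \<le> 1" "M \<le> \<tau>" "M \<le> d / C" "M \<le> (\<rho> \<bullet> n) / C\<^sup>2" by (auto simp: M_def)
  ultimately have "0 < T \<and> T < 1 \<and> T < \<tau> \<and> T < d / C \<and> T < (\<rho> \<bullet> n) / C\<^sup>2"
    unfolding T_def by linarith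
  then have T: "0 < T" "T < 1" "T < \<tau>" "T * C < d" "T * C\<^sup>2 < \<rho> \<bullet> n"
    using C by (auto simp: pos_less_divide_eq)
  have TT: "T\<^sup>2 \<le> T" using T by (simp add: power2_eq_square)
  obtain z where z: "z \<in> F" "infdist (y + T\<^sup>2 *\<^sub>R \<rho>) F = dist (y + T\<^sup>2 *\<^sub>R \<rho>) z"
    using infdist_attains_inf[OF assms(1)] yF by blast
  have zd: "norm (z - y - T\<^sup>2 *\<^sub>R \<rho>) \<le> e * T\<^sup>2"
    using \<tau>(2)[of T] T z by (simp add: dist_norm norm_minus_commute algebra_simps)
  have "norm (z - y) \<le> norm (z - y - T\<^sup>2 *\<^sub>R \<rho>) + norm (T\<^sup>2 *\<^sub>R \<rho>)"
    by (metis diff_add_cancel norm_triangle_ineq)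
  also have "\<dots> \<le> C * T\<^sup>2" using zd by (simp add: C_def algebra_simps)
  finally have zy: "norm (z - y) \<le> C * T\<^sup>2" .
  also have "\<dots> \<le> T * C" using TT C by (simp add: mult.commute)
  finally have "dist z y < d" using T by (simp add: dist_norm)
  then have "2 * (n \<bullet> (z - y)) \<le> (norm (z - y))\<^sup>2" using d z by blast
  also have "\<dots> \<le> (C * T\<^sup>2)\<^sup>2" using zy by (intro power_mono) auto
  also have "\<dots> = C\<^sup>2 * T\<^sup>2 * T\<^sup>2" by (simp add: power2_eq_square algebra_simps)
  also have "\<dots> \<le> C\<^sup>2 * T * T\<^sup>2" using TT by (intro mult_right_mono mult_left_mono) auto
  also have "\<dots> \<le> (\<rho> \<bullet> n) * T\<^sup>2" using T by (intro mult_right_mono) (auto simp: mult.commute)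
  finally have 1: "2 * (n \<bullet> (z - y)) \<le> (\<rho> \<bullet> n) * T\<^sup>2" .
  have "n \<bullet> (z - y) = T\<^sup>2 * (\<rho> \<bullet> n) + n \<bullet> (z - y - T\<^sup>2 *\<^sub>R \<rho>)"
    by (simp add: inner_diff_right inner_commute)
  moreover have "n \<bullet> (z - y - T\<^sup>2 *\<^sub>R \<rho>) \<ge> - (norm n * (e * T\<^sup>2))"
    using Cauchy_Schwarz_ineq2[of n "z - y - T\<^sup>2 *\<^sub>R \<rho>"] mult_left_mono[OF zd, of "norm n"] by auto
  moreover have "norm n * (e * T\<^sup>2) = (\<rho> \<bullet> n) * T\<^sup>2 / 4"
    using n0 by (simp add: e_def)
  moreover have "(\<rho> \<bullet> n) * T\<^sup>2 > 0" using pos T by simp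
  moreover have "T\<^sup>2 * (\<rho> \<bullet> n) = (\<rho> \<bullet> n) * T\<^sup>2" by (rule mult.commute)
  ultimately show False using 1 by linarith
qed

lemma proximal_normal_Int_cball:
  "proximal_normal F y n \<Longrightarrow> R > 0 \<Longrightarrow> proximal_normal (F \<inter> cball y R) y n"
  unfolding proximal_normal_def by auto

text \<open>Four steps along \<open>a\<close>, \<open>b\<close>, \<open>-a\<close>, \<open>-b\<close>: the first-order terms cancel and the second-order
  terms add up to the bracket.\<close>

lemma bracket_tangent_le:
  fixes a b :: "'e::euclidean_space \<Rightarrow> 'e"
  assumes R: "R > 0" and F: "compact (F \<inter> cball y R)"
    and L: "\<Lambda> \<ge> 0"
    and lip: "\<And>x z. x \<in> cball y R \<Longrightarrow> z \<in> cball y R \<Longrightarrow> norm (a x - a z) \<le> \<Lambda> * norm (x - z)"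
      "\<And>x z. x \<in> cball y R \<Longrightarrow> z \<in> cball y R \<Longrightarrow> norm (b x - b z) \<le> \<Lambda> * norm (x - z)"
    and A: "(a has_derivative A) (at y)" and B: "(b has_derivative B) (at y)"
    and tan: "\<And>z n. z \<in> F \<Longrightarrow> z \<in> ball y R \<Longrightarrow> proximal_normal F z n \<Longrightarrow> a z \<bullet> n = 0"
      "\<And>z n. z \<in> F \<Longrightarrow> z \<in> ball y R \<Longrightarrow> proximal_normal F z n \<Longrightarrow> b z \<bullet> n = 0"
    and n: "proximal_normal F y n"
  shows "(B (a y) - A (b y)) \<bullet> n \<le> 0"
proof -
  have yF: "y \<in> F" using n by (simp add: proximal_normal_def)
  interpret A: bounded_linear A using A by (rule has_derivative_bounded_linear)
  interpret B: bounded_linear B using B by (rule has_derivative_bounded_linear)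
  note step = reachable_step[OF R F yF L]
  have "reachable (F \<inter> cball y R) y 0 0"
    using yF R by (auto simp: reachable_def intro!: exI[of _ 1])
  from step[OF lip(1) A tan(1) this]
  have "reachable (F \<inter> cball y R) y (a y) ((1/2) *\<^sub>R A (a y))" by (simp add: A.zero)
  from step[OF lip(2) B tan(2) this]
  have "reachable (F \<inter> cball y R) y (a y + b y)
    ((1/2) *\<^sub>R A (a y) + B (a y) + (1/2) *\<^sub>R B (b y))" .
  from step[of "\<lambda>x. - a x", OF _ has_derivative_minus[OF A] _ this] lip(1) tan(1)
  have "reachable (F \<inter> cball y R) y (a y + b y - a y)
    ((1/2) *\<^sub>R A (a y) + B (a y) + (1/2) *\<^sub>R B (b y) - A (a y + b y) + (1/2) *\<^sub>R A (a y))"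
    by (simp add: linear_neg[OF A.linear] norm_minus_commute)
  also have "(1/2) *\<^sub>R A (a y) + B (a y) + (1/2) *\<^sub>R B (b y) - A (a y + b y) + (1/2) *\<^sub>R A (a y)
    = B (a y) - A (b y) + (1/2) *\<^sub>R B (b y)"
    using scaleR_half_double[of "A (a y)"] by (simp add: A.add algebra_simps)
  finally have "reachable (F \<inter> cball y R) y (b y) (B (a y) - A (b y) + (1/2) *\<^sub>R B (b y))"
    by simp
  from step[of "\<lambda>x. - b x", OF _ has_derivative_minus[OF B] _ this] lip(2) tan(2)
  have "reachable (F \<inter> cball y R) y 0
    (B (a y) - A (b y) + (1/2) *\<^sub>R B (b y) - B (b y) + (1/2) *\<^sub>R B (b y))"
    by (simp add: linear_neg[OF B.linear] norm_minus_commute)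
  also have "B (a y) - A (b y) + (1/2) *\<^sub>R B (b y) - B (b y) + (1/2) *\<^sub>R B (b y) = B (a y) - A (b y)"
    using scaleR_half_double[of "B (b y)"] by (simp add: algebra_simps)
  finally show ?thesis
    by (rule reachable_second_order_normal[OF compact_imp_closed[OF F] _ proximal_normal_Int_cball[OF n R]])
qed

text \<open>Exchanging \<open>a\<close> and \<open>b\<close> reverses the sign of the bracket.\<close>

proposition bracket_tangent:
  fixes a b :: "'e::euclidean_space \<Rightarrow> 'e"
  assumes "R > 0" "compact (F \<inter> cball y R)" "\<Lambda> \<ge> 0"
    and "\<And>x z. x \<in> cball y R \<Longrightarrow> z \<in> cball y R \<Longrightarrow> norm (a x - a z) \<le> \<Lambda> * norm (x - z)"
      "\<And>x z. x \<in> cball y R \<Longrightarrow> z \<in> cball y R \<Longrightarrow> norm (b x - b z) \<le> \<Lambda> * norm (x - z)"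
    and "(a has_derivative A) (at y)" "(b has_derivative B) (at y)"
    and "\<And>z n. z \<in> F \<Longrightarrow> z \<in> ball y R \<Longrightarrow> proximal_normal F z n \<Longrightarrow> a z \<bullet> n = 0"
      "\<And>z n. z \<in> F \<Longrightarrow> z \<in> ball y R \<Longrightarrow> proximal_normal F z n \<Longrightarrow> b z \<bullet> n = 0"
    and "proximal_normal F y n"
  shows "(B (a y) - A (b y)) \<bullet> n = 0"
proof -
  have "(B (a y) - A (b y)) \<bullet> n \<le> 0" by (rule bracket_tangent_le[OF assms])
  moreover have "(A (b y) - B (a y)) \<bullet> n \<le> 0"
    by (rule bracket_tangent_le[OF assms(1-3,5,4,7,6,9,8,10)])
  ultimately show ?thesis by (simp add: inner_diff_left)
qed

section \<open>Tangent vectors and vector fields in charts\<close>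

locale smooth_manifold =
  fixes A :: "('a::{t2_space, second_countable_topology}, 'e::euclidean_space) chart set"
  assumes atlas: "smooth_atlas A"
begin

lemma chart:
  assumes "(V, \<phi>) \<in> A"
  shows chart_open: "open V" and chart_image_open: "open (\<phi> ` V)"
    and chart_continuous: "continuous_on V \<phi>"
    and chart_inv_continuous: "continuous_on (\<phi> ` V) (inv_into V \<phi>)"
    and chart_inv: "p \<in> V \<Longrightarrow> inv_into V \<phi> (\<phi> p) = p"
proof -
  have "is_chart (V, \<phi>)" using atlas assms unfolding smooth_atlas_def by blast
  then have *: "open V" "open (\<phi> ` V)" "homeomorphism V (\<phi> ` V) \<phi> (inv_into V \<phi>)"
    unfolding is_chart_def by auto
  show "open V" "open (\<phi> ` V)" by fact+
  show "continuous_on V \<phi>" "continuous_on (\<phi> ` V) (inv_into V \<phi>)"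
    "p \<in> V \<Longrightarrow> inv_into V \<phi> (\<phi> p) = p"
    using *(3) unfolding homeomorphism_def by blast+
qed

lemma chart_covering: obtains V \<phi> where "(V, \<phi>) \<in> A" "p \<in> V"
proof -
  have "p \<in> (\<Union>c\<in>A. fst c)" using atlas unfolding smooth_atlas_def by blast
  then obtain c where "c \<in> A" "p \<in> fst c" by blast
  then show thesis using that[of "fst c" "snd c"] by simp
qed

lemma chart_image_Int_open:
  assumes "(V, \<phi>) \<in> A" "open U"
  shows "open (\<phi> ` (U \<inter> V))"
proof -
  have "\<phi> ` (U \<inter> V) = inv_into V \<phi> -` U \<inter> \<phi> ` V"
    using chart_inv[OF assms(1)] by force
  then show ?thesis
    using continuous_on_open_vimage[OF chart_image_open[OF assms(1)], of "inv_into V \<phi>"]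
      chart_inv_continuous[OF assms(1)] assms(2) by auto
qed

lemma transition_smooth:
  "(V, \<phi>) \<in> A \<Longrightarrow> (W, \<psi>) \<in> A \<Longrightarrow> smooth_on (\<phi> ` (V \<inter> W)) (\<psi> \<circ> inv_into V \<phi>)"
  using atlas unfolding smooth_atlas_def smooth_transition_def by blast

text \<open>The preimages under a chart of an open ball and of its closure.\<close>

lemma compact_neighbourhood:
  fixes p :: 'a
  assumes "open N" "p \<in> N"
  obtains G C where "open G" "compact C" "p \<in> G" "G \<subseteq> C" "C \<subseteq> N"
proof -
  obtain V \<phi> where c: "(V, \<phi>) \<in> A" "p \<in> V" by (rule chart_covering)
  have "open (\<phi> ` (N \<inter> V))" "\<phi> p \<in> \<phi> ` (N \<inter> V)"
    using chart_image_Int_open[OF c(1) assms(1)] assms(2) c(2) by auto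
  then obtain r where r: "r > 0" "cball (\<phi> p) r \<subseteq> \<phi> ` (N \<inter> V)"
    using open_contains_cball by blast
  define C where "C = inv_into V \<phi> ` cball (\<phi> p) r"
  define G where "G = \<phi> -` ball (\<phi> p) r \<inter> V"
  have "open G"
    unfolding G_def
    using continuous_on_open_vimage[OF chart_open[OF c(1)], of \<phi>] chart_continuous[OF c(1)] by auto
  moreover have "compact C"
    unfolding C_def
    by (rule compact_continuous_image[OF continuous_on_subset[OF chart_inv_continuous[OF c(1)]]])
      (use r in auto)
  moreover have "p \<in> G" using c r by (simp add: G_def)
  moreover have "G \<subseteq> C"
  proof
    fix q assume "q \<in> G"
    then have "q = inv_into V \<phi> (\<phi> q)" "\<phi> q \<in> cball (\<phi> p) r"
      using chart_inv[OF c(1)] by (auto simp: G_def)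
    then show "q \<in> C" unfolding C_def by blast
  qed
  moreover have "C \<subseteq> N"
    unfolding C_def using r(2) chart_inv[OF c(1)] by force
  ultimately show thesis by (rule that)
qed

lemma smooth_funD:
  "smooth_fun A U f \<Longrightarrow> (V, \<phi>) \<in> A \<Longrightarrow> smooth_on (\<phi> ` (U \<inter> V)) (f \<circ> inv_into V \<phi>)"
  unfolding smooth_fun_def by auto

lemma smooth_funI:
  "(\<And>V \<phi>. (V, \<phi>) \<in> A \<Longrightarrow> smooth_on (\<phi> ` (U \<inter> V)) (f \<circ> inv_into V \<phi>)) \<Longrightarrow> smooth_fun A U f"
  unfolding smooth_fun_def by auto

lemma smooth_fun_subset: "smooth_fun A U f \<Longrightarrow> W \<subseteq> U \<Longrightarrow> smooth_fun A W f"
  by (rule smooth_funI, rule smooth_on_subset[OF smooth_funD], assumption+, blast)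

lemma smooth_fun_cong:
  assumes "open U" "smooth_fun A U f" "\<And>p. p \<in> U \<Longrightarrow> f p = g p"
  shows "smooth_fun A U g"
proof (rule smooth_funI)
  fix V \<phi> assume c: "(V, \<phi>) \<in> A"
  show "smooth_on (\<phi> ` (U \<inter> V)) (g \<circ> inv_into V \<phi>)"
    by (rule smooth_on_cong[OF chart_image_Int_open[OF c assms(1)] smooth_funD[OF assms(2) c]])
      (auto simp: chart_inv[OF c] assms(3))
qed

lemma smooth_fun_local:
  assumes "\<And>p. p \<in> U \<Longrightarrow> \<exists>W. open W \<and> p \<in> W \<and> smooth_fun A W f"
  shows "smooth_fun A U f"
proof (rule smooth_funI)
  fix V \<phi> assume c: "(V, \<phi>) \<in> A"
  show "smooth_on (\<phi> ` (U \<inter> V)) (f \<circ> inv_into V \<phi>)"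
  proof (rule smooth_on_local)
    fix x assume "x \<in> \<phi> ` (U \<inter> V)"
    then obtain p where p: "p \<in> U" "p \<in> V" "x = \<phi> p" by auto
    obtain W where W: "open W" "p \<in> W" "smooth_fun A W f" using assms p by blast
    show "\<exists>T. open T \<and> x \<in> T \<and> smooth_on T (f \<circ> inv_into V \<phi>)"
      using chart_image_Int_open[OF c W(1)] smooth_funD[OF W(3) c] p W
      by (intro exI[of _ "\<phi> ` (W \<inter> V)"]) auto
  qed
qed

lemma smooth_fun_const [simp]: "smooth_fun A U (\<lambda>p. c)"
  by (rule smooth_funI) (simp add: o_def smooth_on_def)

lemma smooth_fun_add:
  assumes "open U" "smooth_fun A U f" "smooth_fun A U g"
  shows "smooth_fun A U (\<lambda>p. f p + g p)"
  using smooth_funD[OF assms(2)] smooth_funD[OF assms(3)] chart_image_Int_open[OF _ assms(1)]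
  by (intro smooth_funI) (simp add: o_def smooth_on_def higher_differentiable_on_add)

lemma smooth_fun_mult:
  assumes "open U" "smooth_fun A U f" "smooth_fun A U g"
  shows "smooth_fun A U (\<lambda>p. f p * g p)"
  using smooth_funD[OF assms(2)] smooth_funD[OF assms(3)] chart_image_Int_open[OF _ assms(1)]
  by (intro smooth_funI) (simp add: o_def smooth_on_def higher_differentiable_on_mult)

lemma smooth_fun_inverse:
  assumes "open U" "smooth_fun A U f" "\<And>p. p \<in> U \<Longrightarrow> f p \<noteq> 0"
  shows "smooth_fun A U (\<lambda>p. inverse (f p))"
proof (rule smooth_funI)
  fix V \<phi> assume c: "(V, \<phi>) \<in> A"
  have "(f \<circ> inv_into V \<phi>) x \<noteq> 0" if "x \<in> \<phi> ` (U \<inter> V)" for x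
    using that assms(3) chart_inv[OF c] by auto
  then show "smooth_on (\<phi> ` (U \<inter> V)) ((\<lambda>p. inverse (f p)) \<circ> inv_into V \<phi>)"
    using smooth_funD[OF assms(2) c] chart_image_Int_open[OF c assms(1)]
    by (simp add: o_def smooth_on_def higher_differentiable_on_inverse)
qed

lemma smooth_fun_cmult: "open U \<Longrightarrow> smooth_fun A U f \<Longrightarrow> smooth_fun A U (\<lambda>p. c * f p)"
  by (rule smooth_fun_mult) auto

lemma smooth_fun_diff:
  assumes "open U" "smooth_fun A U f" "smooth_fun A U g"
  shows "smooth_fun A U (\<lambda>p. f p - g p)"
  using smooth_fun_add[OF assms(1,2) smooth_fun_cmult[OF assms(1,3), of "-1"]] by simp

lemma smooth_fun_divide:
  assumes "open U" "smooth_fun A U f" "smooth_fun A U g" "\<And>p. p \<in> U \<Longrightarrow> g p \<noteq> 0"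
  shows "smooth_fun A U (\<lambda>p. f p / g p)"
  using smooth_fun_mult[OF assms(1,2) smooth_fun_inverse[OF assms(1,3,4)]]
  by (simp add: divide_inverse)

lemma smooth_fun_sum:
  "open U \<Longrightarrow> (\<And>i. i \<in> I \<Longrightarrow> smooth_fun A U (f i)) \<Longrightarrow> smooth_fun A U (\<lambda>p. \<Sum>i\<in>I. f i p)"
  by (induction I rule: infinite_finite_induct) (auto intro: smooth_fun_add)

lemma smooth_fun_continuous_on:
  assumes "open U" "smooth_fun A U f"
  shows "continuous_on U f"
proof (rule continuous_at_imp_continuous_on, rule ballI)
  fix p assume p: "p \<in> U"
  obtain V \<phi> where c: "(V, \<phi>) \<in> A" "p \<in> V" by (rule chart_covering)
  have "continuous_on (U \<inter> V) ((f \<circ> inv_into V \<phi>) \<circ> \<phi>)"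
    by (rule continuous_on_compose)
      (auto intro: continuous_on_subset[OF chart_continuous[OF c(1)]]
        smooth_on_continuous_on[OF smooth_funD[OF assms(2) c(1)], unfolded o_def])
  then have "continuous_on (U \<inter> V) f"
    by (rule continuous_on_eq) (simp add: chart_inv[OF c(1)])
  then show "isCont f p"
    using continuous_on_eq_continuous_at[of "U \<inter> V" f] chart_open[OF c(1)] assms(1) p c by auto
qed

lemma smooth_fun_coordinate:
  assumes "(V, \<phi>) \<in> A"
  shows "smooth_fun A V (\<lambda>q. \<phi> q \<bullet> b)"
proof (rule smooth_funI)
  fix W \<psi> assume d: "(W, \<psi>) \<in> A"
  show "smooth_on (\<psi> ` (V \<inter> W)) ((\<lambda>q. \<phi> q \<bullet> b) \<circ> inv_into W \<psi>)"
    using transition_smooth[OF d assms] chart_image_Int_open[OF d chart_open[OF assms]]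
    by (simp add: smooth_on_def o_def Int_commute higher_differentiable_on_inner_const)
qed

lemma smooth_nearI: "open U \<Longrightarrow> smooth_fun A U f \<Longrightarrow> p \<in> U \<Longrightarrow> smooth_near A p f"
  unfolding smooth_near_def by blast

lemma smooth_near_differentiable:
  assumes "smooth_near A p f" "(V, \<phi>) \<in> A" "p \<in> V"
  shows "(f \<circ> inv_into V \<phi>) differentiable (at (\<phi> p))"
proof -
  obtain U where "open U" "p \<in> U" "smooth_fun A U f"
    using assms(1) unfolding smooth_near_def by blast
  then show ?thesis using smooth_on_differentiable[OF smooth_funD[OF _ assms(2)]] assms(3) by blast
qed

definition components :: "('a \<Rightarrow> 'e) \<Rightarrow> 'a tvec \<Rightarrow> 'e"
  where "components \<phi> v = (\<Sum>b\<in>Basis. v (\<lambda>q. \<phi> q \<bullet> b) *\<^sub>R b)"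

lemma components_inner: "b \<in> Basis \<Longrightarrow> components \<phi> v \<bullet> b = v (\<lambda>q. \<phi> q \<bullet> b)"
  by (simp add: components_def inner_sum_left inner_Basis if_distrib sum.delta cong: if_cong)

text \<open>A tangent vector is thus recovered from its values on the coordinate functions, which makes
  the smoothness of coordinate expressions of sections immediate.\<close>

lemma components_coord_vector:
  assumes c: "(V, \<phi>) \<in> A" and p: "p \<in> V"
  shows "components \<phi> (coord_vector A (V, \<phi>) p w) = w"
proof (rule euclidean_eqI)
  fix b :: 'e assume b: "b \<in> Basis"
  have near: "smooth_near A p (\<lambda>q. \<phi> q \<bullet> b)"
    by (rule smooth_nearI[OF chart_open[OF c] smooth_fun_coordinate[OF c] p])
  have "frechet_derivative ((\<lambda>q. \<phi> q \<bullet> b) \<circ> inv_into V \<phi>) (at (\<phi> p))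
      = frechet_derivative (\<lambda>x. x \<bullet> b) (at (\<phi> p))"
    by (rule frechet_derivative_cong_open[OF chart_image_open[OF c]])
      (use p in \<open>auto simp: chart_inv[OF c]\<close>)
  also have "\<dots> = (\<lambda>x. x \<bullet> b)"
    by (rule frechet_derivative_eqI) (auto intro!: derivative_eq_intros)
  finally show "components \<phi> (coord_vector A (V, \<phi>) p w) \<bullet> b = w \<bullet> b"
    using near by (simp add: components_inner[OF b] coord_vector_def)
qed

text \<open>A tangent vector given in one chart is expressed in any other one by the chain rule for the
  transition map.\<close>

lemma tangent_space_in_chart:
  assumes v: "v \<in> tangent_space A p" and c: "(V, \<phi>) \<in> A" and p: "p \<in> V"
  shows "v = coord_vector A (V, \<phi>) p (components \<phi> v)"
proof -
  obtain W \<psi> w where d: "(W, \<psi>) \<in> A" "p \<in> W" "v = coord_vector A (W, \<psi>) p w"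
    using v unfolding tangent_space_def by auto
  let ?\<tau> = "\<phi> \<circ> inv_into W \<psi>"
  have pW: "\<psi> p \<in> \<psi> ` (W \<inter> V)" using p d by auto
  have op: "open (\<psi> ` (W \<inter> V))"
    using chart_image_Int_open[OF d(1) chart_open[OF c]] by (simp add: Int_commute)
  have \<tau>: "?\<tau> differentiable (at (\<psi> p))"
    by (rule smooth_on_differentiable[OF transition_smooth[OF d(1) c] pW])
  have \<tau>p: "?\<tau> (\<psi> p) = \<phi> p" using d by (simp add: chart_inv[OF d(1)])
  have "v f = coord_vector A (V, \<phi>) p (frechet_derivative ?\<tau> (at (\<psi> p)) w) f" for f
  proof (cases "smooth_near A p f")
    case True
    have "frechet_derivative (f \<circ> inv_into W \<psi>) (at (\<psi> p))
        = frechet_derivative ((f \<circ> inv_into V \<phi>) \<circ> ?\<tau>) (at (\<psi> p))"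
      by (rule frechet_derivative_cong_open[OF op pW])
        (auto simp: chart_inv[OF d(1)] chart_inv[OF c])
    also have "\<dots> = frechet_derivative (f \<circ> inv_into V \<phi>) (at (\<phi> p)) \<circ> frechet_derivative ?\<tau> (at (\<psi> p))"
      using frechet_derivative_compose[OF \<tau>, of "f \<circ> inv_into V \<phi>"]
        smooth_near_differentiable[OF True c p] \<tau>p by simp
    finally show ?thesis using True by (simp add: d coord_vector_def)
  qed (simp add: d coord_vector_def)
  then have "v = coord_vector A (V, \<phi>) p (frechet_derivative ?\<tau> (at (\<psi> p)) w)" by blast
  then show ?thesis using components_coord_vector[OF c p] by metis
qed

lemma tangent_apply:
  assumes "v \<in> tangent_space A p" "(V, \<phi>) \<in> A" "p \<in> V" "smooth_near A p f"
  shows "v f = frechet_derivative (f \<circ> inv_into V \<phi>) (at (\<phi> p)) (components \<phi> v)"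
  by (subst tangent_space_in_chart[OF assms(1-3)]) (simp add: coord_vector_def assms(4))

lemma smooth_near_cong:
  assumes "open U" "p \<in> U" "\<And>q. q \<in> U \<Longrightarrow> f q = g q" "smooth_near A p f"
  shows "smooth_near A p g"
proof -
  obtain W where W: "open W" "p \<in> W" "smooth_fun A W f"
    using assms(4) unfolding smooth_near_def by blast
  have "smooth_fun A (W \<inter> U) g"
    by (rule smooth_fun_cong[OF _ smooth_fun_subset[OF W(3)]]) (use W assms in auto)
  then show ?thesis using W assms by (intro smooth_nearI[of "W \<inter> U"]) auto
qed

lemma tangent_cong:
  assumes v: "v \<in> tangent_space A p" and U: "open U" "p \<in> U" "\<And>q. q \<in> U \<Longrightarrow> f q = g q"
  shows "v f = v g"
proof -
  obtain V \<phi> where c: "(V, \<phi>) \<in> A" "p \<in> V" by (rule chart_covering)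
  have near: "smooth_near A p f \<longleftrightarrow> smooth_near A p g"
    using smooth_near_cong[OF U(1,2), of f g] smooth_near_cong[OF U(1,2), of g f] U(3) by auto
  have "frechet_derivative (f \<circ> inv_into V \<phi>) (at (\<phi> p))
      = frechet_derivative (g \<circ> inv_into V \<phi>) (at (\<phi> p))"
    by (rule frechet_derivative_cong_open[OF chart_image_Int_open[OF c(1) U(1)]])
      (use U c in \<open>auto simp: chart_inv[OF c(1)]\<close>)
  then show ?thesis
    by (subst (1 2) tangent_space_in_chart[OF v c]) (simp add: coord_vector_def near)
qed

lemma tangent_add:
  assumes v: "v \<in> tangent_space A p" and fg: "smooth_near A p f" "smooth_near A p g"
  shows "v (\<lambda>q. f q + g q) = v f + v g"
proof -
  obtain V \<phi> where c: "(V, \<phi>) \<in> A" "p \<in> V" by (rule chart_covering)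
  obtain U W where UW: "open U" "p \<in> U" "smooth_fun A U f" "open W" "p \<in> W" "smooth_fun A W g"
    using fg unfolding smooth_near_def by blast
  have near: "smooth_near A p (\<lambda>q. f q + g q)"
    by (rule smooth_nearI[of "U \<inter> W"])
      (use UW in \<open>auto intro!: smooth_fun_add intro: smooth_fun_subset\<close>)
  note D = smooth_near_differentiable[OF _ c, THEN frechet_derivative_works[THEN iffD1]]
  have "((\<lambda>q. f q + g q) \<circ> inv_into V \<phi> has_derivative
      (\<lambda>x. frechet_derivative (f \<circ> inv_into V \<phi>) (at (\<phi> p)) x
         + frechet_derivative (g \<circ> inv_into V \<phi>) (at (\<phi> p)) x)) (at (\<phi> p))"
    using has_derivative_add[OF D[OF fg(1)] D[OF fg(2)]] by (simp add: o_def)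
  then show ?thesis
    using tangent_apply[OF v c] fg near by (simp add: frechet_derivative_eqI)
qed

lemma tangent_mult:
  assumes v: "v \<in> tangent_space A p" and fg: "smooth_near A p f" "smooth_near A p g"
  shows "v (\<lambda>q. f q * g q) = f p * v g + v f * g p"
proof -
  obtain V \<phi> where c: "(V, \<phi>) \<in> A" "p \<in> V" by (rule chart_covering)
  obtain U W where UW: "open U" "p \<in> U" "smooth_fun A U f" "open W" "p \<in> W" "smooth_fun A W g"
    using fg unfolding smooth_near_def by blast
  have near: "smooth_near A p (\<lambda>q. f q * g q)"
    by (rule smooth_nearI[of "U \<inter> W"])
      (use UW in \<open>auto intro!: smooth_fun_mult intro: smooth_fun_subset\<close>)
  note D = smooth_near_differentiable[OF _ c, THEN frechet_derivative_works[THEN iffD1]]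
  have "((\<lambda>q. f q * g q) \<circ> inv_into V \<phi> has_derivative
      (\<lambda>x. f p * frechet_derivative (g \<circ> inv_into V \<phi>) (at (\<phi> p)) x
         + frechet_derivative (f \<circ> inv_into V \<phi>) (at (\<phi> p)) x * g p)) (at (\<phi> p))"
    using has_derivative_mult[OF D[OF fg(1)] D[OF fg(2)]] c by (simp add: o_def chart_inv)
  then show ?thesis
    using tangent_apply[OF v c] fg near by (simp add: frechet_derivative_eqI)
qed

lemma smooth_near_const: "smooth_near A p (\<lambda>q. c)"
  by (rule smooth_nearI[of UNIV]) auto

lemma tangent_const:
  assumes v: "v \<in> tangent_space A p"
  shows "v (\<lambda>q. c) = 0"
proof -
  obtain V \<phi> where ch: "(V, \<phi>) \<in> A" "p \<in> V" by (rule chart_covering)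
  show ?thesis
    using tangent_apply[OF v ch smooth_near_const] by (simp add: o_def frechet_derivative_const)
qed

lemma tangent_cmult:
  assumes "v \<in> tangent_space A p" "smooth_near A p f"
  shows "v (\<lambda>q. c * f q) = c * v f"
  using tangent_mult[OF assms(1) smooth_near_const assms(2)] tangent_const[OF assms(1)] by simp

lemma tangent_max_zero:
  assumes v: "v \<in> tangent_space A p" and U: "open U" "p \<in> U" "smooth_fun A U f"
    and max: "\<And>q. q \<in> U \<Longrightarrow> f q \<le> f p"
  shows "v f = 0"
proof -
  obtain V \<phi> where c: "(V, \<phi>) \<in> A" "p \<in> V" by (rule chart_covering)
  have near: "smooth_near A p f" by (rule smooth_nearI[OF U(1,3,2)])
  have "frechet_derivative (f \<circ> inv_into V \<phi>) (at (\<phi> p)) = (\<lambda>v. 0)"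
  proof (rule differential_zero_maxmin[OF _ chart_image_Int_open[OF c(1) U(1)]])
    show "(f \<circ> inv_into V \<phi> has_derivative frechet_derivative (f \<circ> inv_into V \<phi>) (at (\<phi> p))) (at (\<phi> p))"
      using smooth_near_differentiable[OF near c] frechet_derivative_works by blast
    show "(\<forall>y\<in>\<phi> ` (U \<inter> V). (f \<circ> inv_into V \<phi>) y \<le> (f \<circ> inv_into V \<phi>) (\<phi> p)) \<or>
      (\<forall>y\<in>\<phi> ` (U \<inter> V). (f \<circ> inv_into V \<phi>) (\<phi> p) \<le> (f \<circ> inv_into V \<phi>) y)"
      using max c by (auto simp: chart_inv)
  qed (use U c in auto)
  then show ?thesis using tangent_apply[OF v c near] by simp
qed

lemma sectionsD:
  assumes "X \<in> sections A E U"
  shows sections_mem: "p \<in> U \<Longrightarrow> X p \<in> E p"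
    and sections_smooth: "open V \<Longrightarrow> V \<subseteq> U \<Longrightarrow> smooth_fun A V f \<Longrightarrow> smooth_fun A V (\<lambda>p. X p f)"
  using assms unfolding sections_def by auto

lemma sectionsI:
  assumes "\<And>p. p \<in> U \<Longrightarrow> X p \<in> E p"
    and "\<And>V f. open V \<Longrightarrow> V \<subseteq> U \<Longrightarrow> smooth_fun A V f \<Longrightarrow> smooth_fun A V (\<lambda>p. X p f)"
  shows "X \<in> sections A E U"
  unfolding sections_def using assms by simp

lemma sections_mono:
  assumes X: "X \<in> sections A E U" and W: "W \<subseteq> U" and E: "\<And>p. p \<in> W \<Longrightarrow> E p \<subseteq> E' p"
  shows "X \<in> sections A E' W"
proof (rule sectionsI)
  show "X p \<in> E' p" if "p \<in> W" for p using sections_mem[OF X] E W that by blast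
  show "smooth_fun A V (\<lambda>p. X p f)" if "open V" "V \<subseteq> W" "smooth_fun A V f" for V f
    using that W by (intro sections_smooth[OF X]) auto
qed

lemma sections_add:
  assumes E: "\<And>p. p \<in> U \<Longrightarrow> subspace (E p)" and X: "X \<in> sections A E U" "Y \<in> sections A E U"
  shows "X + Y \<in> sections A E U"
proof (rule sectionsI)
  show "(X + Y) p \<in> E p" if "p \<in> U" for p
    using sections_mem[OF X(1) that] sections_mem[OF X(2) that] E[OF that] by (simp add: subspace_add)
  show "smooth_fun A V (\<lambda>p. (X + Y) p f)" if "open V" "V \<subseteq> U" "smooth_fun A V f" for V f
    using smooth_fun_add[OF that(1) sections_smooth[OF X(1) that] sections_smooth[OF X(2) that]] by simp
qed

lemma sections_scale:
  assumes E: "\<And>p. p \<in> U \<Longrightarrow> subspace (E p)" and X: "X \<in> sections A E U" and h: "smooth_fun A U h"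
  shows "(\<lambda>q. h q *\<^sub>R X q) \<in> sections A E U"
proof (rule sectionsI)
  show "h p *\<^sub>R X p \<in> E p" if "p \<in> U" for p
    using sections_mem[OF X that] E[OF that] by (simp add: subspace_scale)
  show "smooth_fun A V (\<lambda>p. (h p *\<^sub>R X p) f)" if "open V" "V \<subseteq> U" "smooth_fun A V f" for V f
    using smooth_fun_mult[OF that(1) smooth_fun_subset[OF h that(2)] sections_smooth[OF X that]]
    by (simp add: scaleR_fun_def)
qed

lemma sections_zero:
  assumes E: "\<And>p. p \<in> U \<Longrightarrow> subspace (E p)"
  shows "0 \<in> sections A E U"
  by (rule sectionsI) (simp_all add: E subspace_0)

lemma sections_sum:
  assumes E: "\<And>p. p \<in> U \<Longrightarrow> subspace (E p)" and "\<And>i. i \<in> I \<Longrightarrow> X i \<in> sections A E U"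
  shows "(\<Sum>i\<in>I. X i) \<in> sections A E U"
  using assms(2)
  by (induction I rule: infinite_finite_induct)
    (auto simp: sections_zero[OF E] intro!: sections_add[OF E])

definition coordinate_field :: "('a, 'e) chart \<Rightarrow> 'a vfield \<Rightarrow> 'e \<Rightarrow> 'e"
  where "coordinate_field = (\<lambda>(V, \<phi>) X x. components \<phi> (X (inv_into V \<phi> x)))"

lemma coordinate_field_at:
  "(V, \<phi>) \<in> A \<Longrightarrow> p \<in> V \<Longrightarrow> coordinate_field (V, \<phi>) X (\<phi> p) = components \<phi> (X p)"
  by (simp add: coordinate_field_def chart_inv)

lemma coordinate_field_inner_smooth:
  assumes c: "(V, \<phi>) \<in> A" and U: "open U" and X: "X \<in> sections A E U" and b: "b \<in> Basis"
  shows "smooth_on (\<phi> ` (U \<inter> V)) (\<lambda>x. coordinate_field (V, \<phi>) X x \<bullet> b)"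
proof -
  have "smooth_fun A (U \<inter> V) (\<lambda>p. X p (\<lambda>q. \<phi> q \<bullet> b))"
    by (rule sections_smooth[OF X]) (use chart_open[OF c] U in
      \<open>auto intro!: smooth_fun_subset[OF smooth_fun_coordinate[OF c]]\<close>)
  from smooth_funD[OF this c] show ?thesis
    by (simp add: coordinate_field_def components_inner[OF b] o_def Int_absorb2)
qed

lemma coordinate_field_has_derivative:
  assumes c: "(V, \<phi>) \<in> A" and U: "open U" and X: "X \<in> sections A E U" and x: "x \<in> \<phi> ` (U \<inter> V)"
  shows "(coordinate_field (V, \<phi>) X has_derivative
    frechet_derivative (coordinate_field (V, \<phi>) X) (at x)) (at x)"
proof -
  have "coordinate_field (V, \<phi>) X differentiable (at x)"
    using coordinate_field_inner_smooth[OF c U X] x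
    by (subst differentiable_componentwise_within) (auto dest: smooth_on_differentiable)
  then show ?thesis using frechet_derivative_works by blast
qed

lemma section_apply_in_chart:
  assumes c: "(V, \<phi>) \<in> A" and U: "open U" and X: "X \<in> sections A (tangent_space A) U"
    and f: "smooth_fun A U f" and x: "x \<in> \<phi> ` (U \<inter> V)"
  shows "((\<lambda>q. X q f) \<circ> inv_into V \<phi>) x
    = frechet_derivative (f \<circ> inv_into V \<phi>) (at x) (coordinate_field (V, \<phi>) X x)"
proof -
  obtain p where p: "p \<in> U" "p \<in> V" "x = \<phi> p" using x by auto
  show ?thesis
    using tangent_apply[OF sections_mem[OF X p(1)] c p(2) smooth_nearI[OF U f p(1)]] p c
    by (simp add: coordinate_field_at chart_inv)
qed

lemma section_section_apply:
  assumes c: "(V, \<phi>) \<in> A" and p: "p \<in> U" "p \<in> V" and U: "open U"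
    and X: "X \<in> sections A (tangent_space A) U" and Y: "Y \<in> sections A (tangent_space A) U"
    and f: "smooth_fun A U f"
  defines "F \<equiv> f \<circ> inv_into V \<phi>"
    and "a \<equiv> coordinate_field (V, \<phi>) X" and "b \<equiv> coordinate_field (V, \<phi>) Y"
  shows "X p (\<lambda>q. Y q f) = frechet_derivative (\<lambda>z. frechet_derivative F (at z) (b (\<phi> p))) (at (\<phi> p)) (a (\<phi> p))
    + frechet_derivative F (at (\<phi> p)) (frechet_derivative b (at (\<phi> p)) (a (\<phi> p)))"
proof -
  have op: "open (\<phi> ` (U \<inter> V))" by (rule chart_image_Int_open[OF c U])
  have px: "\<phi> p \<in> \<phi> ` (U \<inter> V)" using p by auto
  have Yf: "smooth_near A p (\<lambda>q. Y q f)"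
    by (rule smooth_nearI[OF U sections_smooth[OF Y U order_refl f] p(1)])
  have "X p (\<lambda>q. Y q f)
      = frechet_derivative ((\<lambda>q. Y q f) \<circ> inv_into V \<phi>) (at (\<phi> p)) (a (\<phi> p))"
    using tangent_apply[OF sections_mem[OF X p(1)] c p(2) Yf] by (simp add: a_def coordinate_field_at[OF c p(2)])
  also have "frechet_derivative ((\<lambda>q. Y q f) \<circ> inv_into V \<phi>) (at (\<phi> p))
      = frechet_derivative (\<lambda>z. frechet_derivative F (at z) (b z)) (at (\<phi> p))"
    unfolding F_def b_def
    by (rule frechet_derivative_cong_open[OF op px]) (rule section_apply_in_chart[OF c U Y f])
  also have "\<dots> = (\<lambda>v. frechet_derivative (\<lambda>z. frechet_derivative F (at z) (b (\<phi> p))) (at (\<phi> p)) v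
       + frechet_derivative F (at (\<phi> p)) (frechet_derivative b (at (\<phi> p)) v))"
    by (rule frechet_derivative_eqI, rule frechet_derivative_along_field[OF op px])
      (auto simp: F_def b_def intro: smooth_funD[OF f c] coordinate_field_has_derivative[OF c U Y px])
  finally show ?thesis .
qed

text \<open>In a chart \<open>X X f\<close> is a second derivative of \<open>f\<close> plus a first derivative, and the latter
  vanishes at a maximum.\<close>

lemma section_section_nonpos_at_max:
  assumes U: "open U" "p \<in> U" and X: "X \<in> sections A (tangent_space A) U"
    and f: "smooth_fun A U f" and max: "\<And>q. q \<in> U \<Longrightarrow> f q \<le> f p"
  shows "X p (\<lambda>q. X q f) \<le> 0"
proof -
  obtain V \<phi> where c: "(V, \<phi>) \<in> A" "p \<in> V" by (rule chart_covering)
  let ?F = "f \<circ> inv_into V \<phi>"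
  have op: "open (\<phi> ` (U \<inter> V))" by (rule chart_image_Int_open[OF c(1) U(1)])
  have px: "\<phi> p \<in> \<phi> ` (U \<inter> V)" using U c by auto
  have F: "smooth_on (\<phi> ` (U \<inter> V)) ?F" by (rule smooth_funD[OF f c(1)])
  have le: "?F y \<le> ?F (\<phi> p)" if "y \<in> \<phi> ` (U \<inter> V)" for y
    using that max c by (auto simp: chart_inv)
  have "frechet_derivative ?F (at (\<phi> p)) = (\<lambda>v. 0)"
    using differential_zero_maxmin[OF px op smooth_on_has_derivative[OF F px]] le by blast
  moreover have "frechet_derivative (\<lambda>z. frechet_derivative ?F (at z) a) (at (\<phi> p)) a \<le> 0" for a
    by (rule second_derivative_nonpos_at_max[OF op px F le])
  ultimately show ?thesis
    unfolding section_section_apply[OF c(1) U(2) c(2) U(1) X X f] by simp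
qed

text \<open>The second-order terms of \<open>X Y f\<close> and \<open>Y X f\<close> cancel by the symmetry of second derivatives.\<close>

lemma lie_bracket_in_chart:
  assumes c: "(V, \<phi>) \<in> A" and p: "p \<in> V"
    and X: "X \<in> sections A (tangent_space A) UNIV" and Y: "Y \<in> sections A (tangent_space A) UNIV"
  defines "a \<equiv> coordinate_field (V, \<phi>) X" and "b \<equiv> coordinate_field (V, \<phi>) Y"
  shows "lie_bracket A X Y p = coord_vector A (V, \<phi>) p
    (frechet_derivative b (at (\<phi> p)) (a (\<phi> p)) - frechet_derivative a (at (\<phi> p)) (b (\<phi> p)))"
proof
  fix f
  show "lie_bracket A X Y p f = coord_vector A (V, \<phi>) p
    (frechet_derivative b (at (\<phi> p)) (a (\<phi> p)) - frechet_derivative a (at (\<phi> p)) (b (\<phi> p))) f"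
  proof (cases "smooth_near A p f")
    case True
    then obtain U where U: "open U" "p \<in> U" "smooth_fun A U f" unfolding smooth_near_def by blast
    have XY: "X \<in> sections A (tangent_space A) U" "Y \<in> sections A (tangent_space A) U"
      using X Y by (auto intro: sections_mono)
    have op: "open (\<phi> ` (U \<inter> V))" by (rule chart_image_Int_open[OF c U(1)])
    have px: "\<phi> p \<in> \<phi> ` (U \<inter> V)" using U p by auto
    have F: "smooth_on (\<phi> ` (U \<inter> V)) (f \<circ> inv_into V \<phi>)" by (rule smooth_funD[OF U(3) c])
    have "linear (frechet_derivative (f \<circ> inv_into V \<phi>) (at (\<phi> p)))"
      by (rule linear_frechet_derivative[OF smooth_on_differentiable[OF F px]])
    then show ?thesis
      using True frechet_derivative_commute[OF op px F]
        section_section_apply[OF c U(2) p U(1) XY U(3)]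
        section_section_apply[OF c U(2) p U(1) XY(2,1) U(3)]
      by (simp add: lie_bracket_def coord_vector_def linear_diff a_def b_def)
  qed (simp add: lie_bracket_def coord_vector_def)
qed

lemma lie_bracket_section:
  assumes X: "X \<in> sections A (tangent_space A) UNIV" and Y: "Y \<in> sections A (tangent_space A) UNIV"
  shows "lie_bracket A X Y \<in> sections A (tangent_space A) UNIV"
proof -
  have "lie_bracket A X Y p \<in> tangent_space A p" for p
  proof -
    obtain V \<phi> where c: "(V, \<phi>) \<in> A" "p \<in> V" by (rule chart_covering)
    show ?thesis
      unfolding lie_bracket_in_chart[OF c X Y] tangent_space_def using c by force
  qed
  moreover have "smooth_fun A V (\<lambda>p. lie_bracket A X Y p f)"
    if V: "open V" "smooth_fun A V f" for V f
  proof (rule smooth_fun_cong[OF V(1)])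
    show "smooth_fun A V (\<lambda>p. X p (\<lambda>q. Y q f) - Y p (\<lambda>q. X q f))"
      using V by (intro smooth_fun_diff sections_smooth[OF X] sections_smooth[OF Y]) auto
    show "X p (\<lambda>q. Y q f) - Y p (\<lambda>q. X q f) = lie_bracket A X Y p f" if "p \<in> V" for p
      using smooth_nearI[OF V that] by (simp add: lie_bracket_def)
  qed
  ultimately show ?thesis unfolding sections_def by auto
qed

lemma commutator_section:
  assumes "commutator A S n X" "\<And>p. S p \<subseteq> tangent_space A p"
  shows "X \<in> sections A (tangent_space A) UNIV"
  using assms(1)
  by induction (auto intro: lie_bracket_section sections_mono[OF _ order_refl assms(2)])

end

section \<open>Orthogonal frames, horizontal gradient and horizontal divergence\<close>

lemma sum_fun_apply: "(\<Sum>i\<in>I. f i) x = (\<Sum>i\<in>I. f i x)"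
  by (induction I rule: infinite_finite_induct) auto

locale inner_product_subspace =
  fixes V :: "'v::real_vector set" and b :: "'v \<Rightarrow> 'v \<Rightarrow> real"
  assumes V: "subspace V" and ip: "inner_product_on V b"
begin

lemma sym: "x \<in> V \<Longrightarrow> y \<in> V \<Longrightarrow> b x y = b y x"
  using ip[unfolded inner_product_on_def, THEN conjunct1] by simp

lemma add_left: "x \<in> V \<Longrightarrow> y \<in> V \<Longrightarrow> z \<in> V \<Longrightarrow> b (x + y) z = b x z + b y z"
  using ip[unfolded inner_product_on_def, THEN conjunct2, THEN conjunct1] by simp

lemma scale_left: "x \<in> V \<Longrightarrow> y \<in> V \<Longrightarrow> b (c *\<^sub>R x) y = c * b x y"
  using ip[unfolded inner_product_on_def, THEN conjunct2, THEN conjunct2, THEN conjunct1] by simp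

lemma pos: "x \<in> V \<Longrightarrow> x \<noteq> 0 \<Longrightarrow> b x x > 0"
  using ip[unfolded inner_product_on_def, THEN conjunct2, THEN conjunct2, THEN conjunct2] by simp

lemma zero_left: "y \<in> V \<Longrightarrow> b 0 y = 0"
  using scale_left[of 0 y 0] subspace_0[OF V] by simp

lemma diff_left: "x \<in> V \<Longrightarrow> y \<in> V \<Longrightarrow> z \<in> V \<Longrightarrow> b (x - y) z = b x z - b y z"
  using add_left[of x "(-1) *\<^sub>R y" z] scale_left[of y z "-1"] subspace_scale[OF V, of y "-1"] by simp

lemma sum_left:
  "(\<And>i. i \<in> I \<Longrightarrow> x i \<in> V) \<Longrightarrow> y \<in> V \<Longrightarrow> b (\<Sum>i\<in>I. c i *\<^sub>R x i) y = (\<Sum>i\<in>I. c i * b (x i) y)"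
proof (induction I rule: infinite_finite_induct)
  case (insert j I)
  have "(\<Sum>i\<in>I. c i *\<^sub>R x i) \<in> V"
    using insert.prems by (intro subspace_sum[OF V] subspace_scale[OF V]) auto
  then show ?case
    using insert subspace_scale[OF V, of "x j" "c j"] by (simp add: add_left scale_left)
qed (simp_all add: zero_left)

lemma eq_zero: "x \<in> V \<Longrightarrow> (\<And>y. y \<in> V \<Longrightarrow> b x y = 0) \<Longrightarrow> x = 0"
  using pos[of x] by force

text \<open>The difference of the two sides is orthogonal to the spanning family, hence to itself. The
  vectors are not normalized, which keeps square roots out of the smooth frames below.\<close>

lemma orthogonal_expansion:
  assumes I: "finite I" and e: "\<And>i. i \<in> I \<Longrightarrow> e i \<in> V"
    and orth: "\<And>i j. i \<in> I \<Longrightarrow> j \<in> I \<Longrightarrow> i \<noteq> j \<Longrightarrow> b (e i) (e j) = 0"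
    and v: "v \<in> V" "V \<subseteq> span (e ` I)"
    and nz: "\<And>i. i \<in> I \<Longrightarrow> e i \<noteq> 0"
  shows "v = (\<Sum>i\<in>I. (b v (e i) / b (e i) (e i)) *\<^sub>R e i)"
proof -
  let ?w = "\<Sum>i\<in>I. (b v (e i) / b (e i) (e i)) *\<^sub>R e i"
  have w: "?w \<in> V" by (intro subspace_sum[OF V] subspace_scale[OF V] e)
  have d: "v - ?w \<in> V" by (rule subspace_diff[OF V v(1) w])
  have perp: "b (v - ?w) (e j) = 0" if j: "j \<in> I" for j
  proof -
    have "b ?w (e j) = (\<Sum>i\<in>I. b v (e i) / b (e i) (e i) * b (e i) (e j))"
      by (rule sum_left) (use e j in auto)
    also have "\<dots> = (\<Sum>i\<in>I. if i = j then b v (e j) else 0)"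
      using orth j pos[OF e[OF j] nz[OF j]] by (intro sum.cong) auto
    also have "\<dots> = b v (e j)" using I j by simp
    finally show ?thesis using diff_left[OF v(1) w e[OF j]] by simp
  qed
  have "subspace {y \<in> V. b (v - ?w) y = 0}"
    using V d by (auto simp: subspace_def sym[of "v - ?w"] add_left scale_left zero_left)
  then have "span (e ` I) \<subseteq> {y \<in> V. b (v - ?w) y = 0}"
    by (rule span_minimal[rotated]) (use e perp in auto)
  then have "v - ?w = 0" using eq_zero[OF d] v(2) by blast
  then show ?thesis by simp
qed

end

locale horizontal_bundle = smooth_manifold A
  for A :: "('a::{t2_space, second_countable_topology}, 'e::euclidean_space) chart set" +
  fixes k :: nat and S :: "'a \<Rightarrow> 'a tvec set" and gc :: "'a metric_tensor"
  assumes distribution: "smooth_distribution A k S" and metric: "smooth_metric A S gc"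
begin

lemma S_subspace: "subspace (S p)" and S_tangent: "S p \<subseteq> tangent_space A p" and S_dim: "dim (S p) = k"
  using distribution unfolding smooth_distribution_def by blast+

lemma S_tangentD: "v \<in> S p \<Longrightarrow> v \<in> tangent_space A p"
  using S_tangent by blast

sublocale ip: inner_product_subspace "S p" "gc p" for p
  using S_subspace metric unfolding smooth_metric_def by unfold_locales blast+

lemma metric_smooth:
  "open U \<Longrightarrow> X \<in> sections A S U \<Longrightarrow> Y \<in> sections A S U \<Longrightarrow> smooth_fun A U (\<lambda>p. gc p (X p) (Y p))"
  using metric unfolding smooth_metric_def by blast

lemma sections_tangent: "X \<in> sections A S U \<Longrightarrow> X \<in> sections A (tangent_space A) U"
  by (rule sections_mono[OF _ order_refl S_tangent])

lemma sections_restrict: "X \<in> sections A S U \<Longrightarrow> W \<subseteq> U \<Longrightarrow> X \<in> sections A S W"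
  by (rule sections_mono[OF _ _ order_refl])

text \<open>The coefficients of the Gram-Schmidt process are quotients of smooth functions with nonvanishing
  denominators. That the new vector does not vanish is a dimension count: \<open>k\<close> vectors spanning
  a \<open>k\<close>-dimensional space cannot have one of them in the span of earlier ones.\<close>

lemma gram_schmidt:
  assumes U: "open U" and X: "\<And>i. i < k \<Longrightarrow> X i \<in> sections A S U"
    and span: "\<And>q. q \<in> U \<Longrightarrow> S q = span ((\<lambda>i. X i q) ` {..<k})"
  shows "n \<le> k \<Longrightarrow> \<exists>E. (\<forall>i<n. E i \<in> sections A S U) \<and> (\<forall>q\<in>U.
      (\<forall>i<n. \<forall>j<n. i \<noteq> j \<longrightarrow> gc q (E i q) (E j q) = 0) \<and> (\<forall>i<n. E i q \<noteq> 0) \<and>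
      span ((\<lambda>i. E i q) ` {..<n}) = span ((\<lambda>i. X i q) ` {..<n}))"
proof (induction n)
  case 0
  then show ?case by simp
next
  case (Suc n)
  then have "n \<le> k" by simp
  from Suc.IH[OF this] obtain E where E0: "\<forall>i<n. E i \<in> sections A S U"
    "\<forall>q\<in>U. (\<forall>i<n. \<forall>j<n. i \<noteq> j \<longrightarrow> gc q (E i q) (E j q) = 0) \<and> (\<forall>i<n. E i q \<noteq> 0) \<and>
      span ((\<lambda>i. E i q) ` {..<n}) = span ((\<lambda>i. X i q) ` {..<n})"
    by (elim exE conjE)
  have E: "\<And>i. i < n \<Longrightarrow> E i \<in> sections A S U"
    and orth: "\<And>q i j. q \<in> U \<Longrightarrow> i < n \<Longrightarrow> j < n \<Longrightarrow> i \<noteq> j \<Longrightarrow> gc q (E i q) (E j q) = 0"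
    and nz: "\<And>q i. q \<in> U \<Longrightarrow> i < n \<Longrightarrow> E i q \<noteq> 0"
    and spanE: "\<And>q. q \<in> U \<Longrightarrow> span ((\<lambda>i. E i q) ` {..<n}) = span ((\<lambda>i. X i q) ` {..<n})"
    using E0 by blast+
  have nk: "n < k" using Suc.prems by simp
  define c where "c = (\<lambda>j q. gc q (X n q) (E j q) / gc q (E j q) (E j q))"
  define P where "P = (\<Sum>j<n. (\<lambda>q. (- c j q) *\<^sub>R E j q))"
  define Y where "Y = X n + P"
  have Yq: "Y q = X n q - (\<Sum>j<n. c j q *\<^sub>R E j q)" for q
    unfolding Y_def P_def by (simp add: sum_negf sum_fun_apply)
  have Eq: "E i q \<in> S q" if "i < n" "q \<in> U" for i q by (rule sections_mem[OF E[OF that(1)] that(2)])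
  have Xq: "X n q \<in> S q" if "q \<in> U" for q by (rule sections_mem[OF X[OF nk] that])
  have pos: "gc q (E j q) (E j q) > 0" if "j < n" "q \<in> U" for j q
    using ip.pos[OF Eq nz] that by blast
  have csm: "smooth_fun A U (c j)" if "j < n" for j
    unfolding c_def
    by (intro smooth_fun_divide[OF U] metric_smooth[OF U] X[OF nk] E[OF that]) (use pos that in force)
  have "smooth_fun A U (\<lambda>q. - c j q)" if "j < n" for j
    using smooth_fun_cmult[OF U csm[OF that], of "-1"] by simp
  then have "P \<in> sections A S U"
    unfolding P_def by (intro sections_sum sections_scale S_subspace E) auto
  then have Ysec: "Y \<in> sections A S U"
    unfolding Y_def by (intro sections_add S_subspace X[OF nk])
  have YE: "gc q (Y q) (E i q) = 0" if i: "i < n" and q: "q \<in> U" for i q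
  proof -
    have w: "(\<Sum>j<n. c j q *\<^sub>R E j q) \<in> S q"
      using q by (intro subspace_sum[OF S_subspace] subspace_scale[OF S_subspace] Eq) auto
    have "gc q (\<Sum>j<n. c j q *\<^sub>R E j q) (E i q) = (\<Sum>j<n. c j q * gc q (E j q) (E i q))"
      by (rule ip.sum_left) (use Eq i q in auto)
    also have "\<dots> = (\<Sum>j<n. if j = i then gc q (X n q) (E i q) else 0)"
      using orth[OF q] i pos[OF i q] by (intro sum.cong) (auto simp: c_def)
    also have "\<dots> = gc q (X n q) (E i q)" using i by simp
    finally show ?thesis using ip.diff_left[OF Xq[OF q] w Eq[OF i q]] by (simp add: Yq)
  qed
  have notin: "X n q \<notin> span ((\<lambda>i. X i q) ` {..<n})" if q: "q \<in> U" for q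
  proof
    let ?B = "(\<lambda>i. X i q) ` ({..<k} - {n})"
    assume "X n q \<in> span ((\<lambda>i. X i q) ` {..<n})"
    then have "X n q \<in> span ?B" using nk by (elim rev_subsetD) (intro span_mono, auto)
    then have "(\<lambda>i. X i q) ` {..<k} \<subseteq> span ?B" by (auto intro: span_base)
    then have "S q \<subseteq> span ?B" unfolding span[OF q] by (rule span_minimal[OF _ subspace_span])
    then have "dim (S q) \<le> card ?B" by (rule dim_le_card) simp
    also have "\<dots> \<le> card ({..<k} - {n})" by (rule card_image_le) simp
    also have "\<dots> < k" using nk by simp
    finally show False by (simp add: S_dim)
  qed
  have Psp: "(\<Sum>j<n. c j q *\<^sub>R E j q) \<in> span ((\<lambda>i. E i q) ` {..<n})" for q
    by (intro span_sum span_scale span_base) auto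
  have Ynz: "Y q \<noteq> 0" if q: "q \<in> U" for q
    using notin[OF q] Psp[of q] spanE[OF q] by (auto simp: Yq)
  have Suc_span: "span ((\<lambda>i. (E(n := Y)) i q) ` {..<Suc n}) = span ((\<lambda>i. X i q) ` {..<Suc n})"
    if q: "q \<in> U" for q
  proof -
    let ?R = "(\<lambda>i. E i q) ` {..<n}"
    have "(\<lambda>i. (E(n := Y)) i q) ` {..<Suc n} = insert (Y q) ?R" by (auto simp: lessThan_Suc)
    moreover have "span (insert (Y q) ?R) = span (insert (X n q) ?R)"
    proof (rule subset_antisym; rule span_minimal[OF _ subspace_span])
      have "Y q \<in> span (insert (X n q) ?R)"
        unfolding Yq
        by (intro span_diff subsetD[OF span_mono Psp]) (auto intro: span_base)
      then show "insert (Y q) ?R \<subseteq> span (insert (X n q) ?R)" by (auto intro: span_base)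
      have "Y q + (\<Sum>j<n. c j q *\<^sub>R E j q) \<in> span (insert (Y q) ?R)"
        by (intro span_add subsetD[OF span_mono Psp]) (auto intro: span_base)
      then show "insert (X n q) ?R \<subseteq> span (insert (Y q) ?R)" by (auto simp: Yq intro: span_base)
    qed
    moreover have "span (insert (X n q) ?R) = span (insert (X n q) ((\<lambda>i. X i q) ` {..<n}))"
      unfolding span_insert spanE[OF q] ..
    ultimately show ?thesis by (simp add: lessThan_Suc)
  qed
  have "gc q ((E(n := Y)) i q) ((E(n := Y)) j q) = 0"
    if "q \<in> U" "i < Suc n" "j < Suc n" "i \<noteq> j" for q i j
    using that orth[OF that(1)] YE[OF _ that(1)]
      ip.sym[OF sections_mem[OF Ysec that(1)] Eq[OF _ that(1)]]
    by (auto simp: less_Suc_eq)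
  moreover have "(E(n := Y)) i \<in> sections A S U" if "i < Suc n" for i
    using Ysec E[of i] that by (cases "i = n") (simp_all add: less_Suc_eq)
  moreover have "(E(n := Y)) i q \<noteq> 0" if "q \<in> U" "i < Suc n" for q i
    using Ynz[OF that(1)] nz[OF that(1), of i] that(2) by (cases "i = n") (simp_all add: less_Suc_eq)
  ultimately show ?case using Suc_span by (intro exI[of _ "E(n := Y)"]) blast
qed

definition orthogonal_frame :: "'a set \<Rightarrow> (nat \<Rightarrow> 'a vfield) \<Rightarrow> bool"
  where "orthogonal_frame U E \<longleftrightarrow> open U \<and> (\<forall>i<k. E i \<in> sections A S U) \<and> (\<forall>q\<in>U.
      (\<forall>i<k. \<forall>j<k. i \<noteq> j \<longrightarrow> gc q (E i q) (E j q) = 0) \<and> (\<forall>i<k. E i q \<noteq> 0) \<and>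
      span ((\<lambda>i. E i q) ` {..<k}) = S q)"

lemma orthogonal_frame_exists: obtains U E where "p \<in> U" "orthogonal_frame U E"
proof -
  obtain U X where U: "open U" "p \<in> U" "\<And>i. i < k \<Longrightarrow> X i \<in> sections A S U"
    "\<And>q. q \<in> U \<Longrightarrow> S q = span ((\<lambda>i. X i q) ` {..<k})"
    using distribution unfolding smooth_distribution_def by metis
  show thesis
    using gram_schmidt[OF U(1,3,4) order_refl] U that[of U] unfolding orthogonal_frame_def by auto
qed

context
  fixes U E assumes frame: "orthogonal_frame U E"
begin

lemma frame_open: "open U"
  and frame_section: "i < k \<Longrightarrow> E i \<in> sections A S U"
  using frame unfolding orthogonal_frame_def by blast+

lemma frame_mem: "i < k \<Longrightarrow> q \<in> U \<Longrightarrow> E i q \<in> S q"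
  by (rule sections_mem[OF frame_section])

lemma frame_pos: "i < k \<Longrightarrow> q \<in> U \<Longrightarrow> gc q (E i q) (E i q) > 0"
  using frame ip.pos[OF frame_mem] unfolding orthogonal_frame_def by blast

lemma frame_expansion:
  assumes "q \<in> U" "v \<in> S q"
  shows "v = (\<Sum>i<k. (gc q v (E i q) / gc q (E i q) (E i q)) *\<^sub>R E i q)"
  by (rule ip.orthogonal_expansion) (use frame frame_mem assms in \<open>auto simp: orthogonal_frame_def\<close>)

lemma frame_norm_smooth: "i < k \<Longrightarrow> smooth_fun A U (\<lambda>q. gc q (E i q) (E i q))"
  by (intro metric_smooth frame_open frame_section)

end

text \<open>The barrier functions of the maximum principle are only smooth near a point, where \<open>hgrad\<close>, a
  definite description over global sections, is meaningless. A relation between functions and fields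
  over \<open>N\<close> covers both situations, and it allows \<open>hgrad u\<close> itself to be combined with gradients
  that exist only locally.\<close>

definition is_gradient :: "'a set \<Rightarrow> ('a \<Rightarrow> real) \<Rightarrow> 'a vfield \<Rightarrow> bool"
  where "is_gradient N f W \<longleftrightarrow> W \<in> sections A S N \<and> (\<forall>q\<in>N. \<forall>v\<in>S q. gc q (W q) v = v f)"

lemma is_gradient_local:
  assumes frame: "orthogonal_frame U E" and N: "open N" "N \<subseteq> U" and f: "smooth_fun A N f"
  shows "is_gradient N f (\<Sum>i<k. (\<lambda>q. (E i q f / gc q (E i q) (E i q)) *\<^sub>R E i q))"
    (is "is_gradient N f ?W")
proof -
  have "smooth_fun A N (\<lambda>q. E i q f / gc q (E i q) (E i q))" if i: "i < k" for i
    using frame_pos[OF frame i] N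
    by (intro smooth_fun_divide[OF N(1)] sections_smooth[OF frame_section[OF frame i] N f]
        smooth_fun_subset[OF frame_norm_smooth[OF frame i] N(2)]) force
  then have sec: "?W \<in> sections A S N"
    by (intro sections_sum sections_scale S_subspace)
      (auto intro: sections_restrict[OF frame_section[OF frame] N(2)])
  have "gc q (?W q) v = v f" if q: "q \<in> N" and v: "v \<in> S q" for q v
  proof -
    have qU: "q \<in> U" using q N by blast
    note mem = frame_mem[OF frame _ qU]
    have Wq: "?W q = (\<Sum>i<k. (E i q f / gc q (E i q) (E i q)) *\<^sub>R E i q)"
      by (rule sum_fun_apply)
    have "gc q (?W q) v = (\<Sum>i<k. (E i q f / gc q (E i q) (E i q)) * gc q (E i q) v)"
      unfolding Wq by (rule ip.sum_left) (use mem v in auto)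
    also have "\<dots> = (\<Sum>i<k. (gc q v (E i q) / gc q (E i q) (E i q)) *\<^sub>R E i q) f"
      unfolding sum_fun_apply scaleR_fun_def
      by (rule sum.cong) (use ip.sym[OF mem v] in auto)
    also have "\<dots> = v f" using frame_expansion[OF frame qU v] by simp
    finally show ?thesis .
  qed
  then show ?thesis using sec by (simp add: is_gradient_def)
qed

lemma is_gradient_unique:
  assumes "w \<in> S q" "w' \<in> S q" "\<And>v. v \<in> S q \<Longrightarrow> gc q w v = gc q w' v"
  shows "w = w'"
proof -
  have "w - w' = 0"
    using assms by (intro ip.eq_zero[of _ q]) (auto simp: ip.diff_left intro: subspace_diff[OF S_subspace])
  then show ?thesis by simp
qed

text \<open>The pointwise Riesz representatives agree locally with the frame formula, so they form a smooth
  section. It is the only one with the defining property of \<open>hgrad\<close>, since the difference of two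
  candidates is itself a horizontal section to test with.\<close>

lemma hgrad_is_gradient:
  assumes f: "smooth_fun A UNIV f"
  shows "is_gradient UNIV f (hgrad A S gc f)"
proof -
  define P where "P = (\<lambda>q w. w \<in> S q \<and> (\<forall>v\<in>S q. gc q w v = v f))"
  have local: "\<exists>U W. open U \<and> p \<in> U \<and> is_gradient U f W" for p
  proof -
    obtain U E where U: "p \<in> U" "orthogonal_frame U E" by (rule orthogonal_frame_exists)
    show ?thesis
      using is_gradient_local[OF U(2) frame_open[OF U(2)] order_refl smooth_fun_subset[OF f]]
        frame_open[OF U(2)] U(1) by blast
  qed
  define W where "W = (\<lambda>q. SOME w. P q w)"
  have W: "P q (W q)" for q
  proof -
    obtain U V where "open U" "q \<in> U" "is_gradient U f V" using local by blast
    then have "P q (V q)" unfolding P_def is_gradient_def by (auto intro: sections_mem)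
    then show ?thesis unfolding W_def by (rule someI[of "P q"])
  qed
  have eq: "W q = V q" if "is_gradient U f V" "q \<in> U" for U V q
    by (rule is_gradient_unique[of _ q])
      (use W[of q] that in \<open>auto simp: P_def is_gradient_def intro: sections_mem\<close>)
  have Wsec: "W \<in> sections A S UNIV"
  proof (rule sectionsI)
    show "W p \<in> S p" for p using W[of p] by (simp add: P_def)
    fix V g assume V: "open V" "smooth_fun A V g"
    show "smooth_fun A V (\<lambda>p. W p g)"
    proof (rule smooth_fun_local)
      fix p assume p: "p \<in> V"
      obtain U Y where U: "open U" "p \<in> U" "is_gradient U f Y" using local by blast
      have Y: "Y \<in> sections A S U" using U(3) by (simp add: is_gradient_def)
      have "smooth_fun A (V \<inter> U) (\<lambda>p. Y p g)"
        using V U by (intro sections_smooth[OF Y]) (auto intro: smooth_fun_subset)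
      then have "smooth_fun A (V \<inter> U) (\<lambda>p. W p g)"
        by (rule smooth_fun_cong[rotated]) (use V U eq[OF U(3)] in auto)
      then show "\<exists>T. open T \<and> p \<in> T \<and> smooth_fun A T (\<lambda>p. W p g)"
        using V U p by (intro exI[of _ "V \<inter> U"]) auto
    qed
  qed
  have "hgrad A S gc f = W"
    unfolding hgrad_def
  proof (rule the_equality)
    show "W \<in> sections A S UNIV \<and> (\<forall>X\<in>sections A S UNIV. \<forall>p. gc p (W p) (X p) = X p f)"
      using Wsec W unfolding P_def by (auto intro: sections_mem)
    fix Y assume Y: "Y \<in> sections A S UNIV \<and> (\<forall>X\<in>sections A S UNIV. \<forall>p. gc p (Y p) (X p) = X p f)"
    show "Y = W"
    proof
      fix p
      have neg: "(\<lambda>q. (-1) *\<^sub>R W q) \<in> sections A S UNIV"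
        by (rule sections_scale[OF S_subspace Wsec smooth_fun_const])
      define Z where "Z = Y + (\<lambda>q. (-1) *\<^sub>R W q)"
      have Z: "Z \<in> sections A S UNIV"
        unfolding Z_def by (rule sections_add[OF S_subspace conjunct1[OF Y] neg])
      have mem: "Y p \<in> S p" "W p \<in> S p" "Z p \<in> S p"
        using sections_mem[OF conjunct1[OF Y], of p] sections_mem[OF Wsec, of p] sections_mem[OF Z, of p] by simp_all
      have "gc p (Y p) (Z p) = Z p f" "gc p (W p) (Z p) = Z p f"
        using Y Z W[of p] mem unfolding P_def by auto
      then have "gc p (Z p) (Z p) = 0"
        using ip.diff_left[OF mem(1,2,3)] by (simp add: Z_def)
      then have "Z p = 0" using ip.pos[OF mem(3)] by force
      then show "Y p = W p" by (simp add: Z_def)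
    qed
  qed
  then show ?thesis using Wsec W by (simp add: is_gradient_def P_def)
qed

lemma orthonormal_basis_exists: "\<exists>B. orthonormal_basis (S p) (gc p) B"
proof -
  obtain U E where U: "p \<in> U" "orthogonal_frame U E" by (rule orthogonal_frame_exists)
  define h where "h = (\<lambda>i. gc p (E i p) (E i p))"
  define e where "e = (\<lambda>i. (1 / sqrt (h i)) *\<^sub>R E i p)"
  have h: "h i > 0" if "i < k" for i using frame_pos[OF U(2) that U(1)] by (simp add: h_def)
  have Emem: "E i p \<in> S p" if "i < k" for i by (rule frame_mem[OF U(2) that U(1)])
  have emem: "e i \<in> S p" if "i < k" for i
    unfolding e_def by (rule subspace_scale[OF S_subspace Emem[OF that]])
  have ee: "gc p (e i) (e j) = (if i = j then 1 else 0)" if ij: "i < k" "j < k" for i j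
  proof -
    have "gc p (e i) (e j) = (1 / sqrt (h i)) * gc p (E i p) (e j)"
      unfolding e_def using Emem emem ij by (intro ip.scale_left) (auto simp: e_def)
    also have "gc p (E i p) (e j) = gc p (e j) (E i p)" by (rule ip.sym[OF Emem emem]) fact+
    also have "\<dots> = (1 / sqrt (h j)) * gc p (E j p) (E i p)"
      unfolding e_def by (rule ip.scale_left[OF Emem Emem]) fact+
    also have "gc p (E j p) (E i p) = (if i = j then h i else 0)"
      using U ij by (auto simp: orthogonal_frame_def h_def)
    finally show ?thesis using h[OF ij(1)] by (auto simp: field_simps)
  qed
  have "span (e ` {..<k}) = S p"
  proof (rule subset_antisym)
    show "span (e ` {..<k}) \<subseteq> S p" by (rule span_minimal[OF _ S_subspace]) (use emem in auto)
    have "E i p \<in> span (e ` {..<k})" if i: "i < k" for i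
    proof -
      have "E i p = sqrt (h i) *\<^sub>R e i" using h[OF i] by (simp add: e_def)
      then show ?thesis using i by (metis span_scale span_base imageI lessThan_iff)
    qed
    then have "span ((\<lambda>i. E i p) ` {..<k}) \<subseteq> span (e ` {..<k})"
      by (intro span_minimal[OF _ subspace_span]) auto
    then show "S p \<subseteq> span (e ` {..<k})" using U by (simp add: orthogonal_frame_def)
  qed
  moreover have "gc p x y = (if x = y then 1 else 0)" if xy: "x \<in> e ` {..<k}" "y \<in> e ` {..<k}" for x y
  proof -
    obtain i j where ij: "i < k" "j < k" "x = e i" "y = e j" using xy by auto
    show ?thesis using ee[OF ij(1,2)] ee[OF ij(1,1)] ij by (cases "i = j") auto
  qed
  ultimately show ?thesis unfolding orthonormal_basis_def by (intro exI[of _ "e ` {..<k}"]) auto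
qed

end

locale horizontal_connected_bundle = horizontal_bundle A k S gc
  for A :: "('a::{t2_space, second_countable_topology}, 'e::euclidean_space) chart set"
    and k :: nat and S :: "'a \<Rightarrow> 'a tvec set" and gc :: "'a metric_tensor" +
  fixes D :: "'a connection"
  assumes connection: "is_connection A S D" and compatible: "metric_compatible A S gc D"
begin

lemma D_section:
  "open U \<Longrightarrow> X \<in> sections A S U \<Longrightarrow> Y \<in> sections A S U \<Longrightarrow> (\<lambda>p. D p (X p) Y) \<in> sections A S U"
  using connection unfolding is_connection_def by meson

lemma D_add_direction:
  "open U \<Longrightarrow> Y \<in> sections A S U \<Longrightarrow> p \<in> U \<Longrightarrow> v \<in> S p \<Longrightarrow> w \<in> S p \<Longrightarrow>
    D p (v + w) Y = D p v Y + D p w Y"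
  using connection unfolding is_connection_def by meson

lemma D_scale_direction:
  "open U \<Longrightarrow> Y \<in> sections A S U \<Longrightarrow> p \<in> U \<Longrightarrow> v \<in> S p \<Longrightarrow> D p (c *\<^sub>R v) Y = c *\<^sub>R D p v Y"
  using connection unfolding is_connection_def by meson

lemma D_add:
  "open U \<Longrightarrow> Y \<in> sections A S U \<Longrightarrow> Z \<in> sections A S U \<Longrightarrow> p \<in> U \<Longrightarrow> v \<in> S p \<Longrightarrow>
    D p v (Y + Z) = D p v Y + D p v Z"
  using connection unfolding is_connection_def by meson

lemma D_leibniz:
  "open U \<Longrightarrow> Y \<in> sections A S U \<Longrightarrow> smooth_fun A U f \<Longrightarrow> p \<in> U \<Longrightarrow> v \<in> S p \<Longrightarrow>
    D p v (\<lambda>q. f q *\<^sub>R Y q) = v f *\<^sub>R Y p + f p *\<^sub>R D p v Y"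
  using connection unfolding is_connection_def by meson

lemma D_compatible:
  "open U \<Longrightarrow> X \<in> sections A S U \<Longrightarrow> Y \<in> sections A S U \<Longrightarrow> Z \<in> sections A S U \<Longrightarrow> p \<in> U \<Longrightarrow>
    X p (\<lambda>q. gc q (Y q) (Z q)) = gc p (D p (X p) Y) (Z p) + gc p (Y p) (D p (X p) Z)"
  using compatible unfolding metric_compatible_def by meson

lemma D_sum_direction:
  assumes U: "open U" "p \<in> U" and Y: "Y \<in> sections A S U" and v: "\<And>i. i \<in> I \<Longrightarrow> v i \<in> S p"
  shows "D p (\<Sum>i\<in>I. c i *\<^sub>R v i) Y = (\<Sum>i\<in>I. c i *\<^sub>R D p (v i) Y)"
  using v
proof (induction I rule: infinite_finite_induct)
  case (insert j I)
  have sm: "(\<Sum>i\<in>I. c i *\<^sub>R v i) \<in> S p"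
    using insert.prems by (intro subspace_sum[OF S_subspace] subspace_scale[OF S_subspace]) auto
  have vj: "v j \<in> S p" "c j *\<^sub>R v j \<in> S p"
    using insert.prems subspace_scale[OF S_subspace] by auto
  have "D p (c j *\<^sub>R v j + (\<Sum>i\<in>I. c i *\<^sub>R v i)) Y
      = c j *\<^sub>R D p (v j) Y + D p (\<Sum>i\<in>I. c i *\<^sub>R v i) Y"
    unfolding D_add_direction[OF U(1) Y U(2) vj(2) sm] D_scale_direction[OF U(1) Y U(2) vj(1)] ..
  moreover have "D p (\<Sum>i\<in>I. c i *\<^sub>R v i) Y = (\<Sum>i\<in>I. c i *\<^sub>R D p (v i) Y)"
    by (rule insert.IH) (use insert.prems in auto)
  ultimately show ?case unfolding sum.insert[OF insert.hyps] by (simp only:)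
qed (use D_scale_direction[OF U(1) Y U(2) subspace_0[OF S_subspace], of 0] in simp_all)

lemma D_mem:
  assumes frame: "orthogonal_frame U E" and N: "open N" "N \<subseteq> U" "q \<in> N"
    and W: "W \<in> sections A S N" and v: "v \<in> S q"
  shows "D q v W \<in> S q"
proof -
  have qU: "q \<in> U" using N by blast
  have "D q (E i q) W \<in> S q" if "i < k" for i
    using sections_mem[OF D_section[OF N(1) sections_restrict[OF frame_section[OF frame that] N(2)] W] N(3)] .
  moreover have "D q v W = (\<Sum>i<k. (gc q v (E i q) / gc q (E i q) (E i q)) *\<^sub>R D q (E i q) W)"
    by (subst frame_expansion[OF frame qU v], rule D_sum_direction[OF N(1,3) W])
      (use frame_mem[OF frame _ qU] in auto)
  ultimately show ?thesis
    by (auto intro!: subspace_sum[OF S_subspace] subspace_scale[OF S_subspace])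
qed

text \<open>The trace is independent of the basis: insert the expansion of each basis vector \<open>e\<close> in the frame
  into the first slot, and collect the expansion of each frame vector in the basis in the second.\<close>

lemma hdiv_frame:
  assumes frame: "orthogonal_frame U E" and N: "open N" "N \<subseteq> U" "q \<in> N"
    and W: "W \<in> sections A S N"
  shows "hdiv S gc D W q = (\<Sum>i<k. gc q (D q (E i q) W) (E i q) / gc q (E i q) (E i q))"
proof -
  define B where "B = (SOME B. orthonormal_basis (S q) (gc q) B)"
  have "orthonormal_basis (S q) (gc q) B"
    unfolding B_def by (rule someI_ex[OF orthonormal_basis_exists])
  then have B: "finite B" "span B = S q" "\<And>x y. x \<in> B \<Longrightarrow> y \<in> B \<Longrightarrow> gc q x y = (if x = y then 1 else 0)"
    unfolding orthonormal_basis_def by blast+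
  have Bmem: "e \<in> S q" if "e \<in> B" for e using B(2) that span_base by blast
  have qU: "q \<in> U" using N by blast
  note Emem = frame_mem[OF frame _ qU]
  note Dmem = D_mem[OF frame N W]
  have Bexp: "v = (\<Sum>e\<in>B. gc q v e *\<^sub>R e)" if v: "v \<in> S q" for v
  proof -
    have "v = (\<Sum>e\<in>B. (gc q v e / gc q e e) *\<^sub>R e)"
    proof (rule ip.orthogonal_expansion[of B "\<lambda>e. e" q])
      show "e \<noteq> 0" if "e \<in> B" for e using B(3)[OF that that] ip.zero_left[OF Bmem[OF that]] by auto
    qed (use B Bmem v in auto)
    also have "\<dots> = (\<Sum>e\<in>B. gc q v e *\<^sub>R e)" by (rule sum.cong) (use B(3) in auto)
    finally show ?thesis .
  qed
  have "hdiv S gc D W q = (\<Sum>e\<in>B. gc q (D q e W) e)" by (simp add: hdiv_def B_def)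
  also have "\<dots> = (\<Sum>e\<in>B. \<Sum>i<k. (gc q e (E i q) / gc q (E i q) (E i q)) * gc q (D q (E i q) W) e)"
  proof (rule sum.cong[OF refl])
    fix e assume e: "e \<in> B"
    have De: "D q e W = (\<Sum>i<k. (gc q e (E i q) / gc q (E i q) (E i q)) *\<^sub>R D q (E i q) W)"
      by (subst frame_expansion[OF frame qU Bmem[OF e]], rule D_sum_direction[OF N(1,3) W])
        (use Emem in auto)
    show "gc q (D q e W) e
      = (\<Sum>i<k. (gc q e (E i q) / gc q (E i q) (E i q)) * gc q (D q (E i q) W) e)"
      unfolding De by (rule ip.sum_left) (use Dmem Emem Bmem e in auto)
  qed
  also have "\<dots> = (\<Sum>i<k. \<Sum>e\<in>B. (gc q e (E i q) / gc q (E i q) (E i q)) * gc q (D q (E i q) W) e)"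
    by (rule sum.swap)
  also have "\<dots> = (\<Sum>i<k. gc q (D q (E i q) W) (E i q) / gc q (E i q) (E i q))"
  proof (rule sum.cong[OF refl])
    fix i assume "i \<in> {..<k}"
    then have i: "i < k" by simp
    have "gc q (D q (E i q) W) (E i q) = gc q (E i q) (D q (E i q) W)"
      by (rule ip.sym[OF Dmem[OF Emem[OF i]] Emem[OF i]])
    also have "\<dots> = gc q (\<Sum>e\<in>B. gc q (E i q) e *\<^sub>R e) (D q (E i q) W)"
      using Bexp[OF Emem[OF i]] by simp
    also have "\<dots> = (\<Sum>e\<in>B. gc q (E i q) e * gc q e (D q (E i q) W))"
      by (rule ip.sum_left) (use Bmem Dmem[OF Emem[OF i]] in auto)
    also have "\<dots> = (\<Sum>e\<in>B. gc q e (E i q) * gc q (D q (E i q) W) e)"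
      by (rule sum.cong) (use ip.sym[OF Bmem Emem[OF i]] ip.sym[OF Bmem Dmem[OF Emem[OF i]]] in auto)
    finally show "(\<Sum>e\<in>B. (gc q e (E i q) / gc q (E i q) (E i q)) * gc q (D q (E i q) W) e)
      = gc q (D q (E i q) W) (E i q) / gc q (E i q) (E i q)"
      by (simp add: sum_divide_distrib)
  qed
  finally show ?thesis .
qed

end

section \<open>The boundary point lemma\<close>

lemma open_Collect_pos:
  fixes f :: "'a::topological_space \<Rightarrow> real"
  assumes "open M" "continuous_on M f"
  shows "open {q\<in>M. f q > 0}"
proof -
  have "{q\<in>M. f q > 0} = f -` {0<..} \<inter> M" by auto
  then show ?thesis using continuous_on_open_vimage[OF assms(1), of f] assms(2) by auto
qed

context horizontal_bundle
begin

lemma is_gradient_subset: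
  assumes "is_gradient N f W" "M \<subseteq> N"
  shows "is_gradient M f W"
  using assms sections_restrict[of W N M] unfolding is_gradient_def by blast

lemma is_gradient_section: "is_gradient N f W \<Longrightarrow> W \<in> sections A S N"
  and is_gradient_apply: "is_gradient N f W \<Longrightarrow> q \<in> N \<Longrightarrow> v \<in> S q \<Longrightarrow> gc q (W q) v = v f"
  unfolding is_gradient_def by blast+

lemma is_gradient_add_scale:
  assumes N: "open N" and f: "smooth_fun A N f" "is_gradient N f W"
    and g: "smooth_fun A N g" "is_gradient N g V"
  shows "is_gradient N (\<lambda>q. f q + c * g q) (W + (\<lambda>q. c *\<^sub>R V q))"
proof -
  note W = is_gradient_section[OF f(2)] and V = is_gradient_section[OF g(2)]
  have cV: "(\<lambda>q. c *\<^sub>R V q) \<in> sections A S N"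
    by (rule sections_scale[OF S_subspace V smooth_fun_const])
  have "gc q ((W + (\<lambda>q. c *\<^sub>R V q)) q) v = v (\<lambda>q. f q + c * g q)" if q: "q \<in> N" "v \<in> S q" for q v
  proof -
    have "gc q (W q + c *\<^sub>R V q) v = v f + c * v g"
      using sections_mem[OF W q(1)] sections_mem[OF V q(1)] sections_mem[OF cV q(1)] q
      by (simp only: ip.add_left ip.scale_left is_gradient_apply[OF f(2) q] is_gradient_apply[OF g(2) q])
    also have "\<dots> = v f + v (\<lambda>q. c * g q)"
      using tangent_cmult[OF S_tangentD[OF q(2)] smooth_nearI[OF N g(1) q(1)]] by simp
    also have "\<dots> = v (\<lambda>q. f q + c * g q)"
      using tangent_add[OF S_tangentD[OF q(2)] smooth_nearI[OF N f(1) q(1)]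
          smooth_nearI[OF N smooth_fun_cmult[OF N g(1)] q(1)]] by simp
    finally show ?thesis by simp
  qed
  then show ?thesis
    using sections_add[OF S_subspace W cV] unfolding is_gradient_def by blast
qed

lemma tangent_quadratic:
  assumes v: "v \<in> tangent_space A q" and s: "smooth_near A q s"
  shows "v (\<lambda>r. s r + K * (s r * s r)) = (1 + 2 * K * s q) * v s"
proof -
  obtain N where N: "open N" "q \<in> N" "smooth_fun A N s" using s unfolding smooth_near_def by blast
  have ss: "smooth_near A q (\<lambda>r. s r * s r)"
    by (rule smooth_nearI[OF N(1) smooth_fun_mult[OF N(1,3,3)] N(2)])
  have Kss: "smooth_near A q (\<lambda>r. K * (s r * s r))"
    by (rule smooth_nearI[OF N(1) smooth_fun_cmult[OF N(1) smooth_fun_mult[OF N(1,3,3)]] N(2)])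
  show ?thesis
    unfolding tangent_add[OF v s Kss] tangent_cmult[OF v ss] tangent_mult[OF v s s]
    by (simp add: algebra_simps)
qed

lemma is_gradient_quadratic:
  assumes N: "open N" and s: "smooth_fun A N s" "is_gradient N s W"
  shows "is_gradient N (\<lambda>q. s q + K * (s q * s q)) (\<lambda>q. (1 + 2 * K * s q) *\<^sub>R W q)"
proof -
  note W = is_gradient_section[OF s(2)]
  have "(\<lambda>q. (1 + 2 * K * s q) *\<^sub>R W q) \<in> sections A S N"
    using smooth_fun_add[OF N smooth_fun_const smooth_fun_cmult[OF N s(1), of "2 * K"], of 1]
    by (intro sections_scale S_subspace W)
  moreover have "gc q ((1 + 2 * K * s q) *\<^sub>R W q) v = v (\<lambda>q. s q + K * (s q * s q))"
    if q: "q \<in> N" "v \<in> S q" for q v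
    unfolding tangent_quadratic[OF S_tangentD[OF q(2)] smooth_nearI[OF N s(1) q(1)]]
      ip.scale_left[OF sections_mem[OF W q(1)] q(2)] is_gradient_apply[OF s(2) q] ..
  ultimately show ?thesis unfolding is_gradient_def by blast
qed

end

context horizontal_connected_bundle
begin

text \<open>In an orthogonal frame each term of the trace is \<open>E\<^sub>i (E\<^sub>i w) - (\<nabla>\<^sub>i E\<^sub>i) w\<close> up to a positive
  factor, by compatibility with the metric. At a maximum the first summand is nonpositive and the
  second one vanishes.\<close>

lemma hdiv_nonpos_at_max:
  assumes N: "open N" "q \<in> N" and w: "smooth_fun A N w" "is_gradient N w W"
    and max: "\<And>r. r \<in> N \<Longrightarrow> w r \<le> w q"
  shows "hdiv S gc D W q \<le> 0"
proof -
  obtain U E where U: "q \<in> U" "orthogonal_frame U E" by (rule orthogonal_frame_exists)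
  define M where "M = N \<inter> U"
  have M: "open M" "M \<subseteq> U" "q \<in> M" "M \<subseteq> N" using N U frame_open[OF U(2)] by (auto simp: M_def)
  have wM: "smooth_fun A M w" by (rule smooth_fun_subset[OF w(1) M(4)])
  have WM: "is_gradient M w W" by (rule is_gradient_subset[OF w(2) M(4)])
  note Wsec = is_gradient_section[OF WM]
  have "gc q (D q (E i q) W) (E i q) \<le> 0" if i: "i < k" for i
  proof -
    have Ei: "E i \<in> sections A S M" by (rule sections_restrict[OF frame_section[OF U(2) i] M(2)])
    note Eq = sections_mem[OF Ei M(3)]
    have DE: "D q (E i q) (E i) \<in> S q" by (rule sections_mem[OF D_section[OF M(1) Ei Ei] M(3)])
    have "gc q (W q) (D q (E i q) (E i)) = D q (E i q) (E i) w"
      by (rule is_gradient_apply[OF WM M(3) DE])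
    also have "\<dots> = 0"
      by (rule tangent_max_zero[OF S_tangentD[OF DE] N w(1) max])
    finally have "gc q (D q (E i q) W) (E i q) = E i q (\<lambda>r. gc r (W r) (E i r))"
      using D_compatible[OF M(1) Ei Wsec Ei M(3)] by simp
    also have "\<dots> = E i q (\<lambda>r. E i r w)"
      by (rule tangent_cong[OF S_tangentD[OF Eq] M(1,3)])
        (rule is_gradient_apply[OF WM _ sections_mem[OF Ei]])
    also have "\<dots> \<le> 0"
      by (rule section_section_nonpos_at_max[OF M(1,3) sections_tangent[OF Ei] wM])
        (use max M(4) in auto)
    finally show ?thesis .
  qed
  then show ?thesis
    unfolding hdiv_frame[OF U(2) M(1,2,3) Wsec] using frame_pos[OF U(2) _ U(1)]
    by (intro sum_nonpos divide_nonpos_pos) auto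
qed

lemma hdiv_add_scale:
  assumes N: "open N" "q \<in> N" and W: "W \<in> sections A S N" and V: "V \<in> sections A S N"
  shows "hdiv S gc D (W + (\<lambda>q. c *\<^sub>R V q)) q = hdiv S gc D W q + c * hdiv S gc D V q"
proof -
  obtain U E where U: "q \<in> U" "orthogonal_frame U E" by (rule orthogonal_frame_exists)
  define M where "M = N \<inter> U"
  have M: "open M" "M \<subseteq> U" "q \<in> M" "M \<subseteq> N" using N U frame_open[OF U(2)] by (auto simp: M_def)
  note WM = sections_restrict[OF W M(4)] and VM = sections_restrict[OF V M(4)]
  have cV: "(\<lambda>q. c *\<^sub>R V q) \<in> sections A S M"
    by (rule sections_scale[OF S_subspace VM smooth_fun_const])
  note sum_sec = sections_add[OF S_subspace WM cV]
  have "gc q (D q (E i q) (W + (\<lambda>q. c *\<^sub>R V q))) (E i q)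
      = gc q (D q (E i q) W) (E i q) + c * gc q (D q (E i q) V) (E i q)" if i: "i < k" for i
  proof -
    note Eq = frame_mem[OF U(2) i U(1)]
    note mem = D_mem[OF U(2) M(1,2,3) WM Eq] D_mem[OF U(2) M(1,2,3) VM Eq]
    have "D q (E i q) (\<lambda>q. c *\<^sub>R V q) = c *\<^sub>R D q (E i q) V"
      using D_leibniz[OF M(1) VM smooth_fun_const M(3) Eq, of c] tangent_const[OF S_tangentD[OF Eq]]
      by simp
    then have "D q (E i q) (W + (\<lambda>q. c *\<^sub>R V q)) = D q (E i q) W + c *\<^sub>R D q (E i q) V"
      using D_add[OF M(1) WM cV M(3) Eq] by simp
    then show ?thesis
      using ip.add_left[OF mem(1) subspace_scale[OF S_subspace mem(2)] Eq] ip.scale_left[OF mem(2) Eq]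
      by simp
  qed
  then show ?thesis
    unfolding hdiv_frame[OF U(2) M(1,2,3) sum_sec] hdiv_frame[OF U(2) M(1,2,3) WM]
      hdiv_frame[OF U(2) M(1,2,3) VM] sum_distrib_left sum.distrib[symmetric]
    by (intro sum.cong) (auto simp: add_divide_distrib)
qed

text \<open>The chain rule \<open>\<Delta>(s + K s\<^sup>2) = (1 + 2 K s) \<Delta> s + 2 K \<bar>\<nabla> s\<bar>\<^sup>2\<close>, with the norm of the gradient
  written in the frame.\<close>

lemma hdiv_quadratic:
  assumes frame: "orthogonal_frame U E" and N: "open N" "N \<subseteq> U" "q \<in> N"
    and s: "smooth_fun A N s" "is_gradient N s W"
  shows "hdiv S gc D (\<lambda>q. (1 + 2 * K * s q) *\<^sub>R W q) q
    = (1 + 2 * K * s q) * hdiv S gc D W q + 2 * K * (\<Sum>i<k. (E i q s)\<^sup>2 / gc q (E i q) (E i q))"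
proof -
  note W = is_gradient_section[OF s(2)]
  have f: "smooth_fun A N (\<lambda>q. 1 + 2 * K * s q)"
    by (rule smooth_fun_add[OF N(1) smooth_fun_const smooth_fun_cmult[OF N(1) s(1)]])
  have fW: "(\<lambda>q. (1 + 2 * K * s q) *\<^sub>R W q) \<in> sections A S N"
    by (rule sections_scale[OF S_subspace W f])
  have qU: "q \<in> U" using N by blast
  have "gc q (D q (E i q) (\<lambda>q. (1 + 2 * K * s q) *\<^sub>R W q)) (E i q)
      = (1 + 2 * K * s q) * gc q (D q (E i q) W) (E i q) + 2 * K * (E i q s)\<^sup>2" if i: "i < k" for i
  proof -
    note Eq = frame_mem[OF frame i qU]
    note DW = D_mem[OF frame N W Eq] and Wq = sections_mem[OF W N(3)]
    have "E i q (\<lambda>q. 1 + 2 * K * s q) = 2 * K * E i q s"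
      using tangent_add[OF S_tangentD[OF Eq] smooth_near_const
          smooth_nearI[OF N(1) smooth_fun_cmult[OF N(1) s(1)] N(3)]]
        tangent_cmult[OF S_tangentD[OF Eq] smooth_nearI[OF N(1) s(1) N(3)]]
        tangent_const[OF S_tangentD[OF Eq]] by simp
    then have "D q (E i q) (\<lambda>q. (1 + 2 * K * s q) *\<^sub>R W q)
        = (2 * K * E i q s) *\<^sub>R W q + (1 + 2 * K * s q) *\<^sub>R D q (E i q) W"
      using D_leibniz[OF N(1) W f N(3) Eq] by simp
    then have "gc q (D q (E i q) (\<lambda>q. (1 + 2 * K * s q) *\<^sub>R W q)) (E i q)
        = (2 * K * E i q s) * gc q (W q) (E i q) + (1 + 2 * K * s q) * gc q (D q (E i q) W) (E i q)"
      using ip.add_left[OF subspace_scale[OF S_subspace Wq] subspace_scale[OF S_subspace DW] Eq]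
        ip.scale_left[OF Wq Eq] ip.scale_left[OF DW Eq] by simp
    then show ?thesis
      using is_gradient_apply[OF s(2) N(3) Eq] by (simp add: power2_eq_square)
  qed
  then show ?thesis
    unfolding hdiv_frame[OF frame N fW] hdiv_frame[OF frame N W] sum_distrib_left sum.distrib[symmetric]
    by (intro sum.cong) (auto simp: add_divide_distrib)
qed

lemma hdiv_smooth:
  assumes frame: "orthogonal_frame U E" and N: "open N" "N \<subseteq> U" and W: "W \<in> sections A S N"
  shows "smooth_fun A N (\<lambda>q. hdiv S gc D W q)"
proof (rule smooth_fun_cong[OF N(1)])
  have Ei: "E i \<in> sections A S N" if "i < k" for i
    by (rule sections_restrict[OF frame_section[OF frame that] N(2)])
  have "gc q (E i q) (E i q) \<noteq> 0" if "i < k" "q \<in> N" for i q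
    using frame_pos[OF frame that(1), of q] that(2) N(2) by auto
  then show "smooth_fun A N (\<lambda>q. \<Sum>i<k. gc q (D q (E i q) W) (E i q) / gc q (E i q) (E i q))"
    using Ei by (intro smooth_fun_sum smooth_fun_divide metric_smooth D_section N(1) W) auto
  show "(\<Sum>i<k. gc q (D q (E i q) W) (E i q) / gc q (E i q) (E i q)) = hdiv S gc D W q"
    if "q \<in> N" for q by (rule hdiv_frame[OF frame N that W, symmetric])
qed

text \<open>The perturbation of \<open>u\<close> by \<open>b = s + K s\<^sup>2\<close> must not exceed \<open>u p\<close> on the boundary of a small
  neighbourhood of \<open>p\<close>. Where \<open>s < 0\<close> also \<open>b < 0\<close>, as \<open>K s\<close> is small. On the rest of the boundary,
  which is compact, \<open>u\<close> stays below \<open>u p\<close> by a positive amount since \<open>s\<close> is negative at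
  the other maximum points, so a small multiple of \<open>b\<close> does no harm.\<close>

proposition hopf_lemma:
  assumes u: "smooth_fun A UNIV u" and harmonic: "\<And>q. hdiv S gc D (hgrad A S gc u) q = 0"
    and max: "\<And>q. u q \<le> u p"
    and N: "open N" "p \<in> N" and s: "smooth_fun A N s" "s p = 0"
    and neg: "\<And>q. q \<in> N \<Longrightarrow> q \<noteq> p \<Longrightarrow> u q = u p \<Longrightarrow> s q < 0"
    and v: "v \<in> S p"
  shows "v s = 0"
proof (rule ccontr)
  assume vs: "v s \<noteq> 0"
  obtain U E where U: "p \<in> U" "orthogonal_frame U E" by (rule orthogonal_frame_exists)
  define M where "M = N \<inter> U"
  have M: "open M" "M \<subseteq> U" "p \<in> M" "M \<subseteq> N" using N U frame_open[OF U(2)] by (auto simp: M_def)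
  have sM: "smooth_fun A M s" by (rule smooth_fun_subset[OF s(1) M(4)])
  obtain W where W: "is_gradient M s W" using is_gradient_local[OF U(2) M(1,2) sM] by blast
  define \<Gamma> where "\<Gamma> = (\<lambda>q. \<Sum>i<k. (E i q s)\<^sup>2 / gc q (E i q) (E i q))"
  have "\<Gamma> p > 0"
  proof -
    have "\<exists>i<k. E i p s \<noteq> 0"
    proof (rule ccontr)
      assume "\<not> ?thesis"
      then have "(\<Sum>i<k. (gc p v (E i p) / gc p (E i p) (E i p)) *\<^sub>R E i p) s = 0"
        by (simp add: sum_fun_apply scaleR_fun_def)
      then show False using vs frame_expansion[OF U(2,1) v] by simp
    qed
    then obtain j where j: "j < k" "E j p s \<noteq> 0" by blast
    have "(E j p s)\<^sup>2 / gc p (E j p) (E j p) > 0"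
      using j frame_pos[OF U(2) j(1) U(1)] by simp
    also have "\<dots> \<le> \<Gamma> p"
      unfolding \<Gamma>_def using j(1) frame_pos[OF U(2) _ U(1)]
      by (intro member_le_sum) (auto intro!: divide_nonneg_pos)
    finally show ?thesis .
  qed
  \<comment> \<open>makes the Laplacian of \<open>s + K s\<^sup>2\<close> at \<open>p\<close> at least 1\<close>
  define K where "K = (\<bar>hdiv S gc D W p\<bar> + 1) / (2 * \<Gamma> p)"
  have K: "2 * K * \<Gamma> p = \<bar>hdiv S gc D W p\<bar> + 1" using \<open>\<Gamma> p > 0\<close> by (simp add: K_def)
  define b where "b = (\<lambda>q. s q + K * (s q * s q))"
  define V where "V = (\<lambda>q. (1 + 2 * K * s q) *\<^sub>R W q)"
  have b_smooth: "smooth_fun A M b"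
    unfolding b_def by (intro smooth_fun_add smooth_fun_cmult smooth_fun_mult M(1) sM)
  have V: "is_gradient M b V" unfolding b_def V_def by (rule is_gradient_quadratic[OF M(1) sM W])
  have "hdiv S gc D V p > 0"
    using hdiv_quadratic[OF U(2) M(1,2,3) sM W, of K] K s(2) unfolding V_def \<Gamma>_def by simp
  have cont: "continuous_on M s" "continuous_on M b" "continuous_on M (\<lambda>q. hdiv S gc D V q)"
    by (intro smooth_fun_continuous_on[OF M(1)] sM b_smooth hdiv_smooth[OF U(2) M(1,2)]
        is_gradient_section[OF V])+
  \<comment> \<open>On \<open>P\<close> the barrier is strictly subharmonic and has the sign of \<open>s\<close>.\<close>
  define P where "P = {q\<in>M. hdiv S gc D V q > 0} \<inter> {q\<in>M. 1 + K * s q > 0}"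
  have "open {q\<in>M. hdiv S gc D V q > 0}" "open {q\<in>M. 1 + K * s q > 0}"
    by (rule open_Collect_pos[OF M(1) cont(3)])
      (rule open_Collect_pos[OF M(1)], intro continuous_intros cont(1))
  then have "open P" unfolding P_def by (rule open_Int)
  moreover have "p \<in> P" using M(3) s(2) \<open>hdiv S gc D V p > 0\<close> by (simp add: P_def)
  ultimately obtain G C where GC: "open G" "compact C" "p \<in> G" "G \<subseteq> C" "C \<subseteq> P"
    by (rule compact_neighbourhood)
  have CM: "C \<subseteq> M" using GC(5) by (auto simp: P_def)
  have contC: "continuous_on C s" "continuous_on C b" "continuous_on C u"
    using cont continuous_on_subset[OF _ CM] smooth_fun_continuous_on[OF open_UNIV u]
    by (auto intro: continuous_on_subset)
  \<comment> \<open>The compact part of the boundary layer \<open>C - G\<close> where the barrier may be positive.\<close>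
  define H where "H = {q\<in>C. s q \<ge> 0} - G"
  have "closed {q\<in>C. s q \<ge> 0}"
    using continuous_closed_preimage[OF contC(1) compact_imp_closed[OF GC(2)], of "{0..}"]
    by (simp add: vimage_def Int_def)
  then have "compact (C \<inter> {q\<in>C. s q \<ge> 0} - G)"
    by (intro compact_diff compact_Int_closed GC)
  moreover have "C \<inter> {q\<in>C. s q \<ge> 0} - G = H" by (auto simp: H_def)
  ultimately have H: "compact H" by simp
  have HC: "H \<subseteq> C" by (auto simp: H_def)
  have Hu: "u q < u p" if "q \<in> H" for q
  proof -
    have "q \<in> N" "q \<noteq> p" "s q \<ge> 0" using that GC CM M(4) by (auto simp: H_def)
    then show ?thesis using neg[of q] max[of q] by force
  qed
  obtain \<epsilon> where \<epsilon>: "\<epsilon> > 0" "\<And>q. q \<in> H \<Longrightarrow> u q + \<epsilon> * b q < u p"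
  proof (cases "H = {}")
    case True
    then show thesis using that[of 1] by simp
  next
    case False
    obtain q0 where q0: "q0 \<in> H" "\<And>q. q \<in> H \<Longrightarrow> u q \<le> u q0"
      using continuous_attains_sup[OF H False continuous_on_subset[OF contC(3) HC]] by blast
    obtain q1 where q1: "q1 \<in> H" "\<And>q. q \<in> H \<Longrightarrow> b q \<le> b q1"
      using continuous_attains_sup[OF H False continuous_on_subset[OF contC(2) HC]] by blast
    define B where "B = \<bar>b q1\<bar> + 1"
    have B: "B > 0" "\<And>q. q \<in> H \<Longrightarrow> b q < B" using q1 by (auto simp: B_def) (smt (verit))
    define \<epsilon> where "\<epsilon> = (u p - u q0) / B"
    have "\<epsilon> > 0" using Hu[OF q0(1)] B(1) by (simp add: \<epsilon>_def)
    moreover have "u q + \<epsilon> * b q < u p" if "q \<in> H" for q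
    proof -
      have "\<epsilon> * b q < \<epsilon> * B" using B(2)[OF that] \<open>\<epsilon> > 0\<close> by simp
      also have "\<dots> = u p - u q0" using B(1) by (simp add: \<epsilon>_def)
      finally show ?thesis using q0(2)[OF that] by simp
    qed
    ultimately show thesis by (rule that)
  qed
  define w where "w = (\<lambda>q. u q + \<epsilon> * b q)"
  have "continuous_on C w" unfolding w_def by (intro continuous_intros contC)
  then obtain q where q: "q \<in> C" "\<And>r. r \<in> C \<Longrightarrow> w r \<le> w q"
    using continuous_attains_sup[OF GC(2)] GC(3,4) by (metis empty_iff subsetD)
  have wq: "w q \<ge> u p" using q(2)[of p] GC s(2) by (auto simp: w_def b_def)
  have qG: "q \<in> G"
  proof (rule ccontr)
    assume nG: "q \<notin> G"
    show False
    proof (cases "s q \<ge> 0")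
      case True
      then show False using \<epsilon>(2)[of q] wq q(1) nG by (simp add: H_def w_def)
    next
      case False
      have "1 + K * s q > 0" using q(1) GC(5) by (auto simp: P_def)
      moreover have "b q = s q * (1 + K * s q)" by (simp add: b_def algebra_simps)
      ultimately have "b q < 0" using False by (simp add: mult_neg_pos)
      then have "\<epsilon> * b q < 0" using \<epsilon>(1) by (simp add: mult_pos_neg)
      then show False using wq max[of q] by (simp add: w_def)
    qed
  qed
  have GM: "G \<subseteq> M" using GC(4) CM by blast
  note uG = smooth_fun_subset[OF u subset_UNIV, of G]
    is_gradient_subset[OF hgrad_is_gradient[OF u] subset_UNIV, of G]
  note bG = smooth_fun_subset[OF b_smooth GM] is_gradient_subset[OF V GM]
  have "hdiv S gc D (hgrad A S gc u + (\<lambda>q. \<epsilon> *\<^sub>R V q)) q \<le> 0"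
  proof (rule hdiv_nonpos_at_max[OF GC(1) qG])
    show "smooth_fun A G w" unfolding w_def
      by (intro smooth_fun_add smooth_fun_cmult GC(1) uG bG)
    show "is_gradient G w (hgrad A S gc u + (\<lambda>q. \<epsilon> *\<^sub>R V q))"
      unfolding w_def by (rule is_gradient_add_scale[OF GC(1) uG bG])
    show "w r \<le> w q" if "r \<in> G" for r using q(2) that GC(4) by blast
  qed
  moreover have "hdiv S gc D (hgrad A S gc u + (\<lambda>q. \<epsilon> *\<^sub>R V q)) q = \<epsilon> * hdiv S gc D V q"
    using hdiv_add_scale[OF GC(1) qG is_gradient_section[OF uG(2)] is_gradient_section[OF bG(2)]]
      harmonic by simp
  moreover have "hdiv S gc D V q > 0" using q(1) GC(5) by (auto simp: P_def)
  ultimately show False using \<epsilon>(1) by (simp add: mult_le_0_iff)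
qed

end

section \<open>The set of maximum points\<close>

context smooth_manifold
begin

definition tangent_to :: "('a, 'e) chart \<Rightarrow> 'a set \<Rightarrow> 'a vfield \<Rightarrow> bool"
  where "tangent_to c F X \<longleftrightarrow> (\<forall>y n. proximal_normal (snd c ` (F \<inter> fst c)) y n \<longrightarrow>
    coordinate_field c X y \<bullet> n = 0)"

lemma chart_image_closed_compact:
  assumes c: "(V, \<phi>) \<in> A" and F: "closed F" and R: "cball y R \<subseteq> \<phi> ` V"
  shows "compact (\<phi> ` (F \<inter> V) \<inter> cball y R)"
proof -
  have "\<phi> ` (F \<inter> V) \<inter> cball y R = cball y R \<inter> inv_into V \<phi> -` F"
    using R chart_inv[OF c] by force
  moreover have "closed (cball y R \<inter> inv_into V \<phi> -` F)"
    by (rule continuous_closed_preimage[OF continuous_on_subset[OF chart_inv_continuous[OF c] R] _ F]) simp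
  ultimately show ?thesis using compact_Int_closed[OF compact_cball, of "\<phi> ` (F \<inter> V) \<inter> cball y R" y R]
    by (simp add: Int_absorb1 inf.left_commute inf_commute)
qed

lemma tangent_to_lie_bracket:
  assumes c: "(V, \<phi>) \<in> A" and F: "closed F"
    and X: "X \<in> sections A (tangent_space A) UNIV" "tangent_to (V, \<phi>) F X"
    and Y: "Y \<in> sections A (tangent_space A) UNIV" "tangent_to (V, \<phi>) F Y"
  shows "tangent_to (V, \<phi>) F (lie_bracket A X Y)"
  unfolding tangent_to_def fst_conv snd_conv
proof (intro allI impI)
  fix y n assume n: "proximal_normal (\<phi> ` (F \<inter> V)) y n"
  then obtain p where p: "p \<in> F" "p \<in> V" "y = \<phi> p" unfolding proximal_normal_def by auto
  obtain R where R: "R > 0" "cball y R \<subseteq> \<phi> ` V"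
    using chart_image_open[OF c] p open_contains_cball by blast
  define a where "a = coordinate_field (V, \<phi>) X"
  define b where "b = coordinate_field (V, \<phi>) Y"
  note smooth = coordinate_field_inner_smooth[OF c open_UNIV, simplified]
  note der = coordinate_field_has_derivative[OF c open_UNIV, simplified]
  obtain L1 where L1: "L1 \<ge> 0" "\<And>x z. x \<in> cball y R \<Longrightarrow> z \<in> cball y R \<Longrightarrow> norm (a x - a z) \<le> L1 * norm (x - z)"
    using smooth_components_lipschitz_cball[OF smooth[OF X(1)] R(2)] unfolding a_def by blast
  obtain L2 where L2: "L2 \<ge> 0" "\<And>x z. x \<in> cball y R \<Longrightarrow> z \<in> cball y R \<Longrightarrow> norm (b x - b z) \<le> L2 * norm (x - z)"
    using smooth_components_lipschitz_cball[OF smooth[OF Y(1)] R(2)] unfolding b_def by blast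
  have L: "norm (a x - a z) \<le> max L1 L2 * norm (x - z)" "norm (b x - b z) \<le> max L1 L2 * norm (x - z)"
    if "x \<in> cball y R" "z \<in> cball y R" for x z
    using L1(2)[OF that] L2(2)[OF that]
      mult_right_mono[OF max.cobounded1[of L1 L2] norm_ge_zero[of "x - z"]]
      mult_right_mono[OF max.cobounded2[of L2 L1] norm_ge_zero[of "x - z"]] by linarith+
  have ab: "(a has_derivative frechet_derivative a (at y)) (at y)"
    "(b has_derivative frechet_derivative b (at y)) (at y)"
    unfolding a_def b_def using der[OF X(1)] der[OF Y(1)] p by auto
  have "(frechet_derivative b (at y) (a y) - frechet_derivative a (at y) (b y)) \<bullet> n = 0"
    by (rule bracket_tangent[OF R(1) chart_image_closed_compact[OF c F R(2)] _ L ab _ _ n])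
      (use X(2) Y(2) L1(1) in \<open>auto simp: tangent_to_def a_def b_def\<close>)
  then show "coordinate_field (V, \<phi>) (lie_bracket A X Y) y \<bullet> n = 0"
    unfolding p(3) coordinate_field_at[OF c p(2)] lie_bracket_in_chart[OF c p(2) X(1) Y(1)]
      components_coord_vector[OF c p(2)]
    by (simp add: a_def b_def coordinate_field_at[OF c p(2)])
qed

lemma components_add: "components \<phi> (v + w) = components \<phi> v + components \<phi> w"
  by (simp add: components_def scaleR_add_left sum.distrib)

lemma components_scaleR: "components \<phi> (r *\<^sub>R v) = r *\<^sub>R components \<phi> v"
  by (simp add: components_def scaleR_fun_def scaleR_sum_right)

text \<open>Being orthogonal to \<open>n\<close> at \<open>p\<close> is a linear condition on a field, so it passes from the
  commutators to their span, which contains a field with value \<open>n\<close> at \<open>p\<close>.\<close>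

lemma hoermander_no_normal:
  assumes c: "(V, \<phi>) \<in> A" and p: "p \<in> V" and h: "hoermander A S"
    and n: "\<And>j X. commutator A S j X \<Longrightarrow> components \<phi> (X p) \<bullet> n = 0"
  shows "n = 0"
proof -
  obtain r where r: "(\<lambda>X. X p) ` bracket_span A S r = tangent_space A p"
    using h unfolding hoermander_def by blast
  have "coord_vector A (V, \<phi>) p n \<in> tangent_space A p"
    unfolding tangent_space_def using c p by force
  then obtain X where X: "X \<in> bracket_span A S r" "X p = coord_vector A (V, \<phi>) p n"
    unfolding r[symmetric] by auto
  have "subspace {X. components \<phi> (X p) \<bullet> n = 0}"
    by (auto simp: subspace_def components_add components_scaleR scaleR_fun_def[of _ "_ :: 'a vfield"]
        inner_add_left components_def[of \<phi> 0])
  then have "bracket_span A S r \<subseteq> {X. components \<phi> (X p) \<bullet> n = 0}"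
    unfolding bracket_span_def by (rule span_minimal[rotated]) (use n in blast)
  then have "n \<bullet> n = 0" using X components_coord_vector[OF c p] by auto
  then show ?thesis by simp
qed

text \<open>Take a point outside \<open>F\<close> so close to a boundary point \<open>p\<close> of \<open>F\<close> that its nearest point in the
  part of \<open>F\<close> within a closed ball around \<open>p\<close> is interior to that ball.\<close>

lemma proximal_normal_exists:
  fixes F :: "'a set"
  assumes F: "closed F" "\<not> open F"
  obtains V \<phi> y n where "(V, \<phi>) \<in> A" "proximal_normal (\<phi> ` (F \<inter> V)) y n" "n \<noteq> 0"
proof -
  obtain p where p: "p \<in> F" "\<And>T. open T \<Longrightarrow> p \<in> T \<Longrightarrow> \<not> T \<subseteq> F"
    using F(2) open_subopen[of F] by blast
  obtain V \<phi> where c: "(V, \<phi>) \<in> A" "p \<in> V" by (rule chart_covering)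
  let ?F = "\<phi> ` (F \<inter> V)"
  obtain R where R: "R > 0" "cball (\<phi> p) R \<subseteq> \<phi> ` V"
    using chart_image_open[OF c(1)] c(2) open_contains_cball by blast
  let ?T = "\<phi> -` ball (\<phi> p) (R/2) \<inter> V"
  have "open ?T"
    using continuous_on_open_vimage[OF chart_open[OF c(1)], of \<phi>] chart_continuous[OF c(1)] by auto
  moreover have "p \<in> ?T" using c(2) R(1) by simp
  ultimately have "\<not> ?T \<subseteq> F" by (rule p(2))
  then obtain q where q: "q \<in> V" "\<phi> q \<in> ball (\<phi> p) (R/2)" "q \<notin> F" by blast
  let ?K = "?F \<inter> cball (\<phi> p) R"
  have pK: "\<phi> p \<in> ?K" using p(1) c(2) R(1) by auto
  have K: "compact ?K" by (rule chart_image_closed_compact[OF c(1) F(1) R(2)])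
  obtain y where y: "y \<in> ?K" "infdist (\<phi> q) ?K = dist (\<phi> q) y"
    using infdist_attains_inf[OF compact_imp_closed[OF K], of "\<phi> q"] pK by blast
  have "dist (\<phi> q) y \<le> dist (\<phi> q) (\<phi> p)" using infdist_le[OF pK, of "\<phi> q"] y by simp
  then have "y \<in> ball (\<phi> p) R"
    using q(2) dist_triangle[of "\<phi> p" y "\<phi> q"] by (simp add: dist_commute)
  then obtain e where e: "e > 0" "ball y e \<subseteq> ball (\<phi> p) R" by (meson open_ball openE)
  have "proximal_normal ?F y (\<phi> q - y)"
  proof (rule nearest_point_proximal_normal[OF _ e(1)])
    show "y \<in> ?F" using y by blast
    fix z assume z: "z \<in> ?F" "dist z y < e"
    then have "z \<in> ball y e" by (simp add: dist_commute)
    then have "z \<in> ball (\<phi> p) R" using e(2) by blast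
    then have "z \<in> ?K" using z(1) by auto
    from infdist_le[OF this, of "\<phi> q"] show "dist (\<phi> q) y \<le> dist (\<phi> q) z" using y by simp
  qed
  moreover have "\<phi> q \<notin> ?F"
  proof
    assume "\<phi> q \<in> ?F"
    then obtain q' where "q' \<in> F" "q' \<in> V" "\<phi> q = \<phi> q'" by blast
    then have "q = q'" using chart_inv[OF c(1)] q(1) by metis
    then show False using q(3) \<open>q' \<in> F\<close> by simp
  qed
  then have "\<phi> q - y \<noteq> 0" using y by auto
  ultimately show thesis by (rule that[OF c(1)])
qed

end

context horizontal_connected_bundle
begin

text \<open>The boundary point lemma applied to \<open>s = n \<bullet> (\<phi> - y) - \<bar>\<phi> - y\<bar>\<^sup>2\<close>, which is positive in the ball
  with centre \<open>y + n / 2\<close> through \<open>y\<close>. The ball of the proximal normal \<open>n\<close> has twice this radius,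
  so the smaller one touches \<open>F\<close> at no point but \<open>y\<close>, as the strict inequality \<open>s < 0\<close> demands.
  The differential of \<open>s\<close> at \<open>y\<close> is \<open>n\<close>.\<close>

lemma horizontal_tangent_to_maximum_set:
  assumes c: "(V, \<phi>) \<in> A" and u: "smooth_fun A UNIV u"
    and harmonic: "\<And>q. hdiv S gc D (hgrad A S gc u) q = 0"
    and max: "\<And>q. u q \<le> m" and X: "X \<in> sections A S UNIV"
  shows "tangent_to (V, \<phi>) {q. u q = m} X"
  unfolding tangent_to_def fst_conv snd_conv
proof (intro allI impI)
  let ?F = "\<phi> ` ({q. u q = m} \<inter> V)"
  fix y n assume n: "proximal_normal ?F y n"
  then obtain p where p: "u p = m" "p \<in> V" "y = \<phi> p" unfolding proximal_normal_def by auto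
  obtain e where e: "e > 0" "\<And>z. z \<in> ?F \<Longrightarrow> dist z y < e \<Longrightarrow> 2 * (n \<bullet> (z - y)) \<le> (norm (z - y))\<^sup>2"
    using n unfolding proximal_normal_def by blast
  define \<sigma> where "\<sigma> = (\<lambda>x. n \<bullet> (x - y) - (x - y) \<bullet> (x - y))"
  define s where "s = (\<lambda>q. \<sigma> (\<phi> q))"
  have "s = (\<lambda>q. (\<Sum>b\<in>Basis. (n \<bullet> b) * (\<phi> q \<bullet> b - y \<bullet> b))
      - (\<Sum>b\<in>Basis. (\<phi> q \<bullet> b - y \<bullet> b) * (\<phi> q \<bullet> b - y \<bullet> b)))"
    unfolding s_def \<sigma>_def by (subst (1 2) euclidean_inner) (simp add: inner_diff_left)
  moreover have "smooth_fun A V \<dots>"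
    by (intro smooth_fun_diff smooth_fun_sum smooth_fun_cmult smooth_fun_mult smooth_fun_const
        smooth_fun_coordinate[OF c] chart_open[OF c])
  ultimately have s: "smooth_fun A V s" by simp
  define N where "N = \<phi> -` ball y e \<inter> V"
  have N: "open N" "p \<in> N" "N \<subseteq> V"
    unfolding N_def using continuous_on_open_vimage[OF chart_open[OF c], of \<phi>] chart_continuous[OF c]
      p e(1) by auto
  have Xp: "X p \<in> S p" by (rule sections_mem[OF X]) simp
  have "X p s = 0"
  proof (rule hopf_lemma[OF u harmonic _ N(1,2) smooth_fun_subset[OF s N(3)] _ _ Xp])
    show "u q \<le> u p" for q using max p(1) by simp
    show "s p = 0" by (simp add: s_def \<sigma>_def p(3))
    fix q assume q: "q \<in> N" "q \<noteq> p" "u q = u p"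
    then have qV: "q \<in> V" using N(3) by blast
    have "\<phi> q \<noteq> y" using q(2) chart_inv[OF c qV] chart_inv[OF c p(2)] p(3) by metis
    then have "(norm (\<phi> q - y))\<^sup>2 > 0" by simp
    moreover have "2 * (n \<bullet> (\<phi> q - y)) \<le> (norm (\<phi> q - y))\<^sup>2"
      using q qV p(1) by (intro e(2)) (auto simp: N_def dist_commute)
    ultimately show "s q < 0" unfolding s_def \<sigma>_def power2_norm_eq_inner by linarith
  qed
  moreover have "X p s = n \<bullet> components \<phi> (X p)"
  proof -
    have "frechet_derivative (s \<circ> inv_into V \<phi>) (at (\<phi> p)) = frechet_derivative \<sigma> (at (\<phi> p))"
      by (rule frechet_derivative_cong_open[OF chart_image_open[OF c]])
        (use p(2) in \<open>auto simp: s_def chart_inv[OF c]\<close>)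
    also have "\<dots> = (\<lambda>h. n \<bullet> h)"
      unfolding \<sigma>_def p(3)
      by (rule frechet_derivative_eqI) (auto intro!: derivative_eq_intros)
    finally show ?thesis
      using tangent_apply[OF S_tangentD[OF Xp] c p(2) smooth_nearI[OF chart_open[OF c] s p(2)]] by simp
  qed
  ultimately show "coordinate_field (V, \<phi>) X y \<bullet> n = 0"
    unfolding p(3) coordinate_field_at[OF c p(2)] by (simp add: inner_commute)
qed

lemma commutator_tangent_to_maximum_set:
  assumes c: "(V, \<phi>) \<in> A" and u: "smooth_fun A UNIV u"
    and harmonic: "\<And>q. hdiv S gc D (hgrad A S gc u) q = 0"
    and max: "\<And>q. u q \<le> m" and X: "commutator A S j X"
  shows "tangent_to (V, \<phi>) {q. u q = m} X"
  using X
proof induction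
  case (horizontal X)
  then show ?case by (rule horizontal_tangent_to_maximum_set[OF c u harmonic max])
next
  case (bracket i X j Y)
  have "closed {q. u q = m}"
    using smooth_fun_continuous_on[OF open_UNIV u] by (intro closed_Collect_eq continuous_on_const)
  then show ?case
    using bracket commutator_section[OF _ S_tangent] by (intro tangent_to_lie_bracket[OF c]) auto
qed

proposition harmonic_constant:
  assumes u: "smooth_fun A UNIV u" and harmonic: "\<And>q. hdiv S gc D (hgrad A S gc u) q = 0"
    and h: "hoermander A S" and M: "compact (UNIV :: 'a set)" "connected (UNIV :: 'a set)"
  shows "u constant_on UNIV"
proof -
  have cont: "continuous_on UNIV u" by (rule smooth_fun_continuous_on[OF open_UNIV u])
  obtain p where p: "\<And>q. u q \<le> u p" using continuous_attains_sup[OF M(1) _ cont] by auto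
  define F where "F = {q. u q = u p}"
  have F: "closed F" unfolding F_def using cont by (intro closed_Collect_eq continuous_on_const)
  have "open F"
  proof (rule ccontr)
    assume "\<not> open F"
    then obtain V \<phi> y n where c: "(V, \<phi>) \<in> A" and n: "proximal_normal (\<phi> ` (F \<inter> V)) y n" "n \<noteq> 0"
      using proximal_normal_exists[OF F] by blast
    obtain q where q: "q \<in> V" "y = \<phi> q" using n unfolding proximal_normal_def by auto
    have "components \<phi> (X q) \<bullet> n = 0" if "commutator A S j X" for j X
      using commutator_tangent_to_maximum_set[OF c u harmonic p that] n(1)
      unfolding tangent_to_def F_def q(2) coordinate_field_at[OF c q(1), symmetric]
      by (simp only: fst_conv snd_conv)
    then have "n = 0" by (rule hoermander_no_normal[OF c q(1) h])
    then show False using n(2) by simp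
  qed
  then have "F = {} \<or> F = UNIV"
    using F M(2) unfolding connected_clopen by auto
  then have "u q = u p" for q unfolding F_def by auto
  then show ?thesis unfolding constant_on_def by blast
qed

end

theorem theorem2p11:
  fixes A :: "('a::{t2_space, second_countable_topology}, 'e::euclidean_space) chart set"
    and S :: "'a \<Rightarrow> 'a tvec set"
    and gc :: "'a metric_tensor"
    and L :: "('a \<Rightarrow> real) \<Rightarrow> 'a \<Rightarrow> real"
    and u :: "'a \<Rightarrow> real"
    and k :: nat
  assumes "sub_riemannian A k S gc"
    and "sublaplacian A k S gc L"
    and "hoermander A S"
    and "compact (UNIV :: 'a set)"
    and "connected (UNIV :: 'a set)"
    and "smooth_fun A UNIV u"
    and "\<forall>p. L u p = 0"
  shows "u constant_on UNIV"
proof -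
  obtain S' D where D: "horizontal_connection A S S' gc D" "L = hlaplacian A S gc D"
    using assms(2) unfolding sublaplacian_def by blast
  interpret horizontal_connected_bundle A k S gc D
  proof
    show "smooth_atlas A" "smooth_distribution A k S" "smooth_metric A S gc"
      using assms(1) unfolding sub_riemannian_def by blast+
    show "is_connection A S D" "metric_compatible A S gc D"
      using D(1) unfolding horizontal_connection_def by blast+
  qed
  show ?thesis
    using assms(7) by (intro harmonic_constant assms) (simp add: D(2) hlaplacian_def)
qed

end
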